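(* Let $T$ be a Calder\'on--Zygmund operator with an $s$-dimensional CZ kernel $K$ on $\mathbb{R}^d$ (as in the context). Suppose that the only reflectionless measure for $T$ is the zero measure. Let $\mu$ be an $s$-dimensional measure, i.e. $\mu$ is $\Lambda$-nice for some $\Lambda>0$ and $\mathcal{H}^s(\operatorname{supp}(\mu))<\infty$. If $T_\mu$ is bounded in $L^2(\mu)$ (i.e. $\mu$ is $\Lambda$-good for some $\Lambda>0$), then $\mu$ is the zero measure.
   Context: Fix integers $d\ge 2$, $d'\ge1$, reals $s\in(0,d)$, $\alpha\in(0,1]$. Let $\Omega:\mathbb{R}^d\to\mathbb{C}^{d'}$ satisfy $\Omega(\lambda x)=\lambda\Omega(x)$ for all $\lambda\in\mathbb{R}$, $|\Omega(x)|\le1$ and $|\Omega(x)-\Omega(x')|\le|x-x'|^\alpha$ for $x,x'$ on the unit sphere, and $\Omega(-x)=-\Omega(x)$. The $s$-dimensional CZ kernel is $K(x)=\Omega(x)/|x|^{s+1}$ ($x\neq0$), and for $\delta>0$, $K_\delta(x)=\Omega(x)/\max(\delta,|x|)^{s+1}$. A measure is a nonnegative locally finite Borel measure on $\mathbb{R}^d$. For functions $f,g$ (scalar or $\mathbb{C}^{d'}$-valued), $\langle f,g\rangle_\mu=\int f\cdot g\,d\mu$ (no conjugation). $\mathcal{H}^s$ is $s$-dimensional Hausdorff measure. A measure $\mu$ is $\Lambda$-nice if $\mu(B(x,r))\le\Lambda r^s$ for every ball. For such $\mu$ and $f\in L^2(\mu)$, $T_{\mu,\delta}f(x)=\int K_\delta(x-y)f(y)\,d\mu(y)$.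 $\mu$ is $\Lambda$-good if it is $\Lambda$-nice and $\|T_{\mu,\delta}\|_{L^2(\mu)\to L^2(\mu)}\le\Lambda$ for all $\delta>0$; then $\langle T_\mu f,g\rangle_\mu:=\lim_{\delta\to0}\langle T_{\mu,\delta}f,g\rangle_\mu$ exists for all $f,g\in L^2(\mu)$ and defines a bounded operator $T_\mu$ on $L^2(\mu)$ of norm $\le\Lambda$. For a $\Lambda$-good $\mu$ and a compactly supported Lipschitz $\psi$ with $\int\psi\,d\mu=0$, choose a ball $B\supset\operatorname{supp}\psi$, a point $z\in B$, and $\varphi\in L^2(\mu)$ with $\varphi\equiv1$ on $2B$ (the concentric ball of twice the radius) and $0\le\varphi\le1$, and set $\langle T_\mu(1),\psi\rangle_\mu=\langle T_\mu(\varphi),\psi\rangle_\mu+\int\psi(x)\int(1-\varphi(y))[K(x-y)-K(z-y)]\,d\mu(y)\,d\mu(x)$; this is independent of the choices. A measure $\mu$ is reflectionless (for $T$) if it is $\Lambda$-good for some $\Lambda>0$ and $\langle T_\mu(1),\psi\rangle_\mu=0$ for every compactly supported Lipschitz $\psi$ with $\int\psi\,d\mu=0$. *)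

theory Defs
  imports "HOL-Analysis.Analysis"
begin

definition CZ_angular :: "real \<Rightarrow> ('a::euclidean_space \<Rightarrow> complex ^ 'n) \<Rightarrow> bool" where
  "CZ_angular \<alpha> \<Omega> \<longleftrightarrow>
     (\<forall>c x. \<Omega> (c *\<^sub>R x) = c *\<^sub>R \<Omega> x) \<and>
     (\<forall>x. norm x = 1 \<longrightarrow> norm (\<Omega> x) \<le> 1) \<and>
     (\<forall>x x'. norm x = 1 \<longrightarrow> norm x' = 1 \<longrightarrow> norm (\<Omega> x - \<Omega> x') \<le> norm (x - x') powr \<alpha>) \<and>
     (\<forall>x. \<Omega> (- x) = - \<Omega> x)"

text \<open>The CZ kernel K(x) = Omega(x)/|x|^(s+1); at x = 0 it takes the (irrelevant) value 0.\<close>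
definition CZK :: "('a::euclidean_space \<Rightarrow> complex ^ 'n) \<Rightarrow> real \<Rightarrow> 'a \<Rightarrow> complex ^ 'n" where
  "CZK \<Omega> s x = (1 / (norm x powr (s + 1))) *\<^sub>R \<Omega> x"

definition CZK_trunc :: "('a::euclidean_space \<Rightarrow> complex ^ 'n) \<Rightarrow> real \<Rightarrow> real \<Rightarrow> 'a \<Rightarrow> complex ^ 'n" where
  "CZK_trunc \<Omega> s \<delta> x = (1 / (max \<delta> (norm x) powr (s + 1))) *\<^sub>R \<Omega> x"

definition nice_measure :: "real \<Rightarrow> 'a::euclidean_space measure \<Rightarrow> real \<Rightarrow> bool" where
  "nice_measure s \<mu> \<Lambda> \<longleftrightarrow> sets \<mu> = sets borel \<and>
     (\<forall>x r. r > 0 \<longrightarrow> emeasure \<mu> (ball x r) \<le> ennreal (\<Lambda> * r powr s))"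

definition T_trunc :: "('a::euclidean_space \<Rightarrow> complex ^ 'n) \<Rightarrow> real \<Rightarrow> 'a measure \<Rightarrow> real
    \<Rightarrow> ('a \<Rightarrow> complex) \<Rightarrow> 'a \<Rightarrow> complex ^ 'n" where
  "T_trunc \<Omega> s \<mu> \<delta> f x = (\<chi> i. \<integral> y. (CZK_trunc \<Omega> s \<delta> (x - y) $ i) * f y \<partial>\<mu>)"

definition good_measure :: "('a::euclidean_space \<Rightarrow> complex ^ 'n) \<Rightarrow> real \<Rightarrow> 'a measure \<Rightarrow> real \<Rightarrow> bool" where
  "good_measure \<Omega> s \<mu> \<Lambda> \<longleftrightarrow> nice_measure s \<mu> \<Lambda> \<and>
     (\<forall>\<delta> > 0. \<forall>f :: 'a \<Rightarrow> complex. f \<in> borel_measurable \<mu> \<longrightarrow>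
        (\<integral>\<^sup>+ x. ennreal ((norm (T_trunc \<Omega> s \<mu> \<delta> f x))\<^sup>2) \<partial>\<mu>)
          \<le> ennreal (\<Lambda>\<^sup>2) * (\<integral>\<^sup>+ x. ennreal ((norm (f x))\<^sup>2) \<partial>\<mu>))"

definition T_pair :: "('a::euclidean_space \<Rightarrow> complex ^ 'n) \<Rightarrow> real \<Rightarrow> 'a measure
    \<Rightarrow> ('a \<Rightarrow> complex) \<Rightarrow> ('a \<Rightarrow> real) \<Rightarrow> complex ^ 'n" where
  "T_pair \<Omega> s \<mu> f g = Lim (at_right 0) (\<lambda>\<delta>. \<integral> x. g x *\<^sub>R T_trunc \<Omega> s \<mu> \<delta> f x \<partial>\<mu>)"

text \<open><T_mu(1), psi>_mu for the choice of ball B = ball c r, point z and cutoff phi.\<close>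
definition T1_pair :: "('a::euclidean_space \<Rightarrow> complex ^ 'n) \<Rightarrow> real \<Rightarrow> 'a measure
    \<Rightarrow> 'a \<Rightarrow> ('a \<Rightarrow> real) \<Rightarrow> ('a \<Rightarrow> real) \<Rightarrow> complex ^ 'n" where
  "T1_pair \<Omega> s \<mu> z \<phi> \<psi> = T_pair \<Omega> s \<mu> (\<lambda>y. complex_of_real (\<phi> y)) \<psi>
     + (\<integral> x. \<psi> x *\<^sub>R (\<integral> y. (1 - \<phi> y) *\<^sub>R (CZK \<Omega> s (x - y) - CZK \<Omega> s (z - y)) \<partial>\<mu>) \<partial>\<mu>)"

definition reflectionless :: "('a::euclidean_space \<Rightarrow> complex ^ 'n) \<Rightarrow> real \<Rightarrow> 'a measure \<Rightarrow> bool" where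
  "reflectionless \<Omega> s \<mu> \<longleftrightarrow> (\<exists>\<Lambda> > 0. good_measure \<Omega> s \<mu> \<Lambda>) \<and>
     (\<forall>\<psi> :: 'a \<Rightarrow> real. \<forall>c r z \<phi>.
        (\<exists>L. lipschitz_on L UNIV \<psi>) \<and> r > 0 \<and> closure {x. \<psi> x \<noteq> 0} \<subseteq> ball c r \<and>
        (\<integral> x. \<psi> x \<partial>\<mu>) = 0 \<and> z \<in> ball c r \<and>
        \<phi> \<in> borel_measurable \<mu> \<and> (\<integral>\<^sup>+ x. ennreal ((\<phi> x)\<^sup>2) \<partial>\<mu>) < \<infinity> \<and>
        (\<forall>x. 0 \<le> \<phi> x \<and> \<phi> x \<le> 1) \<and> (\<forall>x \<in> ball c (2 * r). \<phi> x = 1)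
        \<longrightarrow> T1_pair \<Omega> s \<mu> z \<phi> \<psi> = 0)"

definition msupp :: "'a::metric_space measure \<Rightarrow> 'a set" where
  "msupp \<mu> = {x. \<forall>r > 0. emeasure \<mu> (ball x r) > 0}"

definition hausdorff_pre :: "real \<Rightarrow> real \<Rightarrow> 'a::metric_space set \<Rightarrow> ennreal" where
  "hausdorff_pre s \<delta> E = (INF U \<in> {U :: nat \<Rightarrow> 'a set. E \<subseteq> (\<Union>i. U i) \<and>
        (\<forall>i. bounded (U i) \<and> diameter (U i) \<le> \<delta>)}. (\<Sum>i. ennreal (diameter (U i) powr s)))"

definition hausdorff :: "real \<Rightarrow> 'a::metric_space set \<Rightarrow> ennreal" where
  "hausdorff s E = (SUP \<delta> \<in> {0<..}. hausdorff_pre s \<delta> E)"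

end

theory Submission
  imports Defs "HOL-Probability.Probability"
begin

text \<open>Suppose \<open>\<mu>\<close> is good and its support has finite Hausdorff measure. Then \<open>\<mu>\<close> is finite and has
  positive upper density almost everywhere. Moreover \<open>\<psi> \<mapsto> \<langle>T\<^sub>\<mu>(1), \<psi>\<rangle>\<close> is bounded in \<open>L\<^sup>2(\<mu>)\<close>, and since
  mean-zero bumps at very different scales are almost orthogonal, for almost every \<open>x\<close> it is
  \<open>o(r\<^sup>s)\<close> on mean-zero bumps of size 1 supported in \<open>B(x, r)\<close>. Hence if \<open>\<mu> \<noteq> 0\<close> there is a point at
  which suitable blow-ups have mass bounded below near the origin and \<open>\<langle>T(1), \<psi>\<rangle>\<close> tends to 0 along them.
  Blow-ups are uniformly good, so a subsequence converges vaguely to a good measure; the limit is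
  nonzero and reflectionless.\<close>

section \<open>The kernel\<close>

text \<open>Vague convergence sees only continuous functions of bounded support, while T(1) involves
  a singular kernel, a limit in \<delta> and a cutoff of unbounded reach. Each is traded for an
  error that is uniform along the blow-ups, because it depends on the measure only through
  \<Lambda>: antisymmetry of the kernel makes the truncation error O(\<delta>) on Lipschitz bumps,
  and Hoelder regularity makes the error of using a cutoff equal to 1 on a ball of radius \<rho> of
  order \<open>\<rho> powr (- \<alpha>)\<close>. A further mismatch: a bump with mean zero for the
  limit has a small nonzero mean for the blow-ups. It is corrected by a multiple of a fixed positive
  bump, which is why smallness of T(1) is proved uniformly over all bumps with a given Lipschitz
  constant. Finite Hausdorff measure enters twice, both times through coverings of the support: it
  makes the mass finite, so that the constant 1 lies in L^2 and the bound on T(1) is Cauchy-Schwarz,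
  and it forbids zero upper density on a set of positive measure, so that the limit keeps mass near
  the origin.\<close>

lemma norm_vector_scalar_mult:
  fixes v :: "complex ^ 'n"
  shows "norm (c *s v) = cmod c * norm v"
  by (simp add: norm_vec_def L2_set_def norm_mult power_mult_distrib flip: sum_distrib_left real_sqrt_mult)
     (simp add: real_sqrt_mult)

locale CZ_kernel =
  fixes \<Omega> :: "'a::euclidean_space \<Rightarrow> complex ^ 'n" and s \<alpha> :: real
  assumes s_pos: "0 < s" and \<alpha>_pos: "0 < \<alpha>" and \<alpha>_le: "\<alpha> \<le> 1" and ang: "CZ_angular \<alpha> \<Omega>"
begin

abbreviation K where "K \<equiv> CZK \<Omega> s"
abbreviation Kt where "Kt \<equiv> CZK_trunc \<Omega> s"

lemma Omega_scale: "\<Omega> (c *\<^sub>R x) = c *\<^sub>R \<Omega> x"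
  using ang by (auto simp: CZ_angular_def)

lemma Omega_minus: "\<Omega> (- x) = - \<Omega> x"
  using ang by (auto simp: CZ_angular_def)

lemma Omega_0 [simp]: "\<Omega> 0 = 0"
  using Omega_scale[of 0 0] by simp

lemma norm_Omega_le: "norm (\<Omega> x) \<le> norm x"
proof (cases "x = 0")
  case False
  have "norm (\<Omega> (sgn x)) \<le> 1"
    using ang False by (auto simp: CZ_angular_def norm_sgn)
  moreover have "\<Omega> x = norm x *\<^sub>R \<Omega> (sgn x)"
    using False by (simp flip: Omega_scale add: sgn_div_norm)
  ultimately show ?thesis
    by (simp add: mult_left_le)
qed simp

text \<open>The hypothesis controls \<Omega> on the unit sphere only. An increment splits into an
  angular part, where |sgn x - sgn z| is at most 2|x - z|/|x|, and a radial part of size at most |x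
  - z|; homogeneity then gives a bound everywhere.\<close>

lemma Omega_holder:
  assumes "x \<noteq> 0"
  shows "norm (\<Omega> x - \<Omega> z) \<le> 2 * norm x powr (1 - \<alpha>) * norm (x - z) powr \<alpha> + norm (x - z)"
proof (cases "z = 0")
  case True
  then show ?thesis using norm_Omega_le[of x] by (auto intro: order_trans)
next
  case False
  have eqx: "\<Omega> x = norm x *\<^sub>R \<Omega> (sgn x)" if "x \<noteq> 0" for x
    using that by (simp flip: Omega_scale add: sgn_div_norm)
  have sg: "norm (\<Omega> (sgn z)) \<le> 1"
    using ang False by (auto simp: CZ_angular_def norm_sgn)
  have nx: "norm x > 0" using assms by simp
  \<comment> \<open>\<open>norm x *\<^sub>R sgn z\<close> is z moved radially to the sphere through
    x, at a cost of at most |x - z|; this is the origin of the factor 2.\<close>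
  have "x - z - (norm x - norm z) *\<^sub>R sgn z = norm x *\<^sub>R (sgn x - sgn z)"
    using assms False by (simp add: sgn_div_norm algebra_simps)
  then have "norm x * norm (sgn x - sgn z) = norm (x - z - (norm x - norm z) *\<^sub>R sgn z)"
    by simp
  also have "\<dots> \<le> norm (x - z) + \<bar>norm x - norm z\<bar> * norm (sgn z)"
    by (metis norm_triangle_ineq4 norm_scaleR)
  also have "\<dots> \<le> 2 * norm (x - z)"
    using False norm_triangle_ineq3[of x z] by (simp add: norm_sgn)
  finally have d: "norm (sgn x - sgn z) \<le> 2 * norm (x - z) / norm x"
    using nx by (simp add: field_simps)
  have "norm (\<Omega> (sgn x) - \<Omega> (sgn z)) \<le> norm (sgn x - sgn z) powr \<alpha>"
    using ang assms False by (auto simp: CZ_angular_def norm_sgn)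
  also have "\<dots> \<le> (2 * norm (x - z) / norm x) powr \<alpha>"
    using d \<alpha>_pos by (intro powr_mono2) auto
  also have "\<dots> = 2 powr \<alpha> * norm (x - z) powr \<alpha> / norm x powr \<alpha>"
    using nx by (simp add: powr_mult powr_divide)
  also have "\<dots> \<le> 2 * norm (x - z) powr \<alpha> / norm x powr \<alpha>"
    using powr_mono[OF \<alpha>_le, of 2] by (intro divide_right_mono mult_right_mono) auto
  finally have h: "norm x * norm (\<Omega> (sgn x) - \<Omega> (sgn z)) \<le> norm x * (2 * norm (x - z) powr \<alpha> / norm x powr \<alpha>)"
    using nx by (intro mult_left_mono) auto
  also have "\<dots> = 2 * norm x powr (1 - \<alpha>) * norm (x - z) powr \<alpha>"
    using nx by (simp add: powr_diff)
  finally have h: "norm x * norm (\<Omega> (sgn x) - \<Omega> (sgn z)) \<le> 2 * norm x powr (1 - \<alpha>) * norm (x - z) powr \<alpha>" .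
  have "\<Omega> x - \<Omega> z = norm x *\<^sub>R (\<Omega> (sgn x) - \<Omega> (sgn z)) + (norm x - norm z) *\<^sub>R \<Omega> (sgn z)"
    using eqx[OF assms] eqx[OF False] by (simp add: algebra_simps)
  then have "norm (\<Omega> x - \<Omega> z) \<le> norm x * norm (\<Omega> (sgn x) - \<Omega> (sgn z)) + \<bar>norm x - norm z\<bar> * norm (\<Omega> (sgn z))"
    by (metis norm_triangle_ineq norm_scaleR abs_norm_cancel)
  also have "\<bar>norm x - norm z\<bar> * norm (\<Omega> (sgn z)) \<le> norm (x - z) * 1"
    using sg by (intro mult_mono norm_triangle_ineq3) auto
  finally show ?thesis using h by simp
qed

lemma continuous_Omega: "continuous_on UNIV \<Omega>"
proof -
  have "isCont \<Omega> x" for x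
  proof (cases "x = 0")
    case True
    have "(\<lambda>z. norm (\<Omega> z)) \<midarrow>0\<rightarrow> 0"
      by (rule tendsto_sandwich[of "\<lambda>_. 0" _ _ norm]) (auto intro!: norm_Omega_le tendsto_norm_zero always_eventually)
    then show ?thesis using True by (simp add: isCont_def tendsto_norm_zero_iff)
  next
    case False
    have d: "(\<lambda>z. norm (x - z)) \<midarrow>x\<rightarrow> 0"
      using tendsto_norm[OF tendsto_diff[OF tendsto_const tendsto_ident_at], of x x UNIV] by simp
    have "(\<lambda>z. norm (x - z) powr \<alpha>) \<midarrow>x\<rightarrow> 0 powr \<alpha>"
      by (rule tendsto_powr'[OF d tendsto_const]) (use \<alpha>_pos in auto)
    then have "(\<lambda>z. 2 * norm x powr (1 - \<alpha>) * norm (x - z) powr \<alpha> + norm (x - z)) \<midarrow>x\<rightarrow>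
          2 * norm x powr (1 - \<alpha>) * 0 powr \<alpha> + 0"
      by (intro tendsto_add tendsto_mult tendsto_const d)
    then have l: "(\<lambda>z. 2 * norm x powr (1 - \<alpha>) * norm (x - z) powr \<alpha> + norm (x - z)) \<midarrow>x\<rightarrow> 0"
      using \<alpha>_pos by simp
    have "(\<lambda>z. norm (\<Omega> x - \<Omega> z)) \<midarrow>x\<rightarrow> 0"
      by (rule tendsto_sandwich[OF _ _ tendsto_const l]) (auto intro!: always_eventually Omega_holder[OF False])
    then have "(\<lambda>z. norm (\<Omega> z - \<Omega> x)) \<midarrow>x\<rightarrow> 0"
      by (simp add: norm_minus_commute)
    then show ?thesis unfolding isCont_def
      by (simp add: LIM_zero_iff tendsto_norm_zero_iff)
  qed
  then show ?thesis by (simp add: continuous_at_imp_continuous_on)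
qed

lemma Omega_measurable [measurable]: "\<Omega> \<in> borel_measurable borel"
  by (rule borel_measurable_continuous_onI[OF continuous_Omega])

lemma K_measurable [measurable]: "K \<in> borel_measurable borel"
  unfolding CZK_def[abs_def] by measurable

lemma Kt_measurable [measurable]: "Kt \<delta> \<in> borel_measurable borel"
  unfolding CZK_trunc_def[abs_def] by measurable

lemma continuous_Kt:
  assumes "\<delta> > 0"
  shows "continuous_on UNIV (Kt \<delta>)"
  unfolding CZK_trunc_def[abs_def]
  using assms by (intro continuous_intros continuous_Omega) auto

lemma Kt_minus: "Kt \<delta> (- x) = - Kt \<delta> x"
  by (simp add: CZK_trunc_def Omega_minus)

lemma Kt_eq_K: "\<delta> \<le> norm x \<Longrightarrow> Kt \<delta> x = K x"
  by (simp add: CZK_trunc_def CZK_def max_absorb2)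

lemma norm_Kt_le:
  assumes "\<delta> > 0"
  shows "norm (Kt \<delta> x) \<le> max \<delta> (norm x) powr (- s)"
proof -
  define m where "m = max \<delta> (norm x)"
  have m: "m > 0" "norm x \<le> m" using assms by (auto simp: m_def)
  have "norm (Kt \<delta> x) \<le> norm x / m powr (s + 1)"
    using norm_Omega_le[of x] by (auto simp: CZK_trunc_def m_def intro!: divide_right_mono)
  also have "\<dots> \<le> m / m powr (s + 1)"
    using m by (auto intro!: divide_right_mono)
  also have "\<dots> = m powr (- s)"
    using m by (simp add: powr_add powr_minus field_simps)
  finally show ?thesis by (simp add: m_def)
qed

lemma norm_Kt_le':
  assumes "\<delta> > 0"
  shows "norm (Kt \<delta> x) \<le> \<delta> powr (- s)"
proof -
  have "max \<delta> (norm x) powr (- s) \<le> \<delta> powr (- s)"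
    using assms s_pos by (intro powr_mono2') auto
  then show ?thesis using norm_Kt_le[OF assms, of x] by linarith
qed

lemma norm_Kt_le'':
  assumes "\<delta> > 0"
  shows "norm (Kt \<delta> x) \<le> norm x powr (- s)"
proof (cases "x = 0")
  case False
  have "max \<delta> (norm x) powr (- s) \<le> norm x powr (- s)"
    using False s_pos by (intro powr_mono2') auto
  then show ?thesis using norm_Kt_le[OF assms, of x] by linarith
\<comment> \<open>At x = 0 the right-hand side is 0, because \<open>0 powr _ = 0\<close>; the kernel
  vanishes there as well since \<open>\<Omega> 0 = 0\<close>.\<close>
qed (simp add: CZK_trunc_def)

lemma K_scale:
  assumes "c > 0"
  shows "K (c *\<^sub>R x) = c powr (- s) *\<^sub>R K x"
  using assms by (simp add: CZK_def Omega_scale powr_mult powr_add powr_minus field_simps)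

lemma Kt_scale:
  assumes "c > 0" "\<delta> > 0"
  shows "Kt (c * \<delta>) (c *\<^sub>R x) = c powr (- s) *\<^sub>R Kt \<delta> x"
proof -
  have "max (c * \<delta>) (c * norm x) = c * max \<delta> (norm x)"
    using assms by (simp add: max_mult_distrib_left)
  then show ?thesis
    using assms by (simp add: CZK_trunc_def Omega_scale powr_mult powr_add powr_minus field_simps)
qed

text \<open>On an annulus away from 0 the radial factor is Lipschitz by the mean value theorem, and
  distances are at most 4, so that a Lipschitz bound can be weakened to a Hoelder bound of exponent
  \<alpha>. Homogeneity extends the estimate to all scales later.\<close>

lemma K_holder_annulus:
  "\<exists>C\<ge>0. \<forall>a b. 1/2 \<le> norm a \<and> norm a \<le> 2 \<and> 1/2 \<le> norm b \<and> norm b \<le> 2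
      \<longrightarrow> norm (K a - K b) \<le> C * norm (a - b) powr \<alpha>"
proof -
  define p where "p = s + 1"
  have p: "p > 1" using s_pos by (simp add: p_def)
  have lip: "\<bar>u powr (-p) - v powr (-p)\<bar> \<le> p * (1/2) powr (-p-1) * \<bar>u - v\<bar>"
    if "1/2 \<le> u" "1/2 \<le> v" for u v :: real
  proof -
    have "norm (u powr (-p) - v powr (-p)) \<le> (p * (1/2) powr (-p-1)) * norm (u - v)"
    proof (rule field_differentiable_bound[where S="{1/2..}" and f' = "\<lambda>x. -p * x powr (-p-1)"])
      fix z :: real assume z: "z \<in> {1/2..}"
      show "((\<lambda>x. x powr (-p)) has_field_derivative -p * z powr (-p-1)) (at z within {1/2..})"
        using z by (auto intro!: derivative_eq_intros)
      have "z powr (-p-1) \<le> (1/2) powr (-p-1)"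
        using z p by (intro powr_mono2') auto
      then show "norm (-p * z powr (-p-1)) \<le> p * (1/2) powr (-p-1)"
        using p by (simp add: abs_mult)
    qed (use that in auto)
    then show ?thesis by simp
  qed
  define L where "L = p * (1/2) powr (-p-1)"
  have L: "L \<ge> 0" using p by (simp add: L_def)
  \<comment> \<open>The 8 is the Hoelder constant of \<Omega> on the annulus: 4 from the angular
    term and 4 from t \<le> 4 t^\<alpha>. In the second summand L belongs to the radial factor, 2
    bounds |\<Omega>|, and 4 is the same conversion.\<close>
  define C where "C = (1/2) powr (-p) * 8 + 2 * L * 4"
  have "norm (K a - K b) \<le> C * norm (a - b) powr \<alpha>"
    if ab: "1/2 \<le> norm a" "norm a \<le> 2" "1/2 \<le> norm b" "norm b \<le> 2" for a b
  proof -
    define t where "t = norm (a - b)"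
    have t: "0 \<le> t" "t \<le> 4" using norm_triangle_ineq4[of a b] ab by (auto simp: t_def)
    have t1: "t \<le> 4 * t powr \<alpha>"
    proof (cases "t = 0")
      case False
      have "t = t powr \<alpha> * t powr (1 - \<alpha>)" using t False by (simp flip: powr_add)
      also have "\<dots> \<le> t powr \<alpha> * 4"
      proof (rule mult_left_mono)
        have "t powr (1 - \<alpha>) \<le> 4 powr (1 - \<alpha>)" using t \<alpha>_le by (intro powr_mono2) auto
        also have "\<dots> \<le> 4 powr 1" using \<alpha>_pos by (intro powr_mono) auto
        finally show "t powr (1 - \<alpha>) \<le> 4" by simp
      qed simp
      finally show ?thesis by simp
    qed simp
    have "norm a powr (1 - \<alpha>) \<le> 2 powr (1-\<alpha>)" using ab \<alpha>_le by (intro powr_mono2) auto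
    also have "\<dots> \<le> 2 powr 1" using \<alpha>_pos by (intro powr_mono) auto
    finally have "2 * norm a powr (1 - \<alpha>) * t powr \<alpha> \<le> 2 * 2 * t powr \<alpha>"
      by (intro mult_right_mono) auto
    moreover have "norm (\<Omega> a - \<Omega> b) \<le> 2 * norm a powr (1 - \<alpha>) * t powr \<alpha> + t"
      unfolding t_def by (rule Omega_holder) (use ab in auto)
    ultimately have om: "norm (\<Omega> a - \<Omega> b) \<le> 8 * t powr \<alpha>" using t1 by linarith
    have Keq: "K x = norm x powr (-p) *\<^sub>R \<Omega> x" for x
      using powr_minus_divide[of "norm x" p] by (simp add: CZK_def p_def)
    have "K a - K b = norm a powr (-p) *\<^sub>R (\<Omega> a - \<Omega> b) + (norm a powr (-p) - norm b powr (-p)) *\<^sub>R \<Omega> b"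
      unfolding Keq by (simp add: algebra_simps)
    then have "norm (K a - K b) \<le> norm a powr (-p) * norm (\<Omega> a - \<Omega> b) + \<bar>norm a powr (-p) - norm b powr (-p)\<bar> * norm (\<Omega> b)"
      by (metis norm_triangle_ineq norm_scaleR abs_of_nonneg powr_ge_zero)
    also have "\<dots> \<le> (1/2) powr (-p) * (8 * t powr \<alpha>) + (L * t) * 2"
    proof (intro add_mono mult_mono)
      show "norm a powr (-p) \<le> (1/2) powr (-p)" using ab p by (intro powr_mono2') auto
      have "\<bar>norm a powr (-p) - norm b powr (-p)\<bar> \<le> L * \<bar>norm a - norm b\<bar>"
        unfolding L_def by (rule lip) (use ab in auto)
      also have "\<dots> \<le> L * t" unfolding t_def using L by (intro mult_left_mono norm_triangle_ineq3) auto
      finally show "\<bar>norm a powr (-p) - norm b powr (-p)\<bar> \<le> L * t" .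
      show "norm (\<Omega> b) \<le> 2" using norm_Omega_le[of b] ab by linarith
    qed (use om L t in auto)
    also have "\<dots> \<le> (1/2) powr (-p) * (8 * t powr \<alpha>) + (L * (4 * t powr \<alpha>)) * 2"
      using t1 L by (intro add_left_mono mult_right_mono mult_left_mono) auto
    also have "\<dots> = C * t powr \<alpha>" by (simp add: C_def algebra_simps)
    finally show ?thesis by (simp add: t_def)
  qed
  moreover have "C \<ge> 0" using L by (simp add: C_def)
  ultimately show ?thesis by blast
qed

text \<open>Dividing by D = |y - c| moves x - y and z - y into the annulus, since x and z are within
  D/2 of c. Homogeneity contributes D^(-s) and the rescaled increment D^(-\<alpha>). This decay
  beats the growth exponent s of a nice measure by \<alpha>, which makes the far part of T(1)
  integrable.\<close>

lemma K_holder_far: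
  assumes "r > 0"
  shows "\<exists>C\<ge>0. \<forall>c x y z. x \<in> ball c r \<and> z \<in> ball c r \<and> dist y c \<ge> 2 * r
      \<longrightarrow> norm (K (x - y) - K (z - y)) \<le> C * dist y c powr (- s - \<alpha>)"
proof -
  obtain C where C: "C \<ge> 0" and hol: "\<And>a b. 1/2 \<le> norm a \<Longrightarrow> norm a \<le> 2 \<Longrightarrow> 1/2 \<le> norm b \<Longrightarrow> norm b \<le> 2
      \<Longrightarrow> norm (K a - K b) \<le> C * norm (a - b) powr \<alpha>"
    using K_holder_annulus by blast
  have "norm (K (x - y) - K (z - y)) \<le> (C * (2 * r) powr \<alpha>) * dist y c powr (- s - \<alpha>)"
    if h: "x \<in> ball c r" "z \<in> ball c r" "dist y c \<ge> 2 * r" for c x y z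
  proof -
    define D where "D = dist y c"
    have D: "D > 0" using h assms unfolding D_def by linarith
    have ann: "1/2 \<le> norm ((1/D) *\<^sub>R (w - y)) \<and> norm ((1/D) *\<^sub>R (w - y)) \<le> 2" if "w \<in> ball c r" for w
    proof -
      have "dist c w < r" using that by simp
      moreover have "D \<le> dist w y + dist c w" "dist w y \<le> D + dist c w"
        unfolding D_def by (metis dist_commute dist_triangle add.commute)+
      ultimately have "D / 2 \<le> dist w y" "dist w y \<le> 2 * D" using h(3) by (auto simp: D_def)
      then show ?thesis unfolding norm_scaleR using D by (simp add: dist_norm field_simps)
    qed
    have K: "K (w - y) = D powr (- s) *\<^sub>R K ((1/D) *\<^sub>R (w - y))" for w
      using K_scale[OF D, of "(1/D) *\<^sub>R (w - y)"] D by simp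
    have "norm (K (x - y) - K (z - y)) = D powr (- s) * norm (K ((1/D) *\<^sub>R (x - y)) - K ((1/D) *\<^sub>R (z - y)))"
      unfolding K[of x] K[of z] by (simp flip: scaleR_diff_right)
    also have "\<dots> \<le> D powr (- s) * (C * norm ((1/D) *\<^sub>R (x - y) - (1/D) *\<^sub>R (z - y)) powr \<alpha>)"
      using ann[OF h(1)] ann[OF h(2)] by (intro mult_left_mono hol) auto
    also have "(1/D) *\<^sub>R (x - y) - (1/D) *\<^sub>R (z - y) = (1/D) *\<^sub>R (x - z)"
      by (simp flip: scaleR_diff_right)
    also have "norm \<dots> powr \<alpha> = D powr (- \<alpha>) * norm (x - z) powr \<alpha>"
      unfolding norm_scaleR using D by (simp add: powr_divide powr_minus field_simps)
    also have "norm (x - z) powr \<alpha> \<le> (2 * r) powr \<alpha>"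
    proof (intro powr_mono2)
      have "dist x z \<le> dist c x + dist c z" by (metis dist_commute dist_triangle)
      then show "norm (x - z) \<le> 2 * r" using h by (simp add: dist_norm)
    qed (use \<alpha>_pos in auto)
    also have "D powr - s * (C * (D powr - \<alpha> * (2 * r) powr \<alpha>)) = (C * (2 * r) powr \<alpha>) * D powr (- s - \<alpha>)"
      by (simp add: powr_diff powr_minus field_simps)
    finally show ?thesis using C by (simp add: mult_left_mono D_def)
  qed
  then show ?thesis using C by (intro exI[of _ "C * (2 * r) powr \<alpha>"]) auto
qed

end

section \<open>Nice measures\<close>

lemma nice_measure_sets: "nice_measure s \<mu> \<Lambda> \<Longrightarrow> sets \<mu> = sets borel"
  by (simp add: nice_measure_def)

lemma nice_measure_space: "nice_measure s \<mu> \<Lambda> \<Longrightarrow> space \<mu> = UNIV"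
  using sets_eq_imp_space_eq[of \<mu> borel] by (simp add: nice_measure_def)

lemma nice_measure_ball: "nice_measure s \<mu> \<Lambda> \<Longrightarrow> r > 0 \<Longrightarrow> emeasure \<mu> (ball x r) \<le> ennreal (\<Lambda> * r powr s)"
  by (simp add: nice_measure_def)

lemma nice_measure_ball_finite: "nice_measure s \<mu> \<Lambda> \<Longrightarrow> emeasure \<mu> (ball x r) < \<infinity>"
  using nice_measure_ball[of s \<mu> \<Lambda> r x] by (cases "r > 0") (auto simp: less_top[symmetric] top_unique ball_empty)

lemma nice_measure_ball_real:
  assumes "nice_measure s \<mu> \<Lambda>" "0 \<le> \<Lambda>"
  shows "measure \<mu> (ball x r) \<le> \<Lambda> * \<bar>r\<bar> powr s"
proof (cases "r > 0")
  case True
  then show ?thesis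
    using nice_measure_ball[OF assms(1) True, of x] assms(2)
    by (auto simp: measure_def intro!: enn2real_leI)
next
  case False
  then show ?thesis using assms(2) by (auto simp: ball_empty)
qed

lemma nice_measure_sigma_finite:
  assumes "nice_measure s \<mu> \<Lambda>"
  shows "sigma_finite_measure \<mu>"
proof
  have "(\<Union>n::nat. ball 0 (real n)) = (UNIV :: 'a set)"
    using reals_Archimedean2 by (auto simp: dist_norm)
  then show "\<exists>A. countable A \<and> A \<subseteq> sets \<mu> \<and> \<Union> A = space \<mu> \<and> (\<forall>a\<in>A. emeasure \<mu> a \<noteq> \<infinity>)"
    using nice_measure_ball_finite[OF assms, of 0] nice_measure_space[OF assms] nice_measure_sets[OF assms]
    by (intro exI[of _ "range (\<lambda>n::nat. ball 0 (real n))"]) (auto simp: less_top)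
qed

lemma nice_measure_integrable_bounded_support:
  fixes g :: "'a::euclidean_space \<Rightarrow> 'b::{banach, second_countable_topology}"
  assumes "nice_measure s \<mu> \<Lambda>" "g \<in> borel_measurable borel"
    and "\<And>x. norm (g x) \<le> B" "\<And>x. x \<notin> ball c r \<Longrightarrow> g x = 0"
  shows "integrable \<mu> g"
  using assms nice_measure_ball_finite[OF assms(1), of c r] nice_measure_sets[OF assms(1)]
  by (intro integrableI_bounded_set[where A="ball c r" and B=B]) (auto cong: measurable_cong_sets)

lemma nice_measure_norm_integral_le:
  fixes g :: "'a::euclidean_space \<Rightarrow> 'b::{banach, second_countable_topology}"
  assumes nice: "nice_measure s \<mu> \<Lambda>" "0 \<le> \<Lambda>"
    and g: "\<And>x. norm (g x) \<le> B * indicator (ball c r) x" "B \<ge> 0"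
  shows "norm (\<integral>x. g x \<partial>\<mu>) \<le> B * (\<Lambda> * \<bar>r\<bar> powr s)"
proof (cases "integrable \<mu> g")
  case True
  have i: "integrable \<mu> (\<lambda>x. B * indicator (ball c r) x :: real)"
    using nice_measure_ball_finite[OF nice(1)] nice_measure_sets[OF nice(1)]
    by (intro integrable_mult_right integrable_real_indicator) auto
  have "norm (\<integral>x. g x \<partial>\<mu>) \<le> (\<integral>x. norm (g x) \<partial>\<mu>)"
    by (rule integral_norm_bound)
  also have "\<dots> \<le> (\<integral>x. B * indicator (ball c r) x \<partial>\<mu>)"
    by (rule integral_mono[OF integrable_norm[OF True] i]) (use g in auto)
  also have "\<dots> = B * measure \<mu> (ball c r)"
    using nice_measure_space[OF nice(1)] by simp
  also have "\<dots> \<le> B * (\<Lambda> * \<bar>r\<bar> powr s)"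
    by (intro mult_left_mono nice_measure_ball_real[OF nice] g)
  finally show ?thesis .
\<comment> \<open>A non-integrable function has Bochner integral 0, so the bound is trivial in this
  case.\<close>
qed (use assms in \<open>auto simp: not_integrable_integral_eq\<close>)

text \<open>Sum over dyadic annuli: the annulus at distance 2^k \<rho> has mass at most \<Lambda>
  (2^(k+1) \<rho>)^s, so its contribution is of order (2^k \<rho>)^(-b). The factor
  \<open>2 powr s\<close> comes from the outer radius, the denominator from the geometric
  series.\<close>

lemma nice_measure_tail:
  assumes nice: "nice_measure s \<mu> \<Lambda>" "0 \<le> \<Lambda>" and "b > 0" "\<rho> > 0" "s > 0"
  shows "(\<integral>\<^sup>+y. indicator {y. \<rho> \<le> dist y z} y * ennreal (dist y z powr (- s - b)) \<partial>\<mu>)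
    \<le> ennreal (\<Lambda> * 2 powr s / (1 - 2 powr (- b)) * \<rho> powr (- b))"
proof -
  note [measurable_cong] = nice_measure_sets[OF nice(1)]
  let ?t = "\<lambda>k y. ennreal ((2 ^ k * \<rho>) powr (- s - b)) * indicator (ball z (2 ^ (Suc k) * \<rho>)) y"
  have bs: "ball w r \<in> sets \<mu>" for w r
    unfolding nice_measure_sets[OF nice(1)] by (rule borel_open[OF open_ball])
  have m: "?t k \<in> borel_measurable \<mu>" for k
    by (intro borel_measurable_times_ennreal borel_measurable_const borel_measurable_indicator bs)
  have le: "indicator {y. \<rho> \<le> dist y z} y * ennreal (dist y z powr (- s - b)) \<le> (\<Sum>k. ?t k y)" for y
  proof (cases "\<rho> \<le> dist y z")
    case True
    let ?P = "\<lambda>k::nat. dist y z < 2 ^ (Suc k) * \<rho>"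
    obtain n where "dist y z / \<rho> < 2 ^ n" using real_arch_pow[of 2 "dist y z / \<rho>"] by auto
    moreover have "(2::real) ^ n \<le> 2 ^ Suc n" by simp
    ultimately have "dist y z / \<rho> < 2 ^ Suc n" by linarith
    then have ex: "?P n" using assms by (simp add: field_simps)
    \<comment> \<open>k indexes the dyadic annulus of y: \<open>?P k\<close> puts y into the outer
      ball, and minimality (or \<rho> \<le> |y - z| when k = 0) gives the lower bound on the
      distance.\<close>
    define k where "k = (LEAST k. ?P k)"
    have Pk: "?P k" unfolding k_def by (rule LeastI[of ?P, OF ex])
    have lo: "2 ^ k * \<rho> \<le> dist y z"
    proof (cases k)
      case 0 then show ?thesis using True by simp
    next
      case (Suc m)
      then have "\<not> ?P m" unfolding k_def using not_less_Least[of m ?P] by auto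
      then show ?thesis using Suc by simp
    qed
    have "dist y z powr (- s - b) \<le> (2 ^ k * \<rho>) powr (- s - b)"
      using lo assms by (intro powr_mono2') auto
    then have "indicator {y. \<rho> \<le> dist y z} y * ennreal (dist y z powr (- s - b)) \<le> ?t k y"
      using True Pk by (simp add: dist_commute ennreal_leI)
    also have "\<dots> = sum (\<lambda>k. ?t k y) {k}"
      by (simp only: sum.insert finite.emptyI empty_iff not_False_eq_True sum.empty add_0_right)
    also have "\<dots> \<le> (\<Sum>k. ?t k y)"
      by (rule sum_le_suminf) (simp_all only: summableI finite.intros zero_le)
    finally show ?thesis .
  qed simp
  have "(\<integral>\<^sup>+y. indicator {y. \<rho> \<le> dist y z} y * ennreal (dist y z powr (- s - b)) \<partial>\<mu>) \<le> (\<integral>\<^sup>+y. (\<Sum>k. ?t k y) \<partial>\<mu>)"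
    by (rule nn_integral_mono) (rule le)
  also have "\<dots> = (\<Sum>k. \<integral>\<^sup>+y. ?t k y \<partial>\<mu>)"
    by (rule nn_integral_suminf, rule m)
  also have "\<dots> = (\<Sum>k. ennreal ((2 ^ k * \<rho>) powr (- s - b)) * emeasure \<mu> (ball z (2 ^ (Suc k) * \<rho>)))"
    by (rule suminf_cong, rule nn_integral_cmult_indicator) (simp only: bs)
  also have "\<dots> \<le> (\<Sum>k. ennreal (\<Lambda> * 2 powr s * \<rho> powr (- b) * (2 powr (- b)) ^ k))"
  proof (intro suminf_le summableI)
    fix k
    have "ennreal ((2 ^ k * \<rho>) powr (- s - b)) * emeasure \<mu> (ball z (2 ^ (Suc k) * \<rho>))
       \<le> ennreal ((2 ^ k * \<rho>) powr (- s - b)) * ennreal (\<Lambda> * (2 ^ (Suc k) * \<rho>) powr s)"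
      using assms by (intro mult_left_mono nice_measure_ball[OF nice(1)]) auto
    also have "\<dots> = ennreal (\<Lambda> * ((2 ^ k * \<rho>) powr (- s - b) * (2 * (2 ^ k * \<rho>)) powr s))"
      using assms by (simp add: algebra_simps flip: ennreal_mult)
    also have "(2 ^ k * \<rho>) powr (- s - b) * (2 * (2 ^ k * \<rho>)) powr s = 2 powr s * (2 ^ k * \<rho>) powr (- b)"
    proof -
      have "(2 * (2 ^ k * \<rho>)) powr s = 2 powr s * (2 ^ k * \<rho>) powr s"
        using assms by (intro powr_mult)
      moreover have "(2 ^ k * \<rho>) powr (- s - b) * (2 ^ k * \<rho>) powr s = (2 ^ k * \<rho>) powr (- b)"
        by (simp add: powr_add[symmetric])
      ultimately show ?thesis by (metis mult.left_commute)
    qed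
    also have "(2 ^ k * \<rho>) powr (- b) = \<rho> powr (- b) * (2 powr (- b)) ^ k"
    proof -
      have "(2 ^ k :: real) powr (- b) = (2 powr real k) powr (- b)"
        by (subst powr_realpow) auto
      also have "\<dots> = (2 powr (- b)) powr real k" by (simp only: powr_powr mult.commute)
      also have "\<dots> = (2 powr (- b)) ^ k" by (rule powr_realpow) simp
      finally show ?thesis using assms by (simp only: powr_mult) (simp only: mult.commute)
    qed
    finally show "ennreal ((2 ^ k * \<rho>) powr (- s - b)) * emeasure \<mu> (ball z (2 ^ (Suc k) * \<rho>))
      \<le> ennreal (\<Lambda> * 2 powr s * \<rho> powr (- b) * (2 powr (- b)) ^ k)" by (simp add: mult.assoc)
  qed
  also have "\<dots> = ennreal (\<Lambda> * 2 powr s * \<rho> powr (- b) * (1 / (1 - 2 powr (- b))))"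
  proof (rule suminf_ennreal_eq)
    have "(2::real) powr (- b) < 2 powr 0" using assms by (intro powr_less_mono) auto
    then show "(\<lambda>k. \<Lambda> * 2 powr s * \<rho> powr (- b) * (2 powr (- b)) ^ k) sums (\<Lambda> * 2 powr s * \<rho> powr (- b) * (1 / (1 - 2 powr (- b))))"
      by (intro sums_mult geometric_sums) auto
  qed (use assms in auto)
  finally show ?thesis by (simp add: field_simps)
qed

section \<open>Truncated operators on L^2\<close>

lemma borel_measurable_vector_scalar_mult [measurable (raw)]:
  fixes v :: "'b \<Rightarrow> complex ^ 'n"
  assumes [measurable]: "f \<in> borel_measurable M" "v \<in> borel_measurable M"
  shows "(\<lambda>x. f x *s v x) \<in> borel_measurable M"
proof -
  have "continuous_on UNIV (\<lambda>p::complex \<times> (complex ^ 'n). fst p *s snd p)"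
    unfolding vector_scalar_mult_def by (intro continuous_intros)
  from borel_measurable_continuous_onI[OF this]
  have "(\<lambda>p::complex \<times> (complex ^ 'n). fst p *s snd p) \<in> borel_measurable (borel \<Otimes>\<^sub>M borel)"
    by (simp add: borel_prod)
  from measurable_compose[OF _ this, of "\<lambda>x. (f x, v x)" M] show ?thesis by simp
qed

lemma of_real_vector_scalar_mult: "complex_of_real c *s (v :: complex ^ 'n) = c *\<^sub>R v"
  by (simp add: vec_eq_iff flip: scaleR_conv_of_real)

text \<open>Uses ab \<le> a^2 + b^2 instead of Cauchy-Schwarz. The purpose is only to see that
  truncated integrals converge and are bounded uniformly in the outer variable, for which a sum of
  squares is as good as a product of norms.\<close>

lemma integrable_product_bound:
  fixes g :: "'a \<Rightarrow> 'b::{banach, second_countable_topology}"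
  assumes [measurable]: "g \<in> borel_measurable M" "a \<in> borel_measurable M" "b \<in> borel_measurable M"
    and g: "\<And>x. norm (g x) \<le> a x * b x"
    and a: "(\<integral>\<^sup>+x. ennreal ((a x)\<^sup>2) \<partial>M) < \<infinity>" and b: "(\<integral>\<^sup>+x. ennreal ((b x)\<^sup>2) \<partial>M) \<le> ennreal B"
  shows "integrable M g"
    and "norm (\<integral>x. g x \<partial>M) \<le> enn2real (\<integral>\<^sup>+x. ennreal ((a x)\<^sup>2) \<partial>M) + enn2real (ennreal B)"
proof -
  have "norm (g x) \<le> (a x)\<^sup>2 + (b x)\<^sup>2" for x
    using g[of x] sum_squares_bound[of "a x" "b x"] sum_power2_ge_zero[of "a x" "b x"] by linarith
  then have le: "(\<integral>\<^sup>+x. ennreal (norm (g x)) \<partial>M) \<le> (\<integral>\<^sup>+x. ennreal ((a x)\<^sup>2) + ennreal ((b x)\<^sup>2) \<partial>M)"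
    by (intro nn_integral_mono) (auto simp flip: ennreal_plus intro!: ennreal_leI)
  also have "\<dots> = (\<integral>\<^sup>+x. ennreal ((a x)\<^sup>2) \<partial>M) + (\<integral>\<^sup>+x. ennreal ((b x)\<^sup>2) \<partial>M)"
    by (rule nn_integral_add) auto
  also have "\<dots> \<le> (\<integral>\<^sup>+x. ennreal ((a x)\<^sup>2) \<partial>M) + ennreal B"
    using b by (rule add_left_mono)
  finally have fin: "(\<integral>\<^sup>+x. ennreal (norm (g x)) \<partial>M) \<le> (\<integral>\<^sup>+x. ennreal ((a x)\<^sup>2) \<partial>M) + ennreal B" .
  also have "\<dots> < \<infinity>" using a by simp
  finally show int: "integrable M g" by (intro integrableI_bounded) auto
  have "norm (\<integral>x. g x \<partial>M) \<le> (\<integral>x. norm (g x) \<partial>M)" by (rule integral_norm_bound)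
  also have "\<dots> = enn2real (\<integral>\<^sup>+x. ennreal (norm (g x)) \<partial>M)"
    by (rule integral_eq_nn_integral) auto
  also have "\<dots> \<le> enn2real ((\<integral>\<^sup>+x. ennreal ((a x)\<^sup>2) \<partial>M) + ennreal B)"
    using fin a by (intro enn2real_mono) auto
  also have "\<dots> = enn2real (\<integral>\<^sup>+x. ennreal ((a x)\<^sup>2) \<partial>M) + enn2real (ennreal B)"
    using a by (intro enn2real_plus) auto
  finally show "norm (\<integral>x. g x \<partial>M) \<le> enn2real (\<integral>\<^sup>+x. ennreal ((a x)\<^sup>2) \<partial>M) + enn2real (ennreal B)" .
qed

context CZ_kernel
begin

text \<open>Near x the truncated kernel is at most \<delta>^(-s) and the ball has finite mass; far
  away its square decays like the power -2s, so \<open>nice_measure_tail\<close> applies with b = s.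
  Hence T_\<delta> f converges absolutely at every point, not just almost everywhere, for each f in
  L^2.\<close>

lemma Kt_square_bound:
  assumes "\<delta> > 0" "\<Lambda> \<ge> 0"
  shows "\<exists>B\<ge>0. \<forall>\<mu>. nice_measure s \<mu> \<Lambda> \<longrightarrow> (\<forall>x. (\<integral>\<^sup>+y. ennreal ((norm (Kt \<delta> (x - y)))\<^sup>2) \<partial>\<mu>) \<le> ennreal B)"
proof (intro exI allI impI conjI)
  let ?B = "\<delta> powr (-s) * \<delta> powr (-s) * (\<Lambda> * \<delta> powr s) + \<Lambda> * 2 powr s / (1 - 2 powr (- s)) * \<delta> powr (- s)"
  have "(2::real) powr (- s) < 2 powr 0" using s_pos by (intro powr_less_mono) auto
  then have p: "0 \<le> \<Lambda> * 2 powr s / (1 - 2 powr (- s)) * \<delta> powr (- s)" using assms by auto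
  then show "?B \<ge> 0" using assms by (intro add_nonneg_nonneg) auto
  fix \<mu> :: "'a measure" and x assume nice: "nice_measure s \<mu> \<Lambda>"
  note [measurable_cong] = nice_measure_sets[OF nice]
  have "ennreal ((norm (Kt \<delta> (x - y)))\<^sup>2) \<le> ennreal (\<delta> powr (-s) * \<delta> powr (-s)) * indicator (ball x \<delta>) y
      + indicator {y. \<delta> \<le> dist y x} y * ennreal (dist y x powr (- s - s))" for y
  proof (cases "\<delta> \<le> dist y x")
    case True
    have "(norm (Kt \<delta> (x - y)))\<^sup>2 \<le> (dist y x powr (- s))\<^sup>2"
      using norm_Kt_le''[OF assms(1), of "x - y"] by (intro power_mono) (auto simp: dist_norm norm_minus_commute)
    also have "\<dots> = dist y x powr (- s - s)"
      by (simp add: power2_eq_square flip: powr_add)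
    finally show ?thesis using True by (simp add: dist_commute ennreal_leI)
  next
    case False
    have "(norm (Kt \<delta> (x - y)))\<^sup>2 \<le> (\<delta> powr (- s))\<^sup>2"
      using norm_Kt_le'[OF assms(1), of "x - y"] by (intro power_mono) auto
    then show ?thesis using False by (simp add: dist_commute ennreal_leI power2_eq_square)
  qed
  then have "(\<integral>\<^sup>+y. ennreal ((norm (Kt \<delta> (x - y)))\<^sup>2) \<partial>\<mu>) \<le> (\<integral>\<^sup>+y. ennreal (\<delta> powr (-s) * \<delta> powr (-s)) * indicator (ball x \<delta>) y
      + indicator {y. \<delta> \<le> dist y x} y * ennreal (dist y x powr (- s - s)) \<partial>\<mu>)"
    by (intro nn_integral_mono) auto
  also have "\<dots> = ennreal (\<delta> powr (-s) * \<delta> powr (-s)) * emeasure \<mu> (ball x \<delta>)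
      + (\<integral>\<^sup>+y. indicator {y. \<delta> \<le> dist y x} y * ennreal (dist y x powr (- s - s)) \<partial>\<mu>)"
  proof (subst nn_integral_add)
    have "closed {y. \<delta> \<le> dist y x}"
      by (intro closed_Collect_le continuous_intros)
    then have [measurable]: "{y. \<delta> \<le> dist y x} \<in> sets borel" by (rule borel_closed)
    show "(\<lambda>y. indicator {y. \<delta> \<le> dist y x} y * ennreal (dist y x powr (- s - s))) \<in> borel_measurable \<mu>"
      by measurable
    have "ball x \<delta> \<in> sets \<mu>" unfolding nice_measure_sets[OF nice] by simp
    then show "(\<lambda>y. ennreal (\<delta> powr (-s) * \<delta> powr (-s)) * indicator (ball x \<delta>) y) \<in> borel_measurable \<mu>"
      "(\<integral>\<^sup>+y. ennreal (\<delta> powr (-s) * \<delta> powr (-s)) * indicator (ball x \<delta>) y \<partial>\<mu>)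
        + (\<integral>\<^sup>+y. indicator {y. \<delta> \<le> dist y x} y * ennreal (dist y x powr (- s - s)) \<partial>\<mu>)
        = ennreal (\<delta> powr (-s) * \<delta> powr (-s)) * emeasure \<mu> (ball x \<delta>)
        + (\<integral>\<^sup>+y. indicator {y. \<delta> \<le> dist y x} y * ennreal (dist y x powr (- s - s)) \<partial>\<mu>)"
      by (auto simp only: nn_integral_cmult_indicator intro!: borel_measurable_times_ennreal borel_measurable_const borel_measurable_indicator)
  qed
  also have "\<dots> \<le> ennreal (\<delta> powr (-s) * \<delta> powr (-s)) * ennreal (\<Lambda> * \<delta> powr s)
      + ennreal (\<Lambda> * 2 powr s / (1 - 2 powr (- s)) * \<delta> powr (- s))"
    using assms s_pos by (intro add_mono mult_left_mono nice_measure_ball[OF nice] nice_measure_tail[OF nice]) auto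
  also have "\<dots> = ennreal ?B"
    using assms p by (subst ennreal_plus) (auto simp: ennreal_mult[symmetric])
  finally show "(\<integral>\<^sup>+y. ennreal ((norm (Kt \<delta> (x - y)))\<^sup>2) \<partial>\<mu>) \<le> ennreal ?B" .
qed

text \<open>\<open>T_trunc\<close> is defined coordinate by coordinate. Integrability allows the
  coordinates to be collected into one vector-valued integral, the form to which norm estimates and
  limit theorems apply.\<close>

lemma T_trunc_eq:
  assumes "integrable \<mu> (\<lambda>y. f y *s Kt \<delta> (x - y))"
  shows "T_trunc \<Omega> s \<mu> \<delta> f x = (\<integral>y. f y *s Kt \<delta> (x - y) \<partial>\<mu>)"
  unfolding vec_eq_iff
proof
  fix i
  have "(\<integral>y. f y *s Kt \<delta> (x - y) \<partial>\<mu>) $ i = (\<integral>y. (f y *s Kt \<delta> (x - y)) $ i \<partial>\<mu>)"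
    by (rule integral_bounded_linear[OF bounded_linear_vec_nth assms, symmetric])
  then show "T_trunc \<Omega> s \<mu> \<delta> f x $ i = (\<integral>y. f y *s Kt \<delta> (x - y) \<partial>\<mu>) $ i"
    by (simp add: T_trunc_def mult.commute)
qed

lemma T_trunc_L2:
  assumes nice: "nice_measure s \<mu> \<Lambda>" "0 \<le> \<Lambda>" and \<delta>: "\<delta> > 0"
    and f: "f \<in> borel_measurable borel" "(\<integral>\<^sup>+y. ennreal ((cmod (f y))\<^sup>2) \<partial>\<mu>) < \<infinity>"
  shows "integrable \<mu> (\<lambda>y. f y *s Kt \<delta> (x - y))"
    and "T_trunc \<Omega> s \<mu> \<delta> f x = (\<integral>y. f y *s Kt \<delta> (x - y) \<partial>\<mu>)"
    and "T_trunc \<Omega> s \<mu> \<delta> f \<in> borel_measurable borel"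
    and "\<exists>B\<ge>0. \<forall>x. norm (T_trunc \<Omega> s \<mu> \<delta> f x) \<le> B"
proof -
  interpret sigma_finite_measure \<mu> by (rule nice_measure_sigma_finite[OF nice(1)])
  note [measurable] = f(1)
  note [measurable_cong] = nice_measure_sets[OF nice(1)]
  obtain B where B: "B \<ge> 0" "\<And>x. (\<integral>\<^sup>+y. ennreal ((norm (Kt \<delta> (x - y)))\<^sup>2) \<partial>\<mu>) \<le> ennreal B"
    using Kt_square_bound[OF \<delta> nice(2)] nice(1) by blast
  have int: "integrable \<mu> (\<lambda>y. f y *s Kt \<delta> (x - y))" for x
    by (rule integrable_product_bound[where a="\<lambda>y. cmod (f y)" and b="\<lambda>y. norm (Kt \<delta> (x - y))", OF _ _ _ _ f(2) B(2)])
       (auto simp: norm_vector_scalar_mult)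
  have nb: "norm (\<integral>y. f y *s Kt \<delta> (x - y) \<partial>\<mu>) \<le> enn2real (\<integral>\<^sup>+x. ennreal ((cmod (f x))\<^sup>2) \<partial>\<mu>) + enn2real (ennreal B)" for x
    by (rule integrable_product_bound(2)[where a="\<lambda>y. cmod (f y)" and b="\<lambda>y. norm (Kt \<delta> (x - y))", OF _ _ _ _ f(2) B(2)])
       (auto simp: norm_vector_scalar_mult)
  show "integrable \<mu> (\<lambda>y. f y *s Kt \<delta> (x - y))" by (rule int)
  have eq: "T_trunc \<Omega> s \<mu> \<delta> f x = (\<integral>y. f y *s Kt \<delta> (x - y) \<partial>\<mu>)" for x
    by (rule T_trunc_eq[OF int])
  show "T_trunc \<Omega> s \<mu> \<delta> f x = (\<integral>y. f y *s Kt \<delta> (x - y) \<partial>\<mu>)" by (rule eq)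
  have "(\<lambda>x. \<integral>y. f y *s Kt \<delta> (x - y) \<partial>\<mu>) \<in> borel_measurable borel"
    by measurable
  then show "T_trunc \<Omega> s \<mu> \<delta> f \<in> borel_measurable borel"
    by (simp add: eq[abs_def])
  show "\<exists>B\<ge>0. \<forall>x. norm (T_trunc \<Omega> s \<mu> \<delta> f x) \<le> B"
    unfolding eq
    by (intro exI[of _ "enn2real (\<integral>\<^sup>+x. ennreal ((cmod (f x))\<^sup>2) \<partial>\<mu>) + enn2real (ennreal B)"] conjI allI nb)
       (auto intro!: add_nonneg_nonneg)
qed

end

section \<open>Truncated pairings\<close>

definition lipschitz_bump :: "real \<Rightarrow> 'a::metric_space \<Rightarrow> real \<Rightarrow> ('a \<Rightarrow> real) \<Rightarrow> bool" where
  "lipschitz_bump L c r \<psi> \<longleftrightarrow> L-lipschitz_on UNIV \<psi> \<and> (\<forall>x. x \<notin> ball c r \<longrightarrow> \<psi> x = 0)"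

lemma lipschitz_bumpD:
  assumes "lipschitz_bump L c r \<psi>"
  shows "\<bar>\<psi> x - \<psi> y\<bar> \<le> L * dist x y" "x \<notin> ball c r \<Longrightarrow> \<psi> x = 0" "L \<ge> 0"
  using assms lipschitz_onD[of L UNIV \<psi> x y] lipschitz_on_nonneg[of L UNIV \<psi>]
  by (auto simp: lipschitz_bump_def dist_real_def)

lemma lipschitz_bump_measurable:
  "lipschitz_bump L c r \<psi> \<Longrightarrow> \<psi> \<in> borel_measurable borel"
  by (auto simp: lipschitz_bump_def intro!: borel_measurable_continuous_onI intro: lipschitz_on_continuous_on)

text \<open>A point of the bounding sphere, where \<psi> vanishes, has distance at most 2r from
  every point of the ball.\<close>

lemma lipschitz_bump_bound:
  fixes c :: "'a::euclidean_space"
  assumes "lipschitz_bump L c r \<psi>" "r > 0"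
  shows "\<bar>\<psi> x\<bar> \<le> 2 * L * r"
proof (cases "x \<in> ball c r")
  case True
  obtain b :: 'a where b: "b \<in> Basis" using nonempty_Basis by blast
  define y where "y = c + r *\<^sub>R b"
  have y: "dist c y = r" using b assms by (simp add: y_def dist_norm)
  then have "\<psi> y = 0" using lipschitz_bumpD(2)[OF assms(1), of y] by simp
  then have "\<bar>\<psi> x\<bar> \<le> L * dist x y" using lipschitz_bumpD(1)[OF assms(1), of x y] by simp
  also have "\<dots> \<le> L * (2 * r)"
    using dist_triangle[of x y c] True y lipschitz_bumpD(3)[OF assms(1)]
    by (intro mult_left_mono) (auto simp: dist_commute)
  finally show ?thesis by simp
next
  case False
  then show ?thesis using lipschitz_bumpD[OF assms(1)] assms(2) by auto
qed

lemma lipschitz_bump_integrable: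
  fixes c :: "'a::euclidean_space"
  assumes "nice_measure s \<mu> \<Lambda>" "lipschitz_bump L c r \<psi>" "r > 0"
  shows "integrable \<mu> \<psi>"
  by (rule nice_measure_integrable_bounded_support[OF assms(1) lipschitz_bump_measurable[OF assms(2)], where B="2 * L * r"])
     (use lipschitz_bump_bound[OF assms(2,3)] lipschitz_bumpD(2)[OF assms(2)] in auto)

definition square_integrable :: "'a::euclidean_space measure \<Rightarrow> ('a \<Rightarrow> real) \<Rightarrow> bool" where
  "square_integrable \<mu> \<phi> \<longleftrightarrow> \<phi> \<in> borel_measurable borel \<and> (\<integral>\<^sup>+x. ennreal ((\<phi> x)\<^sup>2) \<partial>\<mu>) < \<infinity>"

context CZ_kernel
begin

text \<open>The pairing of T_\<delta> \<phi> with \<psi> before the limit in \<delta>. Estimates are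
  made on \<open>A\<close>, because \<open>TT\<close> is a bare \<open>Lim\<close> and carries no
  information until convergence is established.\<close>

definition A :: "'a measure \<Rightarrow> real \<Rightarrow> ('a \<Rightarrow> real) \<Rightarrow> ('a \<Rightarrow> real) \<Rightarrow> complex ^ 'n" where
  "A \<mu> \<delta> \<phi> \<psi> = (\<integral>x. \<psi> x *\<^sub>R T_trunc \<Omega> s \<mu> \<delta> (\<lambda>y. complex_of_real (\<phi> y)) x \<partial>\<mu>)"

abbreviation TT where "TT \<mu> \<phi> \<psi> \<equiv> T_pair \<Omega> s \<mu> (\<lambda>y. complex_of_real (\<phi> y)) \<psi>"

lemma T_pair_eq_Lim: "TT \<mu> \<phi> \<psi> = Lim (at_right 0) (\<lambda>\<delta>. A \<mu> \<delta> \<phi> \<psi>)"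
  by (simp add: T_pair_def A_def)

lemma T_trunc_real:
  assumes nice: "nice_measure s \<mu> \<Lambda>" "0 \<le> \<Lambda>" and \<delta>: "\<delta> > 0" and \<phi>: "square_integrable \<mu> \<phi>"
  shows "integrable \<mu> (\<lambda>y. \<phi> y *\<^sub>R Kt \<delta> (x - y))"
    and "T_trunc \<Omega> s \<mu> \<delta> (\<lambda>y. complex_of_real (\<phi> y)) x = (\<integral>y. \<phi> y *\<^sub>R Kt \<delta> (x - y) \<partial>\<mu>)"
    and "T_trunc \<Omega> s \<mu> \<delta> (\<lambda>y. complex_of_real (\<phi> y)) \<in> borel_measurable borel"
    and "\<exists>B\<ge>0. \<forall>x. norm (T_trunc \<Omega> s \<mu> \<delta> (\<lambda>y. complex_of_real (\<phi> y)) x) \<le> B"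
proof -
  have [measurable]: "\<phi> \<in> borel_measurable borel" using \<phi> by (simp add: square_integrable_def)
  have "(\<lambda>y. complex_of_real (\<phi> y)) \<in> borel_measurable borel"
    "(\<integral>\<^sup>+y. ennreal ((cmod (complex_of_real (\<phi> y)))\<^sup>2) \<partial>\<mu>) < \<infinity>"
    using \<phi> by (auto simp: square_integrable_def)
  note * = T_trunc_L2[OF nice \<delta> this, unfolded of_real_vector_scalar_mult]
  show "integrable \<mu> (\<lambda>y. \<phi> y *\<^sub>R Kt \<delta> (x - y))"
    and "T_trunc \<Omega> s \<mu> \<delta> (\<lambda>y. complex_of_real (\<phi> y)) x = (\<integral>y. \<phi> y *\<^sub>R Kt \<delta> (x - y) \<partial>\<mu>)"
    and "T_trunc \<Omega> s \<mu> \<delta> (\<lambda>y. complex_of_real (\<phi> y)) \<in> borel_measurable borel"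
    and "\<exists>B\<ge>0. \<forall>x. norm (T_trunc \<Omega> s \<mu> \<delta> (\<lambda>y. complex_of_real (\<phi> y)) x) \<le> B"
    by (rule *)+
qed

lemma bump_T_trunc_integrable:
  assumes nice: "nice_measure s \<mu> \<Lambda>" "0 \<le> \<Lambda>" and \<delta>: "\<delta> > 0" and \<phi>: "square_integrable \<mu> \<phi>"
    and \<psi>: "lipschitz_bump L c r \<psi>" "r > 0"
  shows "integrable \<mu> (\<lambda>x. \<psi> x *\<^sub>R T_trunc \<Omega> s \<mu> \<delta> (\<lambda>y. complex_of_real (\<phi> y)) x)"
proof -
  note [measurable] = T_trunc_real(3)[OF nice \<delta> \<phi>] lipschitz_bump_measurable[OF \<psi>(1)]
  obtain B where B: "B \<ge> 0" "\<And>x. norm (T_trunc \<Omega> s \<mu> \<delta> (\<lambda>y. complex_of_real (\<phi> y)) x) \<le> B"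
    using T_trunc_real(4)[OF nice \<delta> \<phi>] by blast
  show ?thesis
  proof (rule nice_measure_integrable_bounded_support[OF nice(1), where B="2 * L * r * B"])
    show "norm (\<psi> x *\<^sub>R T_trunc \<Omega> s \<mu> \<delta> (\<lambda>y. complex_of_real (\<phi> y)) x) \<le> 2 * L * r * B" for x
      unfolding norm_scaleR using lipschitz_bumpD(3)[OF \<psi>(1)] \<psi>(2)
      by (intro mult_mono B lipschitz_bump_bound[OF \<psi>]) auto
  qed (use lipschitz_bumpD(2)[OF \<psi>(1)] in auto)
qed

text \<open>Since \<open>\<phi> = 1\<close> near the support of \<open>\<psi>\<close>, the difference of the two truncations only sees pairs
  \<open>(x, y)\<close> at distance less than \<open>\<delta>'\<close>; antisymmetry of the kernel replaces \<open>\<psi> x\<close> by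
  \<open>(\<psi> x - \<psi> y) / 2\<close>, which gains a factor \<open>\<delta>'\<close>.\<close>

lemma A_diff_dyadic:
  assumes nice: "nice_measure s \<mu> \<Lambda>" "0 \<le> \<Lambda>" and \<phi>: "square_integrable \<mu> \<phi>"
    and \<phi>1: "\<And>x. x \<in> ball c (2 * r) \<Longrightarrow> \<phi> x = 1"
    and \<psi>: "lipschitz_bump L c r \<psi>" "r > 0"
    and \<delta>: "0 < \<delta>" "\<delta> \<le> \<delta>'" "\<delta>' \<le> 2 * \<delta>" "\<delta>' \<le> r"
  shows "norm (A \<mu> \<delta>' \<phi> \<psi> - A \<mu> \<delta> \<phi> \<psi>) \<le> L * 2 powr s * \<Lambda> * (\<Lambda> * (2 * r) powr s) * \<delta>'"
proof -
  interpret sigma_finite_measure \<mu> by (rule nice_measure_sigma_finite[OF nice(1)])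
  interpret P: pair_sigma_finite \<mu> \<mu> ..
  note [measurable_cong] = nice_measure_sets[OF nice(1)]
  note [measurable] = lipschitz_bump_measurable[OF \<psi>(1)]
  have \<delta>'0: "\<delta>' > 0" using \<delta> by simp
  define D where "D x = Kt \<delta>' x - Kt \<delta> x" for x
  have [measurable]: "D \<in> borel_measurable borel" unfolding D_def[abs_def] by measurable
  have D0: "D x = 0" if "norm x \<ge> \<delta>'" for x
    using that \<delta> by (simp add: D_def Kt_eq_K)
  have Dm: "D (- x) = - D x" for x by (simp add: D_def Kt_minus)
  have Db: "norm (D x) \<le> 2 * \<delta> powr (- s)" for x
  proof -
    have "\<delta>' powr (- s) \<le> \<delta> powr (- s)" using \<delta> s_pos by (intro powr_mono2') auto
    then show ?thesis
      using norm_triangle_ineq4[of "Kt \<delta>' x" "Kt \<delta> x"] norm_Kt_le'[OF \<delta>'0, of x] norm_Kt_le'[OF \<delta>(1), of x]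
      unfolding D_def by linarith
  qed
  have L: "L \<ge> 0" by (rule lipschitz_bumpD(3)[OF \<psi>(1)])
  define g where "g x y = \<psi> x *\<^sub>R D (x - y)" for x y
  have gm [measurable]: "case_prod g \<in> borel_measurable (borel \<Otimes>\<^sub>M borel)"
    unfolding g_def[abs_def] by measurable
  have gb: "norm (g x y) \<le> 2 * L * r * (2 * \<delta> powr (- s))" for x y
    unfolding g_def norm_scaleR using L \<psi>(2)
    by (intro mult_mono Db lipschitz_bump_bound[OF \<psi>]) auto
  \<comment> \<open>The difference kernel sees only |x - y| < \<delta>' \<le> r, so y stays in the
    ball of radius 2r, exactly where \<phi> = 1. This is why \<phi> does not occur in
    \<open>g\<close>.\<close>
  have g0: "g x y = 0" if "x \<notin> ball c r \<or> y \<notin> ball c (2 * r)" for x y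
  proof (cases "x \<in> ball c r")
    case True
    then have "dist c y \<ge> 2 * r" "dist c x < r" using that by auto
    then have "dist x y \<ge> r" using dist_triangle[of c y x] by linarith
    then show ?thesis using D0[of "x - y"] \<delta> by (simp add: g_def dist_norm)
  qed (use lipschitz_bumpD(2)[OF \<psi>(1)] in \<open>auto simp: g_def\<close>)
  have int: "integrable (\<mu> \<Otimes>\<^sub>M \<mu>) (case_prod g)"
  proof (rule integrableI_bounded_set[where A="ball c r \<times> ball c (2 * r)"])
    have s: "ball c r \<in> sets \<mu>" "ball c (2 * r) \<in> sets \<mu>" by measurable
    show "ball c r \<times> ball c (2 * r) \<in> sets (\<mu> \<Otimes>\<^sub>M \<mu>)" using s by auto
    show "emeasure (\<mu> \<Otimes>\<^sub>M \<mu>) (ball c r \<times> ball c (2 * r)) < \<infinity>"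
      using nice_measure_ball_finite[OF nice(1), of c r] nice_measure_ball_finite[OF nice(1), of c "2 * r"]
      by (subst emeasure_pair_measure_Times[OF s]) (auto simp: ennreal_mult_less_top)
    show "AE z in \<mu> \<Otimes>\<^sub>M \<mu>. z \<in> ball c r \<times> ball c (2 * r) \<longrightarrow> norm (case z of (x, y) \<Rightarrow> g x y) \<le> 2 * L * r * (2 * \<delta> powr (- s))"
      using gb by auto
    show "AE z in \<mu> \<Otimes>\<^sub>M \<mu>. z \<notin> ball c r \<times> ball c (2 * r) \<longrightarrow> (case z of (x, y) \<Rightarrow> g x y) = 0"
      using g0 by (intro AE_I2) (auto split: prod.splits)
  qed measurable
  define I where "I = (\<integral>x. \<integral>y. g x y \<partial>\<mu> \<partial>\<mu>)"
  have T: "integrable \<mu> (\<lambda>y. \<phi> y *\<^sub>R Kt d (x - y))"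
       "T_trunc \<Omega> s \<mu> d (\<lambda>y. complex_of_real (\<phi> y)) x = (\<integral>y. \<phi> y *\<^sub>R Kt d (x - y) \<partial>\<mu>)" if "d > 0" for d x
    using T_trunc_real[OF nice that \<phi>] by auto
  have "\<psi> x *\<^sub>R (\<phi> y *\<^sub>R Kt \<delta>' (x - y) - \<phi> y *\<^sub>R Kt \<delta> (x - y)) = g x y" for x y
  proof (cases "x \<in> ball c r \<and> norm (x - y) < \<delta>'")
    case True
    then have "dist c y < 2 * r" using dist_triangle[of c y x] \<delta> by (auto simp: dist_norm)
    then show ?thesis using \<phi>1[of y] by (simp add: g_def D_def)
  next
    case False
    then show ?thesis
      using lipschitz_bumpD(2)[OF \<psi>(1), of x] D0[of "x - y"] by (auto simp: g_def D_def)
  qed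
  then have gT: "\<psi> x *\<^sub>R T_trunc \<Omega> s \<mu> \<delta>' (\<lambda>y. complex_of_real (\<phi> y)) x
      - \<psi> x *\<^sub>R T_trunc \<Omega> s \<mu> \<delta> (\<lambda>y. complex_of_real (\<phi> y)) x = (\<integral>y. g x y \<partial>\<mu>)" for x
  proof -
    assume g: "\<And>x y. \<psi> x *\<^sub>R (\<phi> y *\<^sub>R Kt \<delta>' (x - y) - \<phi> y *\<^sub>R Kt \<delta> (x - y)) = g x y"
    have "(\<integral>y. g x y \<partial>\<mu>) = \<psi> x *\<^sub>R (\<integral>y. \<phi> y *\<^sub>R Kt \<delta>' (x - y) - \<phi> y *\<^sub>R Kt \<delta> (x - y) \<partial>\<mu>)"
      unfolding g[symmetric] by (rule integral_scaleR_right)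
    also have "\<dots> = \<psi> x *\<^sub>R ((\<integral>y. \<phi> y *\<^sub>R Kt \<delta>' (x - y) \<partial>\<mu>) - (\<integral>y. \<phi> y *\<^sub>R Kt \<delta> (x - y) \<partial>\<mu>))"
      using T(1)[OF \<delta>'0, of x] T(1)[OF \<delta>(1), of x] by (subst Bochner_Integration.integral_diff) auto
    finally show ?thesis by (simp add: T(2)[OF \<delta>'0] T(2)[OF \<delta>(1)] scaleR_diff_right)
  qed
  have Aeq: "A \<mu> \<delta>' \<phi> \<psi> - A \<mu> \<delta> \<phi> \<psi> = I"
    unfolding A_def I_def gT[symmetric]
    by (rule Bochner_Integration.integral_diff[symmetric]; rule bump_T_trunc_integrable[OF nice _ \<phi> \<psi>])
       (use \<delta> in auto)
  have I2: "I = (\<integral>x. \<integral>y. g y x \<partial>\<mu> \<partial>\<mu>)"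
    unfolding I_def by (rule P.Fubini_integral[OF int, symmetric])
  have i1: "integrable \<mu> (\<lambda>y. g x y)" for x
    by (rule nice_measure_integrable_bounded_support[OF nice(1) _ gb, where c=c and r="2 * r"]) (use g0 in auto)
  have i2: "integrable \<mu> (\<lambda>y. g y x)" for x
    by (rule nice_measure_integrable_bounded_support[OF nice(1) _ gb, where c=c and r="r"]) (use g0 in auto)
  have "I + I = (\<integral>x. (\<integral>y. g x y \<partial>\<mu>) + (\<integral>y. g y x \<partial>\<mu>) \<partial>\<mu>)"
    using P.integrable_fst[OF int] P.integrable_snd[OF int]
    by (subst Bochner_Integration.integral_add) (auto simp flip: I2, simp add: I_def)
  also have "\<dots> = (\<integral>x. \<integral>y. g x y + g y x \<partial>\<mu> \<partial>\<mu>)"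
    using i1 i2 by simp
  finally have II: "I + I = \<dots>" .
  \<comment> \<open>\<open>L * \<delta>'\<close> bounds the increment of \<psi> at distance below
    \<delta>', and the other factor bounds the difference of the two kernels.\<close>
  let ?b = "L * \<delta>' * (2 * \<delta> powr (- s))"
  have b0: "?b \<ge> 0" using L \<delta> by auto
  have gg: "norm (g x y + g y x) \<le> (?b * indicator (ball c (2 * r)) x) * indicator (ball x \<delta>') y" for x y
  proof -
    have e: "g x y + g y x = (\<psi> x - \<psi> y) *\<^sub>R D (x - y)"
      using Dm[of "x - y"] by (simp add: g_def algebra_simps)
    show ?thesis
    proof (cases "dist x y < \<delta>'")
      case True
      show ?thesis
      proof (cases "x \<in> ball c (2 * r)")
        case False
        have "y \<notin> ball c r" "x \<notin> ball c r"
          using False True dist_triangle[of c x y] \<delta> \<psi>(2) by (auto simp: dist_commute)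
        then show ?thesis using lipschitz_bumpD(2)[OF \<psi>(1)] False by (simp add: e)
      next
        case x: True
        have "norm (g x y + g y x) \<le> L * dist x y * (2 * \<delta> powr (- s))"
          unfolding e norm_scaleR
          using L by (intro mult_mono Db lipschitz_bumpD(1)[OF \<psi>(1)]) auto
        also have "\<dots> \<le> ?b"
          using True L by (intro mult_right_mono mult_left_mono) auto
        finally show ?thesis using True x by simp
      qed
    next
      case False
      then show ?thesis using D0[of "x - y"] b0 by (simp add: e dist_norm)
    qed
  qed
  have inner: "norm (\<integral>y. g x y + g y x \<partial>\<mu>) \<le> ?b * (\<Lambda> * \<bar>\<delta>'\<bar> powr s) * indicator (ball c (2 * r)) x" for x
    using nice_measure_norm_integral_le[OF nice gg[of x]] b0 by (auto simp: indicator_def algebra_simps)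
  have "norm (I + I) \<le> ?b * (\<Lambda> * \<bar>\<delta>'\<bar> powr s) * (\<Lambda> * \<bar>2 * r\<bar> powr s)"
    unfolding II by (rule nice_measure_norm_integral_le[OF nice inner]) (use b0 nice in auto)
  also have "I + I = 2 *\<^sub>R I" by (simp add: scaleR_2)
  finally have nI: "norm I \<le> L * \<delta>' * \<Lambda> * (\<Lambda> * (2 * r) powr s) * (\<delta> powr (- s) * \<delta>' powr s)"
    using \<delta>'0 \<psi>(2) by (simp add: algebra_simps)
  \<comment> \<open>The size \<delta>^(-s) of the kernel cancels against the mass of order
    \<delta>'^s of the ball it lives on, because \<delta>' \<le> 2 \<delta>. What is left is the
    factor \<delta>' gained from antisymmetry.\<close>
  have "\<delta> powr (- s) * \<delta>' powr s \<le> 2 powr s"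
  proof -
    have "\<delta>' powr s \<le> (2 * \<delta>) powr s" using \<delta> s_pos by (intro powr_mono2) auto
    also have "\<dots> = 2 powr s * \<delta> powr s" using \<delta> by (simp add: powr_mult)
    finally have "\<delta> powr (- s) * \<delta>' powr s \<le> \<delta> powr (- s) * (2 powr s * \<delta> powr s)"
      by (intro mult_left_mono) auto
    then show ?thesis using \<delta> by (simp add: powr_minus field_simps)
  qed
  then have "L * \<delta>' * \<Lambda> * (\<Lambda> * (2 * r) powr s) * (\<delta> powr (- s) * \<delta>' powr s)
      \<le> L * \<delta>' * \<Lambda> * (\<Lambda> * (2 * r) powr s) * 2 powr s"
    using L \<delta>'0 nice(2) by (intro mult_left_mono) auto
  with nI show ?thesis
    unfolding Aeq by (simp add: mult_ac)
qed

text \<open>Halving \<delta>' repeatedly brings it within a factor 2 of \<delta>; the dyadic errors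
  form a geometric series, hence the additional factor 2.\<close>

lemma A_diff:
  assumes nice: "nice_measure s \<mu> \<Lambda>" "0 \<le> \<Lambda>" and \<phi>: "square_integrable \<mu> \<phi>"
    and \<phi>1: "\<And>x. x \<in> ball c (2 * r) \<Longrightarrow> \<phi> x = 1"
    and \<psi>: "lipschitz_bump L c r \<psi>" "r > 0"
    and \<delta>: "0 < \<delta>" "\<delta> \<le> \<delta>'" "\<delta>' \<le> r"
  shows "norm (A \<mu> \<delta>' \<phi> \<psi> - A \<mu> \<delta> \<phi> \<psi>) \<le> 2 * (L * 2 powr s * \<Lambda> * (\<Lambda> * (2 * r) powr s)) * \<delta>'"
proof -
  define C where "C = L * 2 powr s * \<Lambda> * (\<Lambda> * (2 * r) powr s)"
  have C: "C \<ge> 0" using lipschitz_bumpD(3)[OF \<psi>(1)] nice(2) by (simp add: C_def)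
  have dy: "norm (A \<mu> d' \<phi> \<psi> - A \<mu> d \<phi> \<psi>) \<le> C * d'" if "0 < d" "d \<le> d'" "d' \<le> 2 * d" "d' \<le> r" for d d'
    unfolding C_def by (rule A_diff_dyadic[OF nice \<phi> \<phi>1 \<psi> that])
  have "0 < d \<Longrightarrow> d \<le> d' \<Longrightarrow> d' \<le> r \<Longrightarrow> d' \<le> 2 ^ n * d \<Longrightarrow> norm (A \<mu> d' \<phi> \<psi> - A \<mu> d \<phi> \<psi>) \<le> 2 * C * d'" for n d d'
  proof (induction n arbitrary: d')
    case 0
    then show ?case using C by auto
  next
    case (Suc n)
    show ?case
    proof (cases "d' \<le> 2 * d")
      case True
      then have "norm (A \<mu> d' \<phi> \<psi> - A \<mu> d \<phi> \<psi>) \<le> C * d'" using Suc dy by auto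
      also have "\<dots> \<le> 2 * C * d'" using C Suc.prems by (intro mult_right_mono) auto
      finally show ?thesis .
    next
      case False
      have "norm (A \<mu> (d' / 2) \<phi> \<psi> - A \<mu> d \<phi> \<psi>) \<le> 2 * C * (d' / 2)"
        using Suc.prems False by (intro Suc.IH) auto
      moreover have "norm (A \<mu> d' \<phi> \<psi> - A \<mu> (d' / 2) \<phi> \<psi>) \<le> C * d'"
        using Suc.prems by (intro dy) auto
      moreover have "norm (A \<mu> d' \<phi> \<psi> - A \<mu> d \<phi> \<psi>)
        \<le> norm (A \<mu> d' \<phi> \<psi> - A \<mu> (d' / 2) \<phi> \<psi>) + norm (A \<mu> (d' / 2) \<phi> \<psi> - A \<mu> d \<phi> \<psi>)"
        using norm_triangle_ineq[of "A \<mu> d' \<phi> \<psi> - A \<mu> (d' / 2) \<phi> \<psi>" "A \<mu> (d' / 2) \<phi> \<psi> - A \<mu> d \<phi> \<psi>"] by simp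
      ultimately show ?thesis by linarith
    qed
  qed
  note * = this
  obtain n where "\<delta>' / \<delta> < 2 ^ n" using real_arch_pow[of 2 "\<delta>' / \<delta>"] by auto
  then have "\<delta>' \<le> 2 ^ n * \<delta>" using \<delta> by (simp add: field_simps)
  then show ?thesis unfolding C_def[symmetric] using \<delta> by (intro *)
qed

text \<open>The pairings are Cauchy as \<delta> tends to 0, and the linear rate depends on the
  measure only through \<Lambda>. This uniformity is what permits the limits in \<delta> and along a
  sequence of blow-ups to be interchanged.\<close>

lemma A_tendsto:
  assumes nice: "nice_measure s \<mu> \<Lambda>" "0 \<le> \<Lambda>" and \<phi>: "square_integrable \<mu> \<phi>"
    and \<phi>1: "\<And>x. x \<in> ball c (2 * r) \<Longrightarrow> \<phi> x = 1"
    and \<psi>: "lipschitz_bump L c r \<psi>" "r > 0"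
  shows "((\<lambda>\<delta>. A \<mu> \<delta> \<phi> \<psi>) \<longlongrightarrow> TT \<mu> \<phi> \<psi>) (at_right 0)"
    and "0 < \<delta> \<Longrightarrow> \<delta> \<le> r \<Longrightarrow> norm (A \<mu> \<delta> \<phi> \<psi> - TT \<mu> \<phi> \<psi>) \<le> 2 * (L * 2 powr s * \<Lambda> * (\<Lambda> * (2 * r) powr s)) * \<delta>"
proof -
  define C where "C = 2 * (L * 2 powr s * \<Lambda> * (\<Lambda> * (2 * r) powr s))"
  have C: "C \<ge> 0" using lipschitz_bumpD(3)[OF \<psi>(1)] nice(2) by (simp add: C_def)
  have ad: "norm (A \<mu> d' \<phi> \<psi> - A \<mu> d \<phi> \<psi>) \<le> C * d'" if "0 < d" "d \<le> d'" "d' \<le> r" for d d'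
    unfolding C_def by (rule A_diff[OF nice \<phi> \<phi>1 \<psi> that])
  define X where "X n = A \<mu> (r / real (Suc n)) \<phi> \<psi>" for n
  have Xle: "norm (X m - X n) \<le> C * r / real (Suc m)" if "m \<le> n" for m n
    unfolding X_def using ad[of "r / real (Suc n)" "r / real (Suc m)"] \<psi>(2) that
    by (auto simp: frac_le field_simps)
  have lim0: "(\<lambda>n. C * r / real (Suc n)) \<longlonglongrightarrow> 0"
    by (intro tendsto_divide_0[OF tendsto_const] filterlim_at_top_imp_at_infinity
        filterlim_compose[OF filterlim_real_sequentially filterlim_Suc])
  have "Cauchy X"
  proof (rule metric_CauchyI)
    fix e :: real assume "e > 0"
    then obtain N where N: "\<And>n. n \<ge> N \<Longrightarrow> C * r / real (Suc n) < e / 2"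
      using order_tendstoD(2)[OF lim0, of "e / 2"] by (auto simp: eventually_sequentially)
    have "dist (X m) (X n) < e" if "m \<ge> N" "n \<ge> N" for m n
    proof -
      have "dist (X m) (X n) \<le> norm (X N - X m) + norm (X N - X n)"
        by (metis dist_norm dist_triangle3)
      then show ?thesis using Xle[OF that(1)] Xle[OF that(2)] N[of N, OF order_refl] by linarith
    qed
    then show "\<exists>M. \<forall>m\<ge>M. \<forall>n\<ge>M. dist (X m) (X n) < e" by blast
  qed
  then obtain l where l: "X \<longlonglongrightarrow> l" using Cauchy_convergent convergent_def by blast
  have le: "norm (A \<mu> \<delta> \<phi> \<psi> - l) \<le> C * \<delta>" if "0 < \<delta>" "\<delta> \<le> r" for \<delta>
  proof (rule LIMSEQ_le_const2[of "\<lambda>n. norm (A \<mu> \<delta> \<phi> \<psi> - X n)"])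
    show "(\<lambda>n. norm (A \<mu> \<delta> \<phi> \<psi> - X n)) \<longlonglongrightarrow> norm (A \<mu> \<delta> \<phi> \<psi> - l)"
      by (intro tendsto_intros l)
    have "(\<lambda>n. r / real (Suc n)) \<longlonglongrightarrow> 0"
      by (intro tendsto_divide_0[OF tendsto_const] filterlim_at_top_imp_at_infinity
        filterlim_compose[OF filterlim_real_sequentially filterlim_Suc])
    then obtain N where N: "\<And>n. n \<ge> N \<Longrightarrow> r / real (Suc n) < \<delta>"
      using order_tendstoD(2)[of "\<lambda>n. r / real (Suc n)" 0 sequentially \<delta>] \<open>0 < \<delta>\<close>
      unfolding eventually_sequentially by blast
    then show "\<exists>N. \<forall>n\<ge>N. norm (A \<mu> \<delta> \<phi> \<psi> - X n) \<le> C * \<delta>"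
      unfolding X_def using \<psi>(2) that by (intro exI[of _ N] allI impI ad) (auto simp: less_imp_le)
  qed
  have "((\<lambda>\<delta>. norm (A \<mu> \<delta> \<phi> \<psi> - l)) \<longlongrightarrow> 0) (at_right 0)"
  proof (rule tendsto_sandwich[where f="\<lambda>_. 0" and h="\<lambda>\<delta>. C * \<delta>"])
    show "\<forall>\<^sub>F \<delta> in at_right 0. norm (A \<mu> \<delta> \<phi> \<psi> - l) \<le> C * \<delta>"
      using \<psi>(2) by (auto simp: eventually_at_right_field intro!: exI[of _ r] le)
    show "((\<lambda>\<delta>. C * \<delta>) \<longlongrightarrow> 0) (at_right 0)"
      using tendsto_mult[OF tendsto_const tendsto_ident_at, of C 0 "{0<..}"] by simp
  qed auto
  then have tl: "((\<lambda>\<delta>. A \<mu> \<delta> \<phi> \<psi>) \<longlongrightarrow> l) (at_right 0)"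
    by (simp add: tendsto_norm_zero_iff LIM_zero_iff)
  then have eq: "TT \<mu> \<phi> \<psi> = l" unfolding T_pair_eq_Lim
    by (intro tendsto_Lim) auto
  show "((\<lambda>\<delta>. A \<mu> \<delta> \<phi> \<psi>) \<longlongrightarrow> TT \<mu> \<phi> \<psi>) (at_right 0)" using tl eq by simp
  show "0 < \<delta> \<Longrightarrow> \<delta> \<le> r \<Longrightarrow> norm (A \<mu> \<delta> \<phi> \<psi> - TT \<mu> \<phi> \<psi>) \<le> 2 * (L * 2 powr s * \<Lambda> * (\<Lambda> * (2 * r) powr s)) * \<delta>"
    using le eq by (simp add: C_def)
qed

text \<open>Kernel decay of order -s - \<alpha> against growth of order s: the tail estimate with b
  = \<alpha>. The weight \<eta> is kept general because it is used as 1 minus a cutoff, both at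
  \<rho> = 2r and at large \<rho>.\<close>

lemma far_integral:
  assumes "r > 0" "\<Lambda> \<ge> 0"
  shows "\<exists>C\<ge>0. \<forall>\<mu> c \<rho> \<eta> x z. nice_measure s \<mu> \<Lambda> \<and> 2 * r \<le> \<rho> \<and> \<eta> \<in> borel_measurable borel \<and>
      (\<forall>y. \<bar>\<eta> y\<bar> \<le> 1) \<and> (\<forall>y\<in>ball c \<rho>. \<eta> y = 0) \<and> x \<in> ball c r \<and> z \<in> ball c r \<longrightarrow>
      integrable \<mu> (\<lambda>y. \<eta> y *\<^sub>R (K (x - y) - K (z - y))) \<and>
      norm (\<integral>y. \<eta> y *\<^sub>R (K (x - y) - K (z - y)) \<partial>\<mu>) \<le> C * \<rho> powr (- \<alpha>)"
proof -
  obtain C where C: "C \<ge> 0" and far: "\<And>c x y z. x \<in> ball c r \<Longrightarrow> z \<in> ball c r \<Longrightarrow> dist y c \<ge> 2 * r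
      \<Longrightarrow> norm (K (x - y) - K (z - y)) \<le> C * dist y c powr (- s - \<alpha>)"
    using K_holder_far[OF assms(1)] by blast
  define E where "E = \<Lambda> * 2 powr s / (1 - 2 powr (- \<alpha>))"
  have "(2::real) powr (- \<alpha>) < 2 powr 0" using \<alpha>_pos by (intro powr_less_mono) auto
  then have E: "E \<ge> 0" using assms by (auto simp: E_def)
  have "integrable \<mu> (\<lambda>y. \<eta> y *\<^sub>R (K (x - y) - K (z - y))) \<and>
      norm (\<integral>y. \<eta> y *\<^sub>R (K (x - y) - K (z - y)) \<partial>\<mu>) \<le> (C * E) * \<rho> powr (- \<alpha>)"
    if nice: "nice_measure s \<mu> \<Lambda>" and \<rho>: "2 * r \<le> \<rho>" and [measurable]: "\<eta> \<in> borel_measurable borel" and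
      \<eta>: "\<And>y. \<bar>\<eta> y\<bar> \<le> 1" "\<And>y. y \<in> ball c \<rho> \<Longrightarrow> \<eta> y = 0" and xz: "x \<in> ball c r" "z \<in> ball c r"
    for \<mu> c \<rho> \<eta> x z
  proof -
    note [measurable_cong] = nice_measure_sets[OF nice]
    let ?g = "\<lambda>y. \<eta> y *\<^sub>R (K (x - y) - K (z - y))"
    have gm: "?g \<in> borel_measurable \<mu>" by measurable
    have "ennreal (norm (?g y)) \<le> ennreal C * (indicator {y. \<rho> \<le> dist y c} y * ennreal (dist y c powr (- s - \<alpha>)))" for y
    proof (cases "\<rho> \<le> dist y c")
      case True
      have "norm (?g y) \<le> 1 * (C * dist y c powr (- s - \<alpha>))"
        unfolding norm_scaleR using True \<rho> by (intro mult_mono \<eta>(1) far[OF xz]) auto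
      then show ?thesis using True C by (simp add: ennreal_leI flip: ennreal_mult)
    qed (use \<eta>(2)[of y] in \<open>auto simp: dist_commute\<close>)
    then have "(\<integral>\<^sup>+y. ennreal (norm (?g y)) \<partial>\<mu>) \<le>
        (\<integral>\<^sup>+y. ennreal C * (indicator {y. \<rho> \<le> dist y c} y * ennreal (dist y c powr (- s - \<alpha>))) \<partial>\<mu>)"
      by (rule nn_integral_mono)
    also have "\<dots> = ennreal C * (\<integral>\<^sup>+y. indicator {y. \<rho> \<le> dist y c} y * ennreal (dist y c powr (- s - \<alpha>)) \<partial>\<mu>)"
    proof (rule nn_integral_cmult)
      have "closed {y. \<rho> \<le> dist y c}"
        by (intro closed_Collect_le continuous_intros)
      then have [measurable]: "{y. \<rho> \<le> dist y c} \<in> sets borel" by (rule borel_closed)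
      show "(\<lambda>y. indicator {y. \<rho> \<le> dist y c} y * ennreal (dist y c powr (- s - \<alpha>))) \<in> borel_measurable \<mu>"
        by measurable
    qed
    also have "\<dots> \<le> ennreal C * ennreal (E * \<rho> powr (- \<alpha>))"
      unfolding E_def using assms \<rho> \<alpha>_pos s_pos by (intro mult_left_mono nice_measure_tail[OF nice]) auto
    also have "\<dots> = ennreal ((C * E) * \<rho> powr (- \<alpha>))"
      using C E by (simp add: mult.assoc flip: ennreal_mult)
    finally have nn: "(\<integral>\<^sup>+y. ennreal (norm (?g y)) \<partial>\<mu>) \<le> ennreal ((C * E) * \<rho> powr (- \<alpha>))" .
    then have i: "integrable \<mu> ?g"
      using gm by (intro integrableI_bounded) (auto simp: le_less_trans less_top)
    have "norm (\<integral>y. ?g y \<partial>\<mu>) \<le> (\<integral>y. norm (?g y) \<partial>\<mu>)" by (rule integral_norm_bound)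
    also have "\<dots> \<le> (C * E) * \<rho> powr (- \<alpha>)"
      using nn C E gm by (subst integral_eq_nn_integral) (auto intro!: enn2real_leI)
    finally show ?thesis using i by blast
  qed
  then show ?thesis using C E by (intro exI[of _ "C * E"] conjI[of "0 \<le> C * E"]) (simp, blast)
qed

definition cutoff :: "'a measure \<Rightarrow> 'a \<Rightarrow> real \<Rightarrow> ('a \<Rightarrow> real) \<Rightarrow> bool" where
  "cutoff \<mu> c r \<phi> \<longleftrightarrow> square_integrable \<mu> \<phi> \<and> (\<forall>x. 0 \<le> \<phi> x \<and> \<phi> x \<le> 1) \<and> (\<forall>x\<in>ball c r. \<phi> x = 1)"

lemma cutoff_mono: "cutoff \<mu> c r \<phi> \<Longrightarrow> r' \<le> r \<Longrightarrow> cutoff \<mu> c r' \<phi>"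
  by (auto simp: cutoff_def)

text \<open>The two cutoffs agree on the ball of radius 2r, so for x in the ball of radius r their
  difference only meets |x - y| \<ge> r, where truncation at \<delta> \<le> r changes nothing. The
  difference of the truncated pairings is therefore constant for small \<delta>.\<close>

lemma TT_diff_cutoff:
  assumes nice: "nice_measure s \<mu> \<Lambda>" "0 \<le> \<Lambda>"
    and \<phi>: "cutoff \<mu> c (2 * r) \<phi>" and \<kappa>: "cutoff \<mu> c (2 * r) \<kappa>"
    and \<psi>: "lipschitz_bump L c r \<psi>" "r > 0"
  shows "TT \<mu> \<phi> \<psi> - TT \<mu> \<kappa> \<psi> = (\<integral>x. \<psi> x *\<^sub>R (\<integral>y. (\<phi> y - \<kappa> y) *\<^sub>R K (x - y) \<partial>\<mu>) \<partial>\<mu>)"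
    and "x \<in> ball c r \<Longrightarrow> integrable \<mu> (\<lambda>y. (\<phi> y - \<kappa> y) *\<^sub>R K (x - y))"
    and "integrable \<mu> (\<lambda>x. \<psi> x *\<^sub>R (\<integral>y. (\<phi> y - \<kappa> y) *\<^sub>R K (x - y) \<partial>\<mu>))"
proof -
  have s: "square_integrable \<mu> \<phi>" "square_integrable \<mu> \<kappa>" and z: "\<And>y. y \<in> ball c (2 * r) \<Longrightarrow> \<phi> y - \<kappa> y = 0"
    using \<phi> \<kappa> by (auto simp: cutoff_def)
  have eq: "(\<phi> y - \<kappa> y) *\<^sub>R K (x - y) = \<phi> y *\<^sub>R Kt \<delta> (x - y) - \<kappa> y *\<^sub>R Kt \<delta> (x - y)"
    if "x \<in> ball c r" "\<delta> \<le> r" for x y \<delta>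
  proof (cases "y \<in> ball c (2 * r)")
    case False
    then have "norm (x - y) \<ge> r" using that dist_triangle[of c y x] by (auto simp: dist_norm)
    then have "Kt \<delta> (x - y) = K (x - y)" using that by (intro Kt_eq_K) auto
    then show ?thesis by (simp add: scaleR_diff_left)
  qed (use z[of y] in auto)
  have T: "integrable \<mu> (\<lambda>y. f y *\<^sub>R Kt d (x - y))"
       "T_trunc \<Omega> s \<mu> d (\<lambda>y. complex_of_real (f y)) x = (\<integral>y. f y *\<^sub>R Kt d (x - y) \<partial>\<mu>)"
     if "d > 0" "square_integrable \<mu> f" for d x f
    using T_trunc_real[OF nice that] by auto
  have int: "integrable \<mu> (\<lambda>y. (\<phi> y - \<kappa> y) *\<^sub>R K (x - y))" if "x \<in> ball c r" for x
    unfolding eq[OF that order_refl] using T(1)[OF \<psi>(2)] s by auto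
  then show "x \<in> ball c r \<Longrightarrow> integrable \<mu> (\<lambda>y. (\<phi> y - \<kappa> y) *\<^sub>R K (x - y))" .
  have H: "\<psi> x *\<^sub>R (\<integral>y. (\<phi> y - \<kappa> y) *\<^sub>R K (x - y) \<partial>\<mu>) =
      \<psi> x *\<^sub>R T_trunc \<Omega> s \<mu> \<delta> (\<lambda>y. complex_of_real (\<phi> y)) x - \<psi> x *\<^sub>R T_trunc \<Omega> s \<mu> \<delta> (\<lambda>y. complex_of_real (\<kappa> y)) x"
    if "0 < \<delta>" "\<delta> \<le> r" for x \<delta>
  proof (cases "x \<in> ball c r")
    case True
    have "(\<integral>y. (\<phi> y - \<kappa> y) *\<^sub>R K (x - y) \<partial>\<mu>) = (\<integral>y. \<phi> y *\<^sub>R Kt \<delta> (x - y) \<partial>\<mu>) - (\<integral>y. \<kappa> y *\<^sub>R Kt \<delta> (x - y) \<partial>\<mu>)"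
      unfolding eq[OF True that(2)] by (rule Bochner_Integration.integral_diff; rule T[OF that(1)]; rule s)
    then show ?thesis using T(2)[OF that(1)] s by (simp add: scaleR_diff_right)
  qed (use lipschitz_bumpD(2)[OF \<psi>(1)] in auto)
  have A: "A \<mu> \<delta> \<phi> \<psi> - A \<mu> \<delta> \<kappa> \<psi> = (\<integral>x. \<psi> x *\<^sub>R (\<integral>y. (\<phi> y - \<kappa> y) *\<^sub>R K (x - y) \<partial>\<mu>) \<partial>\<mu>)"
    if "0 < \<delta>" "\<delta> \<le> r" for \<delta>
    unfolding A_def H[OF that]
    by (rule Bochner_Integration.integral_diff[symmetric]; rule bump_T_trunc_integrable[OF nice that(1) _ \<psi>]; rule s)
  show "integrable \<mu> (\<lambda>x. \<psi> x *\<^sub>R (\<integral>y. (\<phi> y - \<kappa> y) *\<^sub>R K (x - y) \<partial>\<mu>))"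
    unfolding H[OF \<psi>(2) order_refl]
    by (rule Bochner_Integration.integrable_diff; rule bump_T_trunc_integrable[OF nice \<psi>(2) _ \<psi>]; rule s)
  have "((\<lambda>\<delta>. A \<mu> \<delta> \<phi> \<psi> - A \<mu> \<delta> \<kappa> \<psi>) \<longlongrightarrow> TT \<mu> \<phi> \<psi> - TT \<mu> \<kappa> \<psi>) (at_right 0)"
    by (intro tendsto_diff A_tendsto(1)[OF nice _ _ \<psi>] s) (use \<phi> \<kappa> in \<open>auto simp: cutoff_def\<close>)
  moreover have "((\<lambda>\<delta>. A \<mu> \<delta> \<phi> \<psi> - A \<mu> \<delta> \<kappa> \<psi>) \<longlongrightarrow> (\<integral>x. \<psi> x *\<^sub>R (\<integral>y. (\<phi> y - \<kappa> y) *\<^sub>R K (x - y) \<partial>\<mu>) \<partial>\<mu>)) (at_right 0)"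
    by (rule tendsto_eventually)
       (use \<psi>(2) in \<open>auto simp: eventually_at_right_field intro!: exI[of _ r] A\<close>)
  ultimately show "TT \<mu> \<phi> \<psi> - TT \<mu> \<kappa> \<psi> = (\<integral>x. \<psi> x *\<^sub>R (\<integral>y. (\<phi> y - \<kappa> y) *\<^sub>R K (x - y) \<partial>\<mu>) \<partial>\<mu>)"
    by (rule tendsto_unique[rotated]) simp
qed

text \<open>Pairing with a mean-zero bump depends on the cutoff only through its values far away;
  in particular the definition of \<open>T\<^sub>\<mu>(1)\<close> does not depend on the choices made.\<close>

lemma T1_pair_cutoff:
  assumes r: "r > 0" and \<Lambda>: "\<Lambda> \<ge> 0"
  shows "\<exists>C\<ge>0. \<forall>\<mu> c \<rho> z \<phi> \<kappa> \<psi> L. nice_measure s \<mu> \<Lambda> \<and> 2 * r \<le> \<rho> \<and> cutoff \<mu> c (2 * r) \<phi> \<and> cutoff \<mu> c \<rho> \<kappa> \<and>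
      lipschitz_bump L c r \<psi> \<and> (\<integral>x. \<psi> x \<partial>\<mu>) = 0 \<and> z \<in> ball c r \<longrightarrow>
      norm (T1_pair \<Omega> s \<mu> z \<phi> \<psi> - TT \<mu> \<kappa> \<psi>) \<le> C * L * \<rho> powr (- \<alpha>)"
proof -
  obtain C where C: "C \<ge> 0" and far: "\<And>\<mu> c \<rho> \<eta> x z. nice_measure s \<mu> \<Lambda> \<Longrightarrow> 2 * r \<le> \<rho> \<Longrightarrow> \<eta> \<in> borel_measurable borel \<Longrightarrow>
      (\<forall>y. \<bar>\<eta> y\<bar> \<le> 1) \<Longrightarrow> (\<forall>y\<in>ball c \<rho>. \<eta> y = 0) \<Longrightarrow> x \<in> ball c r \<Longrightarrow> z \<in> ball c r \<Longrightarrow>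
      integrable \<mu> (\<lambda>y. \<eta> y *\<^sub>R (K (x - y) - K (z - y))) \<and>
      norm (\<integral>y. \<eta> y *\<^sub>R (K (x - y) - K (z - y)) \<partial>\<mu>) \<le> C * \<rho> powr (- \<alpha>)"
    using far_integral[OF r \<Lambda>] by blast
  have "norm (T1_pair \<Omega> s \<mu> z \<phi> \<psi> - TT \<mu> \<kappa> \<psi>) \<le> (2 * r * C * (\<Lambda> * r powr s)) * L * \<rho> powr (- \<alpha>)"
    if nice: "nice_measure s \<mu> \<Lambda>" and \<rho>: "2 * r \<le> \<rho>" and \<phi>: "cutoff \<mu> c (2 * r) \<phi>" and \<kappa>: "cutoff \<mu> c \<rho> \<kappa>"
      and \<psi>: "lipschitz_bump L c r \<psi>" and mz: "(\<integral>x. \<psi> x \<partial>\<mu>) = 0" and z: "z \<in> ball c r"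
    for \<mu> c \<rho> z \<phi> \<kappa> \<psi> L
  proof -
    interpret sigma_finite_measure \<mu> by (rule nice_measure_sigma_finite[OF nice])
    note [measurable_cong] = nice_measure_sets[OF nice]
    have [measurable]: "\<phi> \<in> borel_measurable borel" "\<kappa> \<in> borel_measurable borel"
      using \<phi> \<kappa> by (auto simp: cutoff_def square_integrable_def)
    note [measurable] = lipschitz_bump_measurable[OF \<psi>]
    have L: "L \<ge> 0" by (rule lipschitz_bumpD(3)[OF \<psi>])
    have \<kappa>': "cutoff \<mu> c (2 * r) \<kappa>" using \<kappa> \<rho> by (rule cutoff_mono)
    note D = TT_diff_cutoff[OF nice \<Lambda> \<phi> \<kappa>' \<psi> r]
    define H where "H x = (\<integral>y. (\<phi> y - \<kappa> y) *\<^sub>R K (x - y) \<partial>\<mu>)" for x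
    define J where "J x = (\<integral>y. (1 - \<phi> y) *\<^sub>R (K (x - y) - K (z - y)) \<partial>\<mu>)" for x
    define M where "M x = (\<integral>y. (1 - \<kappa> y) *\<^sub>R (K (x - y) - K (z - y)) \<partial>\<mu>)" for x
    have J: "integrable \<mu> (\<lambda>y. (1 - \<phi> y) *\<^sub>R (K (x - y) - K (z - y)))" "norm (J x) \<le> C * (2 * r) powr (- \<alpha>)"
      if "x \<in> ball c r" for x
      using far[OF nice order_refl, of "\<lambda>y. 1 - \<phi> y" c x z] that z \<phi> by (auto simp: cutoff_def J_def)
    have M: "norm (M x) \<le> C * \<rho> powr (- \<alpha>)" if "x \<in> ball c r" for x
      using far[OF nice \<rho>, of "\<lambda>y. 1 - \<kappa> y" c x z] that z \<kappa> by (auto simp: cutoff_def M_def)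
    \<comment> \<open>The weights add up pointwise: (\<phi> - \<kappa>) + (1 - \<phi>) = 1 -
      \<kappa>. The sum is thus a far-field integral that starts only at radius \<rho>.\<close>
    have HJ: "(H x - H z) + J x = M x" if x: "x \<in> ball c r" for x
    proof -
      have "(\<integral>y. ((\<phi> y - \<kappa> y) *\<^sub>R K (x - y) - (\<phi> y - \<kappa> y) *\<^sub>R K (z - y)) + (1 - \<phi> y) *\<^sub>R (K (x - y) - K (z - y)) \<partial>\<mu>)
          = (H x - H z) + J x"
        unfolding H_def J_def using D(2)[OF x] D(2)[OF z] J(1)[OF x] by simp
      moreover have "((\<phi> y - \<kappa> y) *\<^sub>R K (x - y) - (\<phi> y - \<kappa> y) *\<^sub>R K (z - y)) + (1 - \<phi> y) *\<^sub>R (K (x - y) - K (z - y))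
          = (1 - \<kappa> y) *\<^sub>R (K (x - y) - K (z - y))" for y by (simp add: algebra_simps)
      ultimately show ?thesis by (simp add: M_def)
    qed
    have iJ: "integrable \<mu> (\<lambda>x. \<psi> x *\<^sub>R J x)"
    proof (rule nice_measure_integrable_bounded_support[OF nice])
      show "(\<lambda>x. \<psi> x *\<^sub>R J x) \<in> borel_measurable borel" unfolding J_def by measurable
      show "norm (\<psi> x *\<^sub>R J x) \<le> 2 * L * r * (C * (2 * r) powr (- \<alpha>))" for x
      proof (cases "x \<in> ball c r")
        case True
        then show ?thesis unfolding norm_scaleR using L r
          by (intro mult_mono J lipschitz_bump_bound[OF \<psi> r]) auto
      next
        case False
        then show ?thesis using L r C lipschitz_bumpD(2)[OF \<psi> False] by simp
      qed
      show "x \<notin> ball c r \<Longrightarrow> \<psi> x *\<^sub>R J x = 0" for x using lipschitz_bumpD(2)[OF \<psi>] by simp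
    qed
    have i\<psi>: "integrable \<mu> \<psi>" by (rule lipschitz_bump_integrable[OF nice \<psi> r])
    \<comment> \<open>Subtracting the constant \<open>H z\<close> is free because \<psi> has
      integral zero; it turns \<open>H\<close> into the increment that combines with
      \<open>J\<close>.\<close>
    have "T1_pair \<Omega> s \<mu> z \<phi> \<psi> - TT \<mu> \<kappa> \<psi> = (\<integral>x. \<psi> x *\<^sub>R H x \<partial>\<mu>) + (\<integral>x. \<psi> x *\<^sub>R J x \<partial>\<mu>) - (\<integral>x. \<psi> x *\<^sub>R H z \<partial>\<mu>)"
      unfolding T1_pair_def J_def[symmetric] using D(1)[folded H_def] i\<psi> mz
      by (simp add: integral_scaleR_left diff_eq_eq)
    also have "\<dots> = (\<integral>x. \<psi> x *\<^sub>R H x + \<psi> x *\<^sub>R J x - \<psi> x *\<^sub>R H z \<partial>\<mu>)"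
      using D(3)[folded H_def] iJ i\<psi> by simp
    also have "\<dots> = (\<integral>x. \<psi> x *\<^sub>R M x \<partial>\<mu>)"
    proof (rule Bochner_Integration.integral_cong[OF refl])
      fix x
      show "\<psi> x *\<^sub>R H x + \<psi> x *\<^sub>R J x - \<psi> x *\<^sub>R H z = \<psi> x *\<^sub>R M x"
        by (cases "x \<in> ball c r")
           (auto simp: HJ[symmetric] scaleR_add_right scaleR_diff_right lipschitz_bumpD(2)[OF \<psi>])
    qed
    finally have eq: "T1_pair \<Omega> s \<mu> z \<phi> \<psi> - TT \<mu> \<kappa> \<psi> = \<dots>" .
    have "norm (\<integral>x. \<psi> x *\<^sub>R M x \<partial>\<mu>) \<le> (2 * L * r * (C * \<rho> powr (- \<alpha>))) * (\<Lambda> * \<bar>r\<bar> powr s)"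
    proof (rule nice_measure_norm_integral_le[OF nice \<Lambda>])
      show "norm (\<psi> x *\<^sub>R M x) \<le> (2 * L * r * (C * \<rho> powr (- \<alpha>))) * indicator (ball c r) x" for x
      proof (cases "x \<in> ball c r")
        case True
        then have "norm (\<psi> x *\<^sub>R M x) \<le> 2 * L * r * (C * \<rho> powr (- \<alpha>))" unfolding norm_scaleR using L r
          by (intro mult_mono M lipschitz_bump_bound[OF \<psi> r]) auto
        then show ?thesis using True by simp
      next
        case False
        then show ?thesis using lipschitz_bumpD(2)[OF \<psi> False] by simp
      qed
      show "0 \<le> 2 * L * r * (C * \<rho> powr (- \<alpha>))" using L r C by simp
    qed
    then show ?thesis unfolding eq using r by (simp add: mult_ac)
  qed
  note * = this
  have "0 \<le> 2 * r * C * (\<Lambda> * r powr s)" using r C \<Lambda> by simp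
  with * show ?thesis by (intro exI[of _ "2 * r * C * (\<Lambda> * r powr s)"] conjI) blast+
qed

end

section \<open>Vague compactness\<close>

lemma binary_expansion:
  fixes x :: real
  assumes "0 \<le> x" "x \<le> 1"
  shows "\<exists>a::nat \<Rightarrow> real. (\<forall>k. a k = 0 \<or> a k = 1) \<and> (\<lambda>k. a k * (1/2) ^ Suc k) sums x"
proof (cases "x = 1")
  \<comment> \<open>The floor digits used below would all be 0 at x = 1, since there the integer
    part \<open>e 0\<close> is 1; the expansion 0.111... is taken instead.\<close>
  case True
  have "(\<lambda>k. (1/2) ^ Suc k) sums (1::real)"
    using power_half_series by simp
  then show ?thesis using True by (intro exI[of _ "\<lambda>_. 1"]) simp
next
  case False
  define e where "e k = \<lfloor>2 ^ k * x\<rfloor>" for k :: nat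
  define a where "a k = real_of_int (e (Suc k) - 2 * e k)" for k
  have "e (Suc k) - 2 * e k = 0 \<or> e (Suc k) - 2 * e k = 1" for k
    unfolding e_def by (simp add: mult.assoc) linarith
  then have a01: "a k = 0 \<or> a k = 1" for k
    unfolding a_def by (metis of_int_0 of_int_1)
  have part: "(\<Sum>k<n. a k * (1/2) ^ Suc k) = real_of_int (e n) * (1/2) ^ n" for n
  proof (induction n)
    case 0
    have "e 0 = 0" using assms False by (auto simp: e_def floor_eq_iff)
    then show ?case by simp
  next
    case (Suc n)
    then show ?case by (simp add: a_def algebra_simps)
  qed
  have "(\<lambda>n. real_of_int (e n) * (1/2) ^ n) \<longlonglongrightarrow> x"
  proof (rule tendsto_sandwich[where f="\<lambda>n. x - (1/2) ^ n" and h="\<lambda>_. x"])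
    have b: "2 ^ n * x - 1 \<le> real_of_int (e n)" "real_of_int (e n) \<le> 2 ^ n * x" for n
      unfolding e_def by linarith+
    have p: "(2::real) ^ n * (1/2) ^ n = 1" for n by (simp add: power_one_over)
    have "x - (1/2) ^ n \<le> real_of_int (e n) * (1/2) ^ n" for n
    proof -
      have "x - (1/2) ^ n = x * (2 ^ n * (1/2) ^ n) - (1/2) ^ n" by (simp only: p mult_1_right)
      also have "\<dots> = (2 ^ n * x - 1) * (1/2) ^ n" by (simp only: algebra_simps)
      also have "\<dots> \<le> real_of_int (e n) * (1/2) ^ n" by (intro mult_right_mono b) auto
      finally show ?thesis .
    qed
    moreover have "real_of_int (e n) * (1/2) ^ n \<le> x" for n
    proof -
      have "real_of_int (e n) * (1/2) ^ n \<le> (2 ^ n * x) * (1/2) ^ n" by (intro mult_right_mono b) auto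
      also have "\<dots> = x * (2 ^ n * (1/2) ^ n)" by (simp only: mult_ac)
      also have "\<dots> = x" by (simp only: p mult_1_right)
      finally show ?thesis .
    qed
    ultimately have "x - (1/2) ^ n \<le> real_of_int (e n) * (1/2) ^ n" "real_of_int (e n) * (1/2) ^ n \<le> x" for n
      by blast+
    then show "\<forall>\<^sub>F n in sequentially. x - (1/2) ^ n \<le> real_of_int (e n) * (1/2) ^ n"
      "\<forall>\<^sub>F n in sequentially. real_of_int (e n) * (1/2) ^ n \<le> x" by auto
    have "(\<lambda>n. x - (1/2) ^ n) \<longlonglongrightarrow> x - 0"
      by (intro tendsto_diff tendsto_const LIMSEQ_power_zero) auto
    then show "(\<lambda>n. x - (1/2) ^ n) \<longlonglongrightarrow> x" by simp
  qed auto
  then have "(\<lambda>k. a k * (1/2) ^ Suc k) sums x"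
    unfolding sums_def part .
  then show ?thesis using a01 by blast
qed

text \<open>Schoenberg's space-filling curve. The function below is continuous, 2-periodic, vanishes on
  \<open>[0, 1/3]\<close> and equals 1 on \<open>[2/3, 1]\<close>, so it reads off the ternary digits of a point of the Cantor set.\<close>

definition digit :: "real \<Rightarrow> real" where
  "digit t = max 0 (min 1 (1/2 - cos (pi * t)))"

lemma digit_range: "0 \<le> digit t" "digit t \<le> 1"
  by (auto simp: digit_def)

lemma continuous_digit: "continuous_on UNIV digit"
  unfolding digit_def[abs_def] by (intro continuous_intros)

text \<open>The constant 1/2 in \<open>digit\<close> is cos(\<pi>/3). Modulo the period, a = 0 gives
  an angle in [0, \<pi>/3] with cosine at least 1/2, and a = 1 an angle in [2\<pi>/3, \<pi>] with
  cosine at most -1/2, so clipping yields exactly 0 or 1.\<close>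

lemma digit_read:
  assumes "a = 0 \<or> a = 1" "0 \<le> r" "r \<le> 1/3"
  shows "digit (2 * real n + (2 * a / 3 + r)) = a"
proof -
  have "pi * (2 * real n + (2 * a / 3 + r)) = pi * (2 * a / 3 + r) + 2 * real n * pi"
    by (simp add: algebra_simps)
  then have eq: "cos (pi * (2 * real n + (2 * a / 3 + r))) = cos (pi * (2 * a / 3 + r))"
    by (simp only: cos_add sin_2npi cos_2npi)
  show ?thesis
  proof (cases "a = 0")
    case True
    have "cos (pi / 3) \<le> cos (pi * r)"
      using assms mult_left_mono[of r "1/3" pi] by (intro cos_monotone_0_pi_le) auto
    then show ?thesis unfolding digit_def eq using True by (simp add: cos_60)
  next
    case False
    then have a: "a = 1" using assms by simp
    have "cos (pi * (2 * a / 3 + r)) \<le> cos (pi * (2 / 3))"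
      using assms a mult_left_mono[of "2/3 + r" 1 pi] mult_left_mono[of "2/3" "2/3 + r" pi]
      by (intro cos_monotone_0_pi_le) auto
    also have "pi * (2 / 3) = pi - pi / 3" by simp
    also have "cos (pi - pi / 3) = - cos (pi / 3)" by (rule cos_pi_minus)
    finally have "cos (pi * (2 * a / 3 + r)) \<le> - (1/2)" by (simp add: cos_60)
    then show ?thesis unfolding digit_def eq using a by simp
  qed
qed

text \<open>Take the Cantor point with ternary digits 2 a_m. Multiplied by 3^m, its earlier digits
  give an even integer, which periodicity removes, the current digit gives 2a/3, and the later ones
  at most 1/3.\<close>

lemma digits_realize:
  fixes a :: "nat \<Rightarrow> real"
  assumes a: "\<And>m. a m = 0 \<or> a m = 1"
  shows "\<exists>t\<in>{0..1}. \<forall>m. digit (3 ^ m * t) = a m"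
proof -
  define f where "f m = 2 * a m * (1/3) ^ Suc m" for m
  have geo: "(\<lambda>m. 2 * (1/3) ^ Suc m) sums (1::real)"
    using sums_mult[OF geometric_sums[of "1/3::real"], of "2/3"] by (simp add: algebra_simps)
  have f0: "0 \<le> f m" and f1: "f m \<le> 2 * (1/3) ^ Suc m" for m
    using a[of m] by (auto simp: f_def)
  have sf: "summable f"
    by (rule summable_comparison_test'[OF sums_summable[OF geo], of 0]) (use f0 f1 in auto)
  define t where "t = (\<Sum>m. f m)"
  have t0: "0 \<le> t" unfolding t_def by (rule suminf_nonneg[OF sf f0])
  have t1: "t \<le> 1" unfolding t_def using suminf_le[OF f1 sf sums_summable[OF geo]] sums_unique[OF geo] by simp
  have "digit (3 ^ m * t) = a m" for m
  proof -
    have sf': "summable (\<lambda>i. f (i + Suc m))" using sf by (rule summable_ignore_initial_segment)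
    define r where "r = 3 ^ m * (\<Sum>i. f (i + Suc m))"
    have r0: "0 \<le> r" unfolding r_def by (intro mult_nonneg_nonneg suminf_nonneg[OF sf'] f0) auto
    have geo': "(\<lambda>i. 2 * (1/3) ^ Suc (i + Suc m)) sums ((1/3) ^ Suc m :: real)"
      using sums_mult[OF geo, of "(1/3) ^ Suc m"] by (simp add: power_add algebra_simps)
    have "(\<Sum>i. f (i + Suc m)) \<le> (1/3) ^ Suc m"
      using suminf_le[OF f1 sf' sums_summable[OF geo']] sums_unique[OF geo'] by simp
    then have "r \<le> 3 ^ m * (1/3) ^ Suc m" unfolding r_def by (intro mult_left_mono) auto
    also have "\<dots> = 1/3" by (simp add: power_one_over)
    finally have r1: "r \<le> 1/3" .
    have "\<exists>n::nat. 3 ^ m * (\<Sum>i<m. f i) = 2 * real n"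
    proof -
      have "3 ^ m * f i = 2 * real (nat \<lfloor>a i\<rfloor> * 3 ^ (m - Suc i))" if "i < m" for i
      proof -
        have "(3::real) ^ m = 3 ^ (m - Suc i) * 3 ^ Suc i" using that by (metis Suc_leI le_add_diff_inverse2 power_add)
        then have "(3::real) ^ m * (1/3) ^ Suc i = 3 ^ (m - Suc i)" by (simp add: power_one_over)
        then show ?thesis using a[of i] by (auto simp: f_def)
      qed
      then have "3 ^ m * (\<Sum>i<m. f i) = (\<Sum>i<m. 2 * real (nat \<lfloor>a i\<rfloor> * 3 ^ (m - Suc i)))"
        unfolding sum_distrib_left by (intro sum.cong) auto
      also have "\<dots> = 2 * real (\<Sum>i<m. nat \<lfloor>a i\<rfloor> * 3 ^ (m - Suc i))"
        by (simp only: sum_distrib_left of_nat_sum)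
      finally show ?thesis by blast
    qed
    then obtain n where n: "3 ^ m * (\<Sum>i<m. f i) = 2 * real n" by blast
    have "t = (\<Sum>i. f (i + Suc m)) + (\<Sum>i<Suc m. f i)"
      unfolding t_def by (rule suminf_split_initial_segment[OF sf])
    then have "3 ^ m * t = 3 ^ m * (\<Sum>i<m. f i) + (3 ^ m * f m + r)"
      by (simp add: r_def algebra_simps)
    also have "3 ^ m * f m = 2 * a m / 3" by (simp add: f_def power_one_over)
    finally show ?thesis unfolding n using digit_read[OF a r0 r1] by simp
  qed
  then show ?thesis using t0 t1 by (intro bexI[of _ t]) auto
qed

text \<open>Coordinate b reads the digits at positions congruent to \<open>e b\<close> modulo the
  dimension as a binary expansion of a number in [0, 1], which is then mapped to [-1, 1]. One
  parameter can prescribe all digits at once, hence all coordinates; the Weierstrass test gives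
  continuity.\<close>

lemma space_filling_curve:
  "\<exists>S :: real \<Rightarrow> 'a::euclidean_space. continuous_on UNIV S \<and> (\<forall>u. norm u \<le> 1 \<longrightarrow> (\<exists>t\<in>{0..1}. S t = u))"
proof -
  define d where "d = DIM('a)"
  have d0: "d > 0" by (simp add: d_def)
  obtain e where e: "bij_betw e (Basis :: 'a set) {0..<d}"
    using ex_bij_betw_finite_nat[OF finite_Basis] unfolding d_def by blast
  have ed: "e b < d" if "b \<in> Basis" for b using e that by (auto simp: bij_betw_def)
  define g where "g b t = (\<Sum>k. digit (3 ^ (k * d + e b) * t) * (1/2) ^ Suc k)" for b :: 'a and t
  have half: "summable (\<lambda>k. (1/2::real) ^ Suc k)" using sums_summable[OF power_half_series] .
  have cont: "continuous_on UNIV (g b)" for b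
  proof -
    have "uniform_limit UNIV (\<lambda>n t. \<Sum>k<n. digit (3 ^ (k * d + e b) * t) * (1/2) ^ Suc k) (g b) sequentially"
      unfolding g_def
      by (rule Weierstrass_m_test[OF _ half]) (auto simp: digit_range mult_le_cancel_right2)
    then show ?thesis
    proof (rule uniform_limit_theorem[rotated])
      have "continuous_on UNIV (\<lambda>t. digit (c * t))" for c
        by (rule continuous_on_compose2[OF continuous_digit]) (auto intro!: continuous_intros)
      then show "\<forall>\<^sub>F n in sequentially. continuous_on UNIV (\<lambda>t. \<Sum>k<n. digit (3 ^ (k * d + e b) * t) * (1/2) ^ Suc k)"
        by (intro always_eventually allI continuous_intros)
    qed simp
  qed
  define S where "S t = (\<Sum>b\<in>Basis. (2 * g b t - 1) *\<^sub>R b)" for t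
  have "continuous_on UNIV S" unfolding S_def[abs_def]
    by (intro continuous_intros cont)
  moreover have "\<exists>t\<in>{0..1}. S t = u" if u: "norm u \<le> 1" for u
  proof -
    have "\<bar>u \<bullet> b\<bar> \<le> 1" if "b \<in> Basis" for b
      using Basis_le_norm[OF that, of u] u by linarith
    then have "\<forall>b\<in>Basis. \<exists>a::nat \<Rightarrow> real. (\<forall>k. a k = 0 \<or> a k = 1) \<and> (\<lambda>k. a k * (1/2) ^ Suc k) sums ((u \<bullet> b + 1) / 2)"
    proof (intro ballI binary_expansion)
      fix b :: 'a assume b: "b \<in> Basis"
      assume "\<And>b. b \<in> Basis \<Longrightarrow> \<bar>u \<bullet> b\<bar> \<le> 1"
      from this[OF b] have "- 1 \<le> u \<bullet> b" "u \<bullet> b \<le> 1" by linarith+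
      then show "0 \<le> (u \<bullet> b + 1) / 2" "(u \<bullet> b + 1) / 2 \<le> 1" by simp_all
    qed
    then obtain a where a: "\<And>b k. b \<in> Basis \<Longrightarrow> a b k = 0 \<or> a b k = (1::real)"
      "\<And>b. b \<in> Basis \<Longrightarrow> (\<lambda>k. a b k * (1/2) ^ Suc k) sums ((u \<bullet> b + 1) / 2)"
      by metis
    \<comment> \<open>Interleaves the binary digits of the coordinates into one sequence.\<close>
    define a' where "a' m = a (inv_into Basis e (m mod d)) (m div d)" for m
    have inv: "inv_into Basis e i \<in> Basis" if "i < d" for i
      using e that by (intro inv_into_into) (auto simp: bij_betw_def)
    have a'01: "a' m = 0 \<or> a' m = 1" for m
      unfolding a'_def by (rule a(1)[OF inv]) (use d0 in auto)
    obtain t where t: "t \<in> {0..1}" "\<And>m. digit (3 ^ m * t) = a' m"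
      using digits_realize[of a', OF a'01] by blast
    have "a' (k * d + e b) = a b k" if "b \<in> Basis" for b k
      using ed[OF that] d0 e that by (simp add: a'_def inv_into_f_f bij_betw_def)
    then have "g b t = (u \<bullet> b + 1) / 2" if "b \<in> Basis" for b
      unfolding g_def t(2) using sums_unique[OF a(2)[OF that]] that by simp
    then have "S t = (\<Sum>b\<in>Basis. (u \<bullet> b) *\<^sub>R b)"
      unfolding S_def by (intro sum.cong) (auto simp: field_simps)
    then show ?thesis using t(1) by (auto simp: euclidean_representation)
  qed
  ultimately show ?thesis by blast
qed

text \<open>Choose the first parameter at which the curve hits \<Phi> y. This is measurable since it
  is at most a exactly when \<Phi> y lies in the compact image of an initial interval, so the
  sublevel sets are closed.\<close>

lemma borel_section:
  fixes S :: "real \<Rightarrow> 'a::euclidean_space" and \<Phi> :: "'b::topological_space \<Rightarrow> 'a"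
  assumes S: "continuous_on UNIV S" and \<Phi>: "continuous_on UNIV \<Phi>"
    and sur: "\<And>y. \<exists>t\<in>{0..1}. S t = \<Phi> y"
  shows "\<exists>H\<in>borel_measurable borel. \<forall>y. H y \<in> {0..1} \<and> S (H y) = \<Phi> y"
proof -
  define F where "F y = {t\<in>{0..1}. S t = \<Phi> y}" for y
  define H where "H y = Inf (F y)" for y
  have cS: "continuous_on X S" for X using S continuous_on_subset by blast
  have cF: "compact (F y)" for y
  proof -
    have "closed (S -` {\<Phi> y})" by (rule closed_vimage[OF closed_singleton S])
    then have "compact ({0..1} \<inter> S -` {\<Phi> y})" by (intro compact_Int_closed compact_Icc)
    moreover have "F y = {0..1} \<inter> S -` {\<Phi> y}" by (auto simp: F_def)
    ultimately show ?thesis by simp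
  qed
  have HF: "H y \<in> F y" for y
    unfolding H_def
  proof (rule closed_contains_Inf)
    show "F y \<noteq> {}" using sur[of y] by (auto simp: F_def)
    show "bdd_below (F y)" by (auto simp: F_def intro!: bdd_belowI[of _ 0])
    show "closed (F y)" by (rule compact_imp_closed[OF cF])
  qed
  have Hle: "H y \<le> t" if "t \<in> F y" for y t
    unfolding H_def by (rule cInf_lower[OF that]) (auto simp: F_def intro!: bdd_belowI[of _ 0])
  have "{y. H y \<le> a} = \<Phi> -` (S ` {0..min 1 a})" for a
  proof (intro set_eqI iffI)
    fix y assume "y \<in> {y. H y \<le> a}"
    then show "y \<in> \<Phi> -` (S ` {0..min 1 a})" using HF[of y] by (auto simp: F_def intro!: image_eqI[of _ S "H y"])
  next
    fix y assume "y \<in> \<Phi> -` (S ` {0..min 1 a})"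
    then obtain t where "t \<in> {0..min 1 a}" "\<Phi> y = S t" by auto
    then show "y \<in> {y. H y \<le> a}" using Hle[of t y] by (auto simp: F_def)
  qed
  moreover have "closed (\<Phi> -` (S ` {0..min 1 a}))" for a :: real
    by (intro closed_vimage[OF _ \<Phi>] compact_imp_closed compact_continuous_image cS compact_Icc)
  ultimately have "H \<in> borel_measurable borel"
    by (intro borel_measurableI_le) (simp add: borel_closed)
  then show ?thesis using HF unfolding F_def by blast
qed

text \<open>Vague convergence, tested against sequences of bounded functions with common bounded support
  that converge continuously; this allows double integrals to be treated one variable at a time.\<close>

definition vague_conv :: "(nat \<Rightarrow> 'a::euclidean_space measure) \<Rightarrow> 'a measure \<Rightarrow> bool" where
  "vague_conv N \<nu> \<longleftrightarrow> sets \<nu> = sets borel \<and> (\<forall>R. emeasure \<nu> (ball 0 R) < \<infinity>) \<and>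
     (\<forall>f g B R. (\<forall>j. f j \<in> borel_measurable borel) \<and> g \<in> borel_measurable borel \<and>
        (\<forall>j x. \<bar>f j x\<bar> \<le> B) \<and> (\<forall>j x. x \<notin> ball 0 R \<longrightarrow> f j x = (0::real)) \<and>
        (\<forall>X x. X \<longlonglongrightarrow> x \<longrightarrow> (\<lambda>j. f j (X j)) \<longlonglongrightarrow> g x)
        \<longrightarrow> (\<lambda>j. \<integral>x. f j x \<partial>N j) \<longlonglongrightarrow> (\<integral>x. g x \<partial>\<nu>))"

text \<open>The weight decays one power faster than the measure can grow, so its total mass is
  bounded in terms of \<Lambda> and s alone. It turns nice measures, which may be infinite, into
  measures of uniformly bounded mass.\<close>

lemma nice_measure_weight:
  fixes \<mu> :: "'a::euclidean_space measure"
  assumes nice: "nice_measure s \<mu> \<Lambda>" "0 \<le> \<Lambda>" and s: "s > 0"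
  shows "(\<integral>\<^sup>+y. ennreal (max 1 (norm y) powr (- s - 1)) \<partial>\<mu>) \<le> ennreal (\<Lambda> + \<Lambda> * 2 powr s / (1 - 2 powr (- 1)))"
proof -
  have sb: "ball 0 1 \<in> sets \<mu>" unfolding nice_measure_sets[OF nice(1)] by simp
  have "closed {y::'a. 1 \<le> dist y 0}"
    by (intro closed_Collect_le continuous_intros)
  then have sc: "{y. 1 \<le> dist y 0} \<in> sets \<mu>" unfolding nice_measure_sets[OF nice(1)] by (rule borel_closed)
  have "(\<lambda>y::'a. ennreal (dist y 0 powr (- s - 1))) \<in> borel_measurable borel" by measurable
  then have m: "(\<lambda>y. ennreal (dist y 0 powr (- s - 1))) \<in> borel_measurable \<mu>"
    by (simp add: measurable_cong_sets[OF nice_measure_sets[OF nice(1)] refl])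
  have "(\<integral>\<^sup>+y. ennreal (max 1 (norm y) powr (- s - 1)) \<partial>\<mu>) \<le>
    (\<integral>\<^sup>+y. indicator (ball 0 1) y + indicator {y. 1 \<le> dist y 0} y * ennreal (dist y 0 powr (- s - 1)) \<partial>\<mu>)"
    by (intro nn_integral_mono) (auto simp: indicator_def max_def)
  also have "\<dots> = emeasure \<mu> (ball 0 1) + (\<integral>\<^sup>+y. indicator {y. 1 \<le> dist y 0} y * ennreal (dist y 0 powr (- s - 1)) \<partial>\<mu>)"
    by (subst nn_integral_add) (auto simp only: nn_integral_indicator[OF sb] intro!: borel_measurable_times_ennreal borel_measurable_indicator sb sc m)
  also have "\<dots> \<le> ennreal (\<Lambda> * 1 powr s) + ennreal (\<Lambda> * 2 powr s / (1 - 2 powr (- 1)) * 1 powr (- 1))"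
    by (intro add_mono nice_measure_ball[OF nice(1)] nice_measure_tail[OF nice]) (use s in auto)
  also have "\<dots> = ennreal (\<Lambda> + \<Lambda> * 2 powr s / (1 - 2 powr (- 1)))"
    using nice(2) by (subst ennreal_plus[symmetric]) (auto simp: powr_minus)
  finally show ?thesis .
qed

text \<open>After weighting, the measures have bounded mass and are transported to \<open>[0, 1]\<close> by a Borel section of a
  space-filling curve, where Helly's selection theorem and Skorohod's representation apply.\<close>

theorem vague_compactness:
  fixes N :: "nat \<Rightarrow> 'a::euclidean_space measure"
  assumes nice: "\<And>j. nice_measure s (N j) \<Lambda>" and \<Lambda>: "0 \<le> \<Lambda>" and s: "s > 0"
    and nz: "\<And>j. emeasure (N j) UNIV \<noteq> 0"
  shows "\<exists>\<sigma> \<nu>. strict_mono \<sigma> \<and> vague_conv (\<lambda>j. N (\<sigma> j)) \<nu>"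
proof -
  have sN: "sets (N j) = sets borel" "space (N j) = UNIV" for j
    using nice_measure_sets[OF nice] nice_measure_space[OF nice] by auto
  note [measurable_cong] = sN(1)
  define w where "w y = max 1 (norm y) powr (- s - 1)" for y :: 'a
  have w0: "w y > 0" for y by (simp add: w_def)
  have wc: "continuous_on UNIV w" unfolding w_def[abs_def] by (intro continuous_intros) auto
  have [measurable]: "w \<in> borel_measurable borel" by (rule borel_measurable_continuous_onI[OF wc])
  define b where "b = \<Lambda> + \<Lambda> * 2 powr s / (1 - 2 powr (- 1))"
  have b0: "b \<ge> 0" using \<Lambda> by (auto simp: b_def powr_minus)
  have Wb: "(\<integral>\<^sup>+y. ennreal (w y) \<partial>N j) \<le> ennreal b" for j
    unfolding w_def b_def by (rule nice_measure_weight[OF nice \<Lambda> s])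
  define m where "m j = enn2real (\<integral>\<^sup>+y. ennreal (w y) \<partial>N j)" for j
  have mW: "ennreal (m j) = (\<integral>\<^sup>+y. ennreal (w y) \<partial>N j)" for j
    unfolding m_def using Wb[of j] by (simp add: top_unique le_less_trans less_top)
  have mb: "m j \<le> b" for j using Wb[of j] b0 unfolding m_def by (rule enn2real_leI[rotated])
  have m0: "m j > 0" for j
  proof -
    have "(\<integral>\<^sup>+y. ennreal (w y) \<partial>N j) \<noteq> 0"
    proof
      assume "(\<integral>\<^sup>+y. ennreal (w y) \<partial>N j) = 0"
      then have "AE y in N j. ennreal (w y) = 0" by (subst (asm) nn_integral_0_iff_AE) measurable
      then have "AE y in N j. False" using w0 by (auto elim!: eventually_mono simp: not_le[symmetric] ennreal_eq_0_iff)
      then have "emeasure (N j) (space (N j)) = 0" by (simp add: eventually_False ae_filter_eq_bot_iff)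
      then show False using nz sN(2) by auto
    qed
    then show ?thesis unfolding mW[symmetric] by (simp add: ennreal_eq_0_iff)
  qed
  obtain S :: "real \<Rightarrow> 'a" where S: "continuous_on UNIV S" "\<And>u. norm u \<le> 1 \<Longrightarrow> \<exists>t\<in>{0..1}. S t = u"
    using space_filling_curve by blast
  have [measurable]: "S \<in> borel_measurable borel" by (rule borel_measurable_continuous_onI[OF S(1)])
  \<comment> \<open>\<Phi> maps the space homeomorphically onto the open unit ball, with inverse
    \<Psi>; the unit sphere then plays the role of infinity.\<close>
  define \<Phi> where "\<Phi> y = (1 / (1 + norm y)) *\<^sub>R y" for y :: 'a
  define \<Psi> where "\<Psi> u = (1 / (1 - norm u)) *\<^sub>R u" for u :: 'a
  have [measurable]: "\<Psi> \<in> borel_measurable borel" unfolding \<Psi>_def[abs_def] by measurable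
  have pos1: "1 + norm y > 0" for y :: 'a using norm_ge_zero[of y] by linarith
  have n\<Phi>: "norm (\<Phi> y) < 1" for y using pos1[of y] by (simp add: \<Phi>_def)
  have \<Psi>\<Phi>: "\<Psi> (\<Phi> y) = y" for y
  proof -
    have "1 - norm (\<Phi> y) = 1 / (1 + norm y)" using pos1[of y] by (simp add: \<Phi>_def field_simps)
    then show ?thesis using pos1[of y] by (simp add: \<Psi>_def \<Phi>_def)
  qed
  have "continuous_on UNIV \<Phi>" unfolding \<Phi>_def[abs_def]
    by (intro continuous_intros) (use pos1 in \<open>auto simp: less_imp_neq[symmetric]\<close>)
  then obtain H where H [measurable]: "H \<in> borel_measurable borel" and HS: "\<And>y. H y \<in> {0..1}" "\<And>y. S (H y) = \<Phi> y"
    using borel_section[OF S(1), of \<Phi>] S(2) n\<Phi> by (metis less_imp_le)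
  define P where "P j = distr (density (N j) (\<lambda>y. ennreal (w y / m j))) borel H" for j
  have prob: "prob_space (density (N j) (\<lambda>y. ennreal (w y / m j)))" for j
  proof
    have "(\<integral>\<^sup>+y. ennreal (w y / m j) \<partial>N j) = (\<integral>\<^sup>+y. ennreal (1 / m j) * ennreal (w y) \<partial>N j)"
      using m0[of j] w0 by (intro nn_integral_cong) (simp add: ennreal_mult[symmetric] less_imp_le)
    also have "\<dots> = ennreal (1 / m j) * ennreal (m j)"
      unfolding mW by (rule nn_integral_cmult) measurable
    also have "\<dots> = 1" using m0[of j] by (simp add: ennreal_mult[symmetric])
    finally show "emeasure (density (N j) (\<lambda>y. ennreal (w y / m j))) (space (density (N j) (\<lambda>y. ennreal (w y / m j)))) = 1"
      by (simp add: emeasure_density sN(2))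
  qed
  have rP: "real_distribution (P j)" for j
    unfolding P_def by (rule prob_space.real_distribution_distr[OF prob]) measurable
  \<comment> \<open>All these laws live on [0, 1]. The interval is extended to -1 because tightness
    is stated with intervals open on the left, which must not lose the point 0.\<close>
  have "tight P"
    unfolding tight_def
  proof (intro conjI allI impI rP)
    fix \<epsilon> :: real assume "\<epsilon> > 0"
    have "measure (P j) {-1<..1} = 1" for j
    proof -
      interpret real_distribution "P j" by (rule rP)
      have "AE t in P j. t \<in> {-1<..1}"
        unfolding P_def using HS(1) by (subst AE_distr_iff) (auto intro!: AE_I2 simp: less_le_trans[of "-1" 0])
      then show ?thesis by (intro prob_eq_1[THEN iffD2]) auto
    qed
    then show "\<exists>a b. a < b \<and> (\<forall>n. 1 - \<epsilon> < measure (P n) {a<..b})"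
      using \<open>\<epsilon> > 0\<close> by (intro exI[of _ "-1"] exI[of _ 1]) auto
  qed
  \<comment> \<open>Normalising to probabilities loses the masses \<open>m j\<close>, so their limit
    is extracted separately. It may be 0, in which case \<nu> is the zero measure.\<close>
  have "\<exists>l\<in>{0..b}. \<exists>r. strict_mono r \<and> (m \<circ> r) \<longlonglongrightarrow> l"
    using compact_Icc[of 0 b] mb m0 unfolding compact_def by (metis atLeastAtMost_iff less_imp_le)
  then obtain ml \<sigma>1 where ml: "ml \<ge> 0" "strict_mono \<sigma>1" "(m \<circ> \<sigma>1) \<longlonglongrightarrow> ml" by auto
  obtain \<sigma>2 M where M: "strict_mono \<sigma>2" "real_distribution M" "weak_conv_m (P \<circ> \<sigma>1 \<circ> \<sigma>2) M"
    using tight_imp_convergent_subsubsequence[OF \<open>tight P\<close> ml(2)] by blast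
  define \<sigma> where "\<sigma> = \<sigma>1 \<circ> \<sigma>2"
  have \<sigma>: "strict_mono \<sigma>" unfolding \<sigma>_def by (rule strict_mono_o[OF ml(2) M(1)])
  have m\<sigma>: "(\<lambda>j. m (\<sigma> j)) \<longlonglongrightarrow> ml"
    using LIMSEQ_subseq_LIMSEQ[OF ml(3) M(1)] by (simp add: \<sigma>_def comp_def)
  interpret M: real_distribution M by (rule M(2))
  \<comment> \<open>Undoes the weight and restores the limiting mass. Parameters with |S t| \<ge> 1
    get density 0: mass there corresponds to mass that has escaped to infinity, which a vague limit
    drops.\<close>
  define W where "W t = (if norm (S t) < 1 then ml / w (\<Psi> (S t)) else 0)" for t
  have [measurable]: "W \<in> borel_measurable borel" unfolding W_def[abs_def] by measurable
  have W0: "W t \<ge> 0" for t using ml(1) w0 by (auto simp: W_def less_imp_le)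
  define \<nu> where "\<nu> = distr (density M (\<lambda>t. ennreal (W t))) borel (\<lambda>t. \<Psi> (S t))"
  have s\<nu>: "sets \<nu> = sets borel" by (simp add: \<nu>_def)
  \<comment> \<open>Dividing by the weight makes integration of f against \<open>N j\<close> equal
    to \<open>m j\<close> times integration of \<open>G f\<close> against \<open>P j\<close>, and
    likewise with \<open>ml\<close> and M for \<nu>.\<close>
  define G where "G f t = (if norm (S t) < 1 then f (\<Psi> (S t)) / w (\<Psi> (S t)) else 0)" for f :: "'a \<Rightarrow> real" and t
  have Gm: "G f \<in> borel_measurable borel" if [measurable]: "f \<in> borel_measurable borel" for f
    unfolding G_def[abs_def] by measurable
  have int\<nu>: "(\<integral>x. g x \<partial>\<nu>) = ml * (\<integral>t. G g t \<partial>M)" if [measurable]: "g \<in> borel_measurable borel" for g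
  proof -
    have "(\<integral>x. g x \<partial>\<nu>) = (\<integral>t. W t *\<^sub>R g (\<Psi> (S t)) \<partial>M)"
      unfolding \<nu>_def by (subst integral_distr, measurable, subst integral_density) (auto simp: W0)
    also have "\<dots> = (\<integral>t. ml * G g t \<partial>M)"
      by (intro Bochner_Integration.integral_cong) (auto simp: W_def G_def)
    finally show ?thesis by simp
  qed
  have intN: "(\<integral>x. f x \<partial>N j) = m j * (\<integral>t. G f t \<partial>P j)" if [measurable]: "f \<in> borel_measurable borel" for f j
  proof -
    note [measurable] = Gm[OF that]
    have "(\<integral>t. G f t \<partial>P j) = (\<integral>y. (w y / m j) *\<^sub>R G f (H y) \<partial>N j)"
      unfolding P_def
      by (subst integral_distr, measurable, subst integral_density)
         (use m0[of j] w0 in \<open>auto simp: less_imp_le intro!: AE_I2 divide_nonneg_nonneg\<close>)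
    also have "\<dots> = (\<integral>y. (1 / m j) * f y \<partial>N j)"
      using w0 by (intro Bochner_Integration.integral_cong) (auto simp: G_def HS(2) n\<Phi> \<Psi>\<Phi> less_imp_neq[symmetric])
    finally show ?thesis using m0[of j] by simp
  qed
  have fin: "emeasure \<nu> (ball 0 R) < \<infinity>" for R
  proof -
    define c where "c = ml / (max 1 \<bar>R\<bar> powr (- s - 1))"
    have "(\<lambda>t. \<Psi> (S t)) \<in> borel_measurable borel" by measurable
    from measurable_sets[OF this, of "ball 0 R"]
    have [measurable]: "(\<lambda>t. \<Psi> (S t)) -` ball 0 R \<in> sets borel" by simp
    have "emeasure \<nu> (ball 0 R) = (\<integral>\<^sup>+t. ennreal (W t) * indicator ((\<lambda>t. \<Psi> (S t)) -` ball 0 R) t \<partial>M)"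
      unfolding \<nu>_def by (subst emeasure_distr, measurable, subst emeasure_density) (auto simp: M.space_eq_univ)
    also have "\<dots> \<le> (\<integral>\<^sup>+t. ennreal c \<partial>M)"
    proof (rule nn_integral_mono)
      fix t
      show "ennreal (W t) * indicator ((\<lambda>t. \<Psi> (S t)) -` ball 0 R) t \<le> ennreal c"
      proof (cases "norm (\<Psi> (S t)) < R \<and> norm (S t) < 1")
        case True
        then have "max 1 \<bar>R\<bar> powr (- s - 1) \<le> w (\<Psi> (S t))"
          unfolding w_def using s by (intro powr_mono2') auto
        then have "W t \<le> c" using True ml(1) by (auto simp: W_def c_def intro!: divide_left_mono mult_pos_pos w0)
        then show ?thesis by (auto simp: indicator_def ennreal_leI)
      qed (auto simp: indicator_def W_def)
    qed
    also have "\<dots> < \<infinity>" using M.emeasure_space_1 by simp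
    finally show ?thesis .
  qed
  have "(\<lambda>j. \<integral>x. f j x \<partial>N (\<sigma> j)) \<longlonglongrightarrow> (\<integral>x. g x \<partial>\<nu>)"
    if f: "\<And>j. f j \<in> borel_measurable borel" and g: "g \<in> borel_measurable borel" and B: "\<And>j x. \<bar>f j x\<bar> \<le> B"
      and R: "\<And>j x. x \<notin> ball 0 R \<Longrightarrow> f j x = (0::real)" and conv: "\<And>X x. X \<longlonglongrightarrow> x \<Longrightarrow> (\<lambda>j. f j (X j)) \<longlonglongrightarrow> g x"
    for f g B R
  proof -
    have B0: "B \<ge> 0" using B[of 0 0] by linarith
    have rP': "real_distribution ((P \<circ> \<sigma>1 \<circ> \<sigma>2) n)" for n by (simp add: rP)
    \<comment> \<open>Weak convergence alone handles one fixed test function. Realising the laws by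
      variables that converge pointwise reduces the case of varying \<open>f j\<close> to continuous
      convergence and dominated convergence.\<close>
    obtain Q :: "real measure" and Ys Y where Q': "prob_space Q \<and> (\<forall>n. Ys n \<in> measurable Q borel) \<and>
      (\<forall>n. distr Q borel (Ys n) = (P \<circ> \<sigma>1 \<circ> \<sigma>2) n) \<and> Y \<in> measurable Q lborel \<and> distr Q borel Y = M \<and>
      (\<forall>x \<in> space Q. (\<lambda>n. Ys n x) \<longlonglongrightarrow> Y x)"
      using Skorohod[OF rP' M(2,3)] by (elim exE) (rule that)
    have Q: "prob_space Q" "\<And>n. Ys n \<in> measurable Q borel"
      "\<And>n. distr Q borel (Ys n) = (P \<circ> \<sigma>1 \<circ> \<sigma>2) n" "Y \<in> measurable Q lborel" "distr Q borel Y = M"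
      "\<And>x. x \<in> space Q \<Longrightarrow> (\<lambda>n. Ys n x) \<longlonglongrightarrow> Y x"
      using Q' by blast+
    interpret Q: prob_space Q by (rule Q(1))
    have Ym [measurable]: "Y \<in> borel_measurable Q" using Q(4) by simp
    note [measurable] = Q(2) Gm[OF f] Gm[OF g]
    have "(\<lambda>j. \<integral>x. G (f j) (Ys j x) \<partial>Q) \<longlonglongrightarrow> (\<integral>x. G g (Y x) \<partial>Q)"
    proof (rule integral_dominated_convergence[where w="\<lambda>_. B / (max 1 \<bar>R\<bar> powr (- s - 1))"])
      show "AE x in Q. (\<lambda>j. G (f j) (Ys j x)) \<longlonglongrightarrow> G g (Y x)"
      proof (rule AE_I2)
        fix x assume "x \<in> space Q"
        define u where "u = S (Y x)"
        define U where "U j = S (Ys j x)" for j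
        have U: "U \<longlonglongrightarrow> u"
          unfolding U_def[abs_def] u_def using S(1) Q(6)[OF \<open>x \<in> space Q\<close>]
          by (intro isCont_tendsto_compose[where g=S]) (auto simp: continuous_on_eq_continuous_at)
        have nU: "(\<lambda>j. norm (U j)) \<longlonglongrightarrow> norm u" by (rule tendsto_norm[OF U])
        show "(\<lambda>j. G (f j) (Ys j x)) \<longlonglongrightarrow> G g (Y x)"
        proof (cases "norm u < 1")
          case True
          have \<Psi>U: "(\<lambda>j. \<Psi> (U j)) \<longlonglongrightarrow> \<Psi> u"
            unfolding \<Psi>_def using True by (intro tendsto_intros U) auto
          have "(\<lambda>j. w (\<Psi> (U j))) \<longlonglongrightarrow> w (\<Psi> u)"
            using wc \<Psi>U by (intro isCont_tendsto_compose[where g=w]) (auto simp: continuous_on_eq_continuous_at)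
          then have "(\<lambda>j. f j (\<Psi> (U j)) / w (\<Psi> (U j))) \<longlonglongrightarrow> g (\<Psi> u) / w (\<Psi> u)"
            by (intro tendsto_divide conv[OF \<Psi>U]) (use w0[of "\<Psi> u"] in auto)
          moreover have "\<forall>\<^sub>F j in sequentially. f j (\<Psi> (U j)) / w (\<Psi> (U j)) = G (f j) (Ys j x)"
            using order_tendstoD(2)[OF nU True] by eventually_elim (simp add: G_def U_def)
          ultimately have "(\<lambda>j. G (f j) (Ys j x)) \<longlonglongrightarrow> g (\<Psi> u) / w (\<Psi> u)" by (rule Lim_transform_eventually)
          then show ?thesis using True by (simp add: G_def u_def)
        next
          case False
          \<comment> \<open>\<open>R' / (1 + R')\<close> is the radius to which \<Phi> sends the
            sphere of radius \<open>R'\<close>. Once \<open>U j\<close> lies beyond it,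
            \<open>f j\<close> is evaluated outside its support, so the integrand vanishes near
            infinity, in agreement with the value 0 of \<open>G g\<close> there.\<close>
          define R' where "R' = max R 0"
          have R': "R' \<ge> 0" "R \<le> R'" by (auto simp: R'_def)
          have "R' / (1 + R') < 1" using R' by simp
          then have "R' / (1 + R') < norm u" using False by linarith
          then have "\<forall>\<^sub>F j in sequentially. R' / (1 + R') < norm (U j)"
            by (rule order_tendstoD(1)[OF nU])
          then have "\<forall>\<^sub>F j in sequentially. G (f j) (Ys j x) = 0"
          proof eventually_elim
            case (elim j)
            show ?case
            proof (cases "norm (U j) < 1")
              case True
              have "R' < norm (U j) * (1 + R')" using elim R' by (simp add: divide_less_eq)
              then have "R' * (1 - norm (U j)) < norm (U j)" by (simp add: algebra_simps)
              then have "R' < norm (U j) / (1 - norm (U j))" using True by (simp add: less_divide_eq)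
              also have "\<dots> = norm (\<Psi> (U j))" using True by (simp add: \<Psi>_def)
              finally have "R' < norm (\<Psi> (U j))" .
              then show ?thesis using R[of "\<Psi> (U j)" j] R' by (simp add: G_def U_def)
            qed (simp add: G_def U_def)
          qed
          then have "(\<lambda>j. G (f j) (Ys j x)) \<longlonglongrightarrow> 0" by (rule tendsto_eventually)
          then show ?thesis using False by (simp add: G_def u_def)
        qed
      qed
      show "AE x in Q. norm (G (f j) (Ys j x)) \<le> B / (max 1 \<bar>R\<bar> powr (- s - 1))" for j
      proof (rule AE_I2)
        fix x
        define v where "v = \<Psi> (S (Ys j x))"
        have "\<bar>f j v\<bar> / w v \<le> B / (max 1 \<bar>R\<bar> powr (- s - 1))"
        proof (cases "v \<in> ball 0 R")
          case True
          then have "max 1 \<bar>R\<bar> powr (- s - 1) \<le> w v"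
            unfolding w_def using s by (intro powr_mono2') auto
          then show ?thesis using B B0 by (intro frac_le) auto
        qed (use R B0 in auto)
        then show "norm (G (f j) (Ys j x)) \<le> B / (max 1 \<bar>R\<bar> powr (- s - 1))"
          using B0 w0[of v] by (auto simp: G_def v_def[symmetric] abs_divide less_imp_le)
      qed
    qed auto
    moreover have "(\<integral>x. G (f j) (Ys j x) \<partial>Q) = (\<integral>t. G (f j) t \<partial>P (\<sigma> j))" for j
      using Q(3)[of j, symmetric] by (simp add: \<sigma>_def integral_distr)
    moreover have "(\<integral>x. G g (Y x) \<partial>Q) = (\<integral>t. G g t \<partial>M)"
      using Q(5) by (metis integral_distr Ym Gm[OF g])
    ultimately have "(\<lambda>j. m (\<sigma> j) * (\<integral>t. G (f j) t \<partial>P (\<sigma> j))) \<longlonglongrightarrow> ml * (\<integral>t. G g t \<partial>M)"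
      by (intro tendsto_mult m\<sigma>) simp
    then show ?thesis using intN[OF f] int\<nu>[OF g] by simp
  qed
  then have "vague_conv (\<lambda>j. N (\<sigma> j)) \<nu>"
    unfolding vague_conv_def using s\<nu> fin by blast
  then show ?thesis using \<sigma> by blast
qed

section \<open>Vague limits of good measures\<close>

lemma vague_convD:
  fixes f :: "nat \<Rightarrow> 'a::euclidean_space \<Rightarrow> real"
  assumes "vague_conv N \<nu>" "\<And>j. f j \<in> borel_measurable borel" "g \<in> borel_measurable borel"
    "\<And>j x. \<bar>f j x\<bar> \<le> B" "\<And>j x. x \<notin> ball 0 R \<Longrightarrow> f j x = 0"
    "\<And>X x. X \<longlonglongrightarrow> x \<Longrightarrow> (\<lambda>j. f j (X j)) \<longlonglongrightarrow> g x"
  shows "(\<lambda>j. \<integral>x. f j x \<partial>N j) \<longlonglongrightarrow> (\<integral>x. g x \<partial>\<nu>)"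
  using assms unfolding vague_conv_def by blast

lemma vague_conv_integral:
  fixes f :: "nat \<Rightarrow> 'a::euclidean_space \<Rightarrow> 'b::euclidean_space"
  assumes v: "vague_conv N \<nu>" and nice: "\<And>j. nice_measure s (N j) \<Lambda>"
    and f: "\<And>j. f j \<in> borel_measurable borel" and g: "g \<in> borel_measurable borel"
    and B: "\<And>j x. norm (f j x) \<le> B" and R: "\<And>j x. x \<notin> ball 0 R \<Longrightarrow> f j x = 0"
    and conv: "\<And>X x. X \<longlonglongrightarrow> x \<Longrightarrow> (\<lambda>j. f j (X j)) \<longlonglongrightarrow> g x"
  shows "(\<lambda>j. \<integral>x. f j x \<partial>N j) \<longlonglongrightarrow> (\<integral>x. g x \<partial>\<nu>)" and "integrable \<nu> g"
proof -
  have gl: "(\<lambda>j. f j x) \<longlonglongrightarrow> g x" for x using conv[of "\<lambda>_. x"] by simp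
  have gB: "norm (g x) \<le> B" for x
    by (rule LIMSEQ_le_const2[OF tendsto_norm[OF gl]]) (use B in auto)
  have gR: "g x = 0" if "x \<notin> ball 0 R" for x
    using gl[of x] R[OF that] by (simp add: LIMSEQ_const_iff)
  have s\<nu>: "sets \<nu> = sets borel" and fin: "emeasure \<nu> (ball 0 R) < \<infinity>" using v by (auto simp: vague_conv_def)
  show gi: "integrable \<nu> g"
    by (rule integrableI_bounded_set[where A="ball 0 R" and B=B])
       (use g gB gR s\<nu> fin in \<open>auto cong: measurable_cong_sets\<close>)
  have fi: "integrable (N j) (f j)" for j
    by (rule nice_measure_integrable_bounded_support[OF nice f B R])
  show "(\<lambda>j. \<integral>x. f j x \<partial>N j) \<longlonglongrightarrow> (\<integral>x. g x \<partial>\<nu>)"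
  proof (subst tendsto_componentwise_iff, intro ballI)
    fix b :: 'b assume b: "b \<in> Basis"
    have "(\<lambda>j. \<integral>x. f j x \<bullet> b \<partial>N j) \<longlonglongrightarrow> (\<integral>x. g x \<bullet> b \<partial>\<nu>)"
    proof (rule vague_convD[OF v, where B=B and R=R])
      show "\<bar>f j x \<bullet> b\<bar> \<le> B" for j x using Basis_le_norm[OF b, of "f j x"] B[of j x] by linarith
      show "x \<notin> ball 0 R \<Longrightarrow> f j x \<bullet> b = 0" for j x using R[of x j] by simp
      show "X \<longlonglongrightarrow> x \<Longrightarrow> (\<lambda>j. f j (X j) \<bullet> b) \<longlonglongrightarrow> g x \<bullet> b" for X x
        by (intro tendsto_inner conv tendsto_const)
    qed (use f g in measurable)
    then show "(\<lambda>j. (\<integral>x. f j x \<partial>N j) \<bullet> b) \<longlonglongrightarrow> (\<integral>x. g x \<partial>\<nu>) \<bullet> b"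
      using integral_inner_left[OF fi] integral_inner_left[OF gi] by simp
  qed
qed

lemma nn_integral_limit_le:
  fixes u :: "nat \<Rightarrow> 'a \<Rightarrow> ennreal"
  assumes "\<And>k. u k \<in> borel_measurable M" "\<And>x. x \<in> space M \<Longrightarrow> (\<lambda>k. u k x) \<longlonglongrightarrow> u' x"
    and "\<And>k. (\<integral>\<^sup>+x. u k x \<partial>M) \<le> c k" "c \<longlonglongrightarrow> C"
  shows "(\<integral>\<^sup>+x. u' x \<partial>M) \<le> C"
proof -
  have "(\<integral>\<^sup>+x. u' x \<partial>M) = (\<integral>\<^sup>+x. liminf (\<lambda>k. u k x) \<partial>M)"
    by (rule nn_integral_cong, rule lim_imp_Liminf[symmetric]) (use assms(2) in auto)
  also have "\<dots> \<le> liminf (\<lambda>k. \<integral>\<^sup>+x. u k x \<partial>M)"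
    by (rule nn_integral_liminf[OF assms(1)])
  also have "\<dots> \<le> liminf c" by (rule Liminf_mono) (use assms(3) in auto)
  also have "\<dots> = C" by (rule lim_imp_Liminf[OF _ assms(4)]) simp
  finally show ?thesis .
qed

text \<open>Open balls are approximated from below by continuous functions dominated by the
  indicator of the ball. The growth bound holds for their integrals against each \<open>N j\<close>,
  survives the vague limit, and then passes to the ball by Fatou.\<close>

lemma vague_conv_nice:
  assumes v: "vague_conv N \<nu>" and nice: "\<And>j. nice_measure s (N j) \<Lambda>" and \<Lambda>: "0 \<le> \<Lambda>"
  shows "nice_measure s \<nu> \<Lambda>"
  unfolding nice_measure_def
proof (intro conjI allI impI)
  show s\<nu>: "sets \<nu> = sets borel" using v by (simp add: vague_conv_def)
  note [measurable_cong] = s\<nu>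
  fix x :: 'a and r :: real assume r: "r > 0"
  define f where "f k y = max 0 (min 1 (real k * (r - dist x y)))" for k y
  have fm [measurable]: "f k \<in> borel_measurable borel" for k unfolding f_def[abs_def] by measurable
  have f01: "0 \<le> f k y" "f k y \<le> 1" for k y by (auto simp: f_def)
  have f0: "f k y = 0" if "y \<notin> ball x r" for k y
    using that by (auto simp: f_def mult_nonneg_nonpos max_absorb1 min.coboundedI2)
  have f0': "f k y = 0" if "y \<notin> ball 0 (norm x + r)" for k y
    using that norm_triangle_ineq2[of y x] by (intro f0) (auto simp: dist_norm norm_minus_commute)
  have fc: "continuous_on UNIV (f k)" for k unfolding f_def[abs_def] by (intro continuous_intros)
  have conv: "(\<lambda>j. f k (X j)) \<longlonglongrightarrow> f k y" if "X \<longlonglongrightarrow> y" for X y k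
    using fc[of k] that by (intro isCont_tendsto_compose[where g="f k"]) (auto simp: continuous_on_eq_continuous_at)
  have lim: "(\<lambda>j. \<integral>y. f k y \<partial>N j) \<longlonglongrightarrow> (\<integral>y. f k y \<partial>\<nu>)" and fi: "integrable \<nu> (f k)" for k
    by (rule vague_conv_integral[OF v nice fm fm, where B=1 and R="norm x + r"]; use f01 f0' conv in auto)+
  have "(\<integral>y. f k y \<partial>N j) \<le> \<Lambda> * r powr s" for k j
    using nice_measure_norm_integral_le[OF nice \<Lambda>, where g="f k" and B=1 and c=x and r=r] f01 f0[of _ k] r
    by (fastforce simp: indicator_def)
  then have "(\<integral>y. f k y \<partial>\<nu>) \<le> \<Lambda> * r powr s" for k
    by (intro LIMSEQ_le_const2[OF lim]) auto
  then have le: "(\<integral>\<^sup>+y. ennreal (f k y) \<partial>\<nu>) \<le> ennreal (\<Lambda> * r powr s)" for k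
    using f01 by (subst nn_integral_eq_integral[OF fi]) (auto intro!: ennreal_leI)
  have "(\<integral>\<^sup>+y. indicator (ball x r) y \<partial>\<nu>) \<le> ennreal (\<Lambda> * r powr s)"
  proof (rule nn_integral_limit_le[OF _ _ le tendsto_const])
    fix y
    have "(\<lambda>k. f k y) \<longlonglongrightarrow> indicator (ball x r) y"
    proof (cases "y \<in> ball x r")
      case True
      then have p: "r - dist x y > 0" by simp
      obtain n where n: "1 / (r - dist x y) \<le> real n" using real_arch_simple by blast
      have "f k y = 1" if "k \<ge> n" for k
      proof -
        have "1 / (r - dist x y) \<le> real k" using n that by linarith
        then have "1 \<le> real k * (r - dist x y)" using p by (simp add: field_simps)
        then show ?thesis by (simp add: f_def)
      qed
      then show ?thesis using True by (intro tendsto_eventually) (auto simp: eventually_sequentially)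
    qed (simp add: f0)
    then have "(\<lambda>k. ennreal (f k y)) \<longlonglongrightarrow> ennreal (indicator (ball x r) y)" by (rule tendsto_ennrealI)
    then show "(\<lambda>k. ennreal (f k y)) \<longlonglongrightarrow> indicator (ball x r) y" by (simp add: ennreal_indicator)
  qed measurable
  then show "emeasure \<nu> (ball x r) \<le> ennreal (\<Lambda> * r powr s)" using s\<nu> by simp
qed

text \<open>For an indicator, regularity squeezes the set between a compact K and an open U with U -
  K of small measure, and a Urysohn function for the pair is close in L^1. Sums and dominated limits
  extend this to all integrable functions.\<close>

lemma continuous_dense_L1:
  fixes f :: "'a::euclidean_space \<Rightarrow> 'b::euclidean_space"
  assumes sM: "sets M = sets borel" and fM: "finite_measure M" and f: "integrable M f"
  shows "\<forall>\<epsilon>>0. \<exists>g. continuous_on UNIV g \<and> integrable M g \<and> (\<integral>x. norm (f x - g x) \<partial>M) < \<epsilon>"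
  using f
proof (induction rule: integrable_induct)
  case (base A c)
  interpret finite_measure M by (rule fM)
  have sp: "space M = UNIV" using sets_eq_imp_space_eq[OF sM] by simp
  have Ab: "A \<in> sets borel" using base sM by simp
  have Mf: "emeasure M (space M) \<noteq> \<infinity>" by simp
  show ?case
  proof (intro allI impI)
    fix \<epsilon> :: real assume e: "\<epsilon> > 0"
    \<comment> \<open>Chosen so that |c| times 2e' is below \<epsilon>; the added 1 keeps the
      denominator positive when c = 0.\<close>
    define e' where "e' = \<epsilon> / (2 * (norm c + 1))"
    have e': "e' > 0" using e by (simp add: e'_def add_nonneg_pos)
    have "\<exists>U. A \<subseteq> U \<and> open U \<and> emeasure M U < emeasure M A + ennreal e'"
    proof -
      have "emeasure M A < emeasure M A + ennreal e'" using e' by (simp add: emeasure_eq_measure ennreal_less_iff flip: ennreal_plus)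
      then have "(INF U\<in>{U. A \<subseteq> U \<and> open U}. emeasure M U) < emeasure M A + ennreal e'"
        using outer_regular[OF sM Mf Ab] by simp
      then show ?thesis unfolding INF_less_iff by auto
    qed
    then obtain U where U: "A \<subseteq> U" "open U" "emeasure M U < emeasure M A + ennreal e'" by blast
    have Us: "U \<in> sets M" using U(2) sM by simp
    have mU: "measure M U < measure M A + e'"
      using U(3) e' by (simp add: emeasure_eq_measure ennreal_less_iff flip: ennreal_plus)
    have "\<exists>K. K \<subseteq> A \<and> compact K \<and> measure M A < measure M K + e'"
    proof (cases "measure M A = 0")
      \<comment> \<open>Null sets are treated apart because \<open>ennreal\<close> sends a negative
        \<open>measure M A - e'\<close> to 0, and the strict inequality below then rests on A having
        positive measure.\<close>
      case True
      then show ?thesis using e' by (intro exI[of _ "{}"]) auto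
    next
      case False
      have "ennreal (measure M A - e') < emeasure M A"
        unfolding emeasure_eq_measure using e' False measure_nonneg[of M A] by (intro ennreal_lessI) linarith+
      then have "ennreal (measure M A - e') < (SUP K\<in>{K. K \<subseteq> A \<and> compact K}. emeasure M K)"
        using inner_regular[OF sM Mf Ab] by simp
      then obtain K where "K \<subseteq> A" "compact K" "ennreal (measure M A - e') < emeasure M K"
        unfolding less_SUP_iff by auto
      moreover from this(3) have "measure M A - e' < measure M K"
        by (cases "measure M A - e' \<ge> 0") (auto simp: emeasure_eq_measure ennreal_less_iff less_le_trans[OF _ measure_nonneg])
      ultimately show ?thesis by (intro exI[of _ K]) auto
    qed
    then obtain K where K: "K \<subseteq> A" "compact K" "measure M A < measure M K + e'" by blast
    have Ks: "K \<in> sets M" using K(2) sM by (simp add: borel_compact)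
    obtain u :: "'a \<Rightarrow> real" where u: "continuous_on UNIV u" "\<And>x. u x \<in> closed_segment 1 0"
      "\<And>x. x \<in> K \<Longrightarrow> u x = 1" "\<And>x. x \<in> - U \<Longrightarrow> u x = 0"
      using Urysohn[of K "- U" "1::real" 0] K U by (metis compact_imp_closed closed_Compl disjoint_eq_subset_Compl double_complement subset_trans)
    have u01: "0 \<le> u x" "u x \<le> 1" for x using u(2)[of x] by (auto simp: closed_segment_eq_real_ivl)
    have um: "u \<in> borel_measurable M"
      using borel_measurable_continuous_onI[OF u(1)] sM by (simp cong: measurable_cong_sets)
    have ui: "integrable M (\<lambda>x. u x *\<^sub>R c)"
      by (rule integrable_const_bound[where B="norm c"]) (use u01 um in \<open>auto intro!: AE_I2 mult_left_le_one_le\<close>)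
    have "(\<integral>x. norm (indicator A x *\<^sub>R c - u x *\<^sub>R c) \<partial>M) \<le> (\<integral>x. norm c * indicator (U - K) x \<partial>M)"
    proof (rule integral_mono)
      show "integrable M (\<lambda>x. norm (indicator A x *\<^sub>R c - u x *\<^sub>R c))"
        by (intro integrable_norm Bochner_Integration.integrable_diff ui) (use base in auto)
      show "integrable M (\<lambda>x. norm c * indicator (U - K) x)"
        using Us Ks by (intro integrable_mult_right integrable_real_indicator) (auto simp: less_top[symmetric])
      fix x
      have "norm (indicator A x *\<^sub>R c - u x *\<^sub>R c) = \<bar>indicator A x - u x\<bar> * norm c"
        by (simp flip: scaleR_diff_left)
      also have "\<dots> \<le> indicator (U - K) x * norm c"
      proof (rule mult_right_mono)
        show "\<bar>indicator A x - u x\<bar> \<le> indicator (U - K) x"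
          using u01[of x] u(3)[of x] u(4)[of x] U(1) K(1) by (auto simp: indicator_def)
      qed simp
      finally show "norm (indicator A x *\<^sub>R c - u x *\<^sub>R c) \<le> norm c * indicator (U - K) x"
        by (simp add: mult.commute)
    qed
    also have "\<dots> = norm c * measure M (U - K)" using sp by simp
    also have "measure M (U - K) = measure M U - measure M K"
      using U(1) K(1) Us Ks by (intro finite_measure_Diff) auto
    also have "norm c * (measure M U - measure M K) \<le> norm c * (2 * e')"
      using mU K(3) by (intro mult_left_mono) auto
    also have "\<dots> < (norm c + 1) * (2 * e')" using e' by simp
    also have "\<dots> = \<epsilon>"
    proof -
      have "q * (2 * (\<epsilon> / (2 * q))) = \<epsilon>" if "q > 0" for q using that by simp
      from this[of "norm c + 1"] show ?thesis unfolding e'_def by (simp add: add_nonneg_pos)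
    qed
    finally show "\<exists>g. continuous_on UNIV g \<and> integrable M g \<and> (\<integral>x. norm (indicator A x *\<^sub>R c - g x) \<partial>M) < \<epsilon>"
      using ui u(1) by (intro exI[of _ "\<lambda>x. u x *\<^sub>R c"]) (auto intro!: continuous_intros)
  qed
next
  case (add f1 f2)
  show ?case
  proof (intro allI impI)
    fix \<epsilon> :: real assume "\<epsilon> > 0"
    then obtain g1 g2 where g: "continuous_on UNIV g1" "integrable M g1" "(\<integral>x. norm (f1 x - g1 x) \<partial>M) < \<epsilon> / 2"
      "continuous_on UNIV g2" "integrable M g2" "(\<integral>x. norm (f2 x - g2 x) \<partial>M) < \<epsilon> / 2"
      using add.IH[THEN spec, of "\<epsilon> / 2"] by auto
    have "(\<integral>x. norm (f1 x + f2 x - (g1 x + g2 x)) \<partial>M) \<le> (\<integral>x. norm (f1 x - g1 x) + norm (f2 x - g2 x) \<partial>M)"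
      using add.hyps g by (intro integral_mono) (auto intro!: norm_diff_triangle_ineq)
    also have "\<dots> < \<epsilon>" using add.hyps g by simp
    finally show "\<exists>g. continuous_on UNIV g \<and> integrable M g \<and> (\<integral>x. norm (f1 x + f2 x - g x) \<partial>M) < \<epsilon>"
      using g by (intro exI[of _ "\<lambda>x. g1 x + g2 x"]) (auto intro!: continuous_intros)
  qed
next
  case (lim f' fs)
  show ?case
  proof (intro allI impI)
    fix \<epsilon> :: real assume e: "\<epsilon> > 0"
    have "(\<lambda>i. \<integral>x. norm (fs i x - f' x) \<partial>M) \<longlonglongrightarrow> (\<integral>x. 0 \<partial>M)"
    proof (rule integral_dominated_convergence[where w="\<lambda>x. 3 * norm (f' x)"])
      show "AE x in M. (\<lambda>i. norm (fs i x - f' x)) \<longlonglongrightarrow> 0"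
        using lim.hyps(2) by (intro AE_I2) (simp add: LIM_zero tendsto_norm_zero)
      show "AE x in M. norm (norm (fs i x - f' x)) \<le> 3 * norm (f' x)" for i
      proof (intro AE_I2)
        fix x assume "x \<in> space M"
        then show "norm (norm (fs i x - f' x)) \<le> 3 * norm (f' x)"
          using lim.hyps(3)[of x i] norm_triangle_ineq4[of "fs i x" "f' x"] by simp
      qed
    qed (use lim.hyps in auto)
    then have "\<forall>\<^sub>F i in sequentially. (\<integral>x. norm (fs i x - f' x) \<partial>M) < \<epsilon> / 2"
      using e by (intro order_tendstoD) auto
    then obtain i where i: "(\<integral>x. norm (fs i x - f' x) \<partial>M) < \<epsilon> / 2"
      by (auto simp: eventually_sequentially)
    obtain g where g: "continuous_on UNIV g" "integrable M g" "(\<integral>x. norm (fs i x - g x) \<partial>M) < \<epsilon> / 2"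
      using lim.IH[of i, THEN spec, of "\<epsilon> / 2"] e by auto
    have "(\<integral>x. norm (f' x - g x) \<partial>M) \<le> (\<integral>x. norm (fs i x - f' x) + norm (fs i x - g x) \<partial>M)"
    proof (rule integral_mono)
      fix x
      show "norm (f' x - g x) \<le> norm (fs i x - f' x) + norm (fs i x - g x)"
        by (metis dist_norm dist_triangle3)
    qed (use lim.hyps g in auto)
    also have "\<dots> < \<epsilon>" using lim.hyps g i by simp
    finally show "\<exists>g. continuous_on UNIV g \<and> integrable M g \<and> (\<integral>x. norm (f' x - g x) \<partial>M) < \<epsilon>"
      using g by blast
  qed
qed

section \<open>Operator bounds pass to vague limits\<close>

context CZ_kernel
begin

lemma T_trunc_bounded_support:
  assumes nice: "nice_measure s \<mu> \<Lambda>" "0 \<le> \<Lambda>" and \<delta>: "\<delta> > 0"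
    and f: "f \<in> borel_measurable borel" "\<And>y. cmod (f y) \<le> B" "\<forall>y. y \<notin> ball 0 R \<longrightarrow> f y = 0"
  shows "integrable \<mu> (\<lambda>y. f y *s Kt \<delta> (x - y))"
    and "T_trunc \<Omega> s \<mu> \<delta> f x = (\<integral>y. f y *s Kt \<delta> (x - y) \<partial>\<mu>)"
    and "T_trunc \<Omega> s \<mu> \<delta> f \<in> borel_measurable borel"
    and "norm (T_trunc \<Omega> s \<mu> \<delta> f x) \<le> B * \<delta> powr (- s) * (\<Lambda> * \<bar>R\<bar> powr s)"
proof -
  interpret sigma_finite_measure \<mu> by (rule nice_measure_sigma_finite[OF nice(1)])
  note [measurable] = f(1)
  note [measurable_cong] = nice_measure_sets[OF nice(1)]
  have B: "B \<ge> 0" using f(2)[of 0] norm_ge_zero order_trans by blast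
  have b: "norm (f y *s Kt \<delta> (x - y)) \<le> B * \<delta> powr (- s)" for x y
    unfolding norm_vector_scalar_mult using B by (intro mult_mono f(2) norm_Kt_le'[OF \<delta>]) auto
  have z: "f y *s Kt \<delta> (x - y) = 0" if "y \<notin> ball 0 R" for x y using f(3) that by simp
  have int: "integrable \<mu> (\<lambda>y. f y *s Kt \<delta> (x - y))" for x
    by (rule nice_measure_integrable_bounded_support[OF nice(1) _ b z]) measurable
  then show "integrable \<mu> (\<lambda>y. f y *s Kt \<delta> (x - y))" .
  have eq: "T_trunc \<Omega> s \<mu> \<delta> f x = (\<integral>y. f y *s Kt \<delta> (x - y) \<partial>\<mu>)" for x by (rule T_trunc_eq[OF int])
  then show "T_trunc \<Omega> s \<mu> \<delta> f x = (\<integral>y. f y *s Kt \<delta> (x - y) \<partial>\<mu>)" .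
  have "(\<lambda>x. \<integral>y. f y *s Kt \<delta> (x - y) \<partial>\<mu>) \<in> borel_measurable borel" by measurable
  then show "T_trunc \<Omega> s \<mu> \<delta> f \<in> borel_measurable borel" by (simp add: eq[abs_def])
  have "norm (f y *s Kt \<delta> (x - y)) \<le> B * \<delta> powr (- s) * indicator (ball 0 R) y" for y
    using b[of y x] z[of y x] by (cases "y \<in> ball 0 R") auto
  then show "norm (T_trunc \<Omega> s \<mu> \<delta> f x) \<le> B * \<delta> powr (- s) * (\<Lambda> * \<bar>R\<bar> powr s)"
    unfolding eq using B by (intro nice_measure_norm_integral_le[OF nice]) auto
qed

text \<open>The integrand depends on j through the moving point \<open>X j\<close>; continuity of
  the truncated kernel makes it converge continuously. The conclusion is again continuous
  convergence, so the outer integral can be treated in the same way.\<close>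

lemma T_trunc_vague:
  assumes v: "vague_conv N \<nu>" and nice: "\<And>j. nice_measure s (N j) \<Lambda>" "0 \<le> \<Lambda>" and \<delta>: "\<delta> > 0"
    and f: "continuous_on UNIV f" "\<And>y. cmod (f y) \<le> B" "\<forall>y. y \<notin> ball 0 R \<longrightarrow> f y = 0"
    and X: "X \<longlonglongrightarrow> x"
  shows "(\<lambda>j. T_trunc \<Omega> s (N j) \<delta> f (X j)) \<longlonglongrightarrow> T_trunc \<Omega> s \<nu> \<delta> f x"
proof -
  have nv: "nice_measure s \<nu> \<Lambda>" by (rule vague_conv_nice[OF v nice])
  have fm [measurable]: "f \<in> borel_measurable borel" by (rule borel_measurable_continuous_onI[OF f(1)])
  have B: "B \<ge> 0" using f(2)[of 0] norm_ge_zero order_trans by blast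
  note T = T_trunc_bounded_support(2)[OF _ nice(2) \<delta> fm f(2,3)]
  have "(\<lambda>j. \<integral>y. f y *s Kt \<delta> (X j - y) \<partial>N j) \<longlonglongrightarrow> (\<integral>y. f y *s Kt \<delta> (x - y) \<partial>\<nu>)"
  proof (rule vague_conv_integral(1)[OF v nice(1), where B="B * \<delta> powr (- s)" and R=R])
    show "norm (f y *s Kt \<delta> (X j - y)) \<le> B * \<delta> powr (- s)" for j y
      unfolding norm_vector_scalar_mult using B by (intro mult_mono f(2) norm_Kt_le'[OF \<delta>]) auto
    show "(\<lambda>j. f (Y j) *s Kt \<delta> (X j - Y j)) \<longlonglongrightarrow> f y *s Kt \<delta> (x - y)" if "Y \<longlonglongrightarrow> y" for Y y
    proof -
      have "(\<lambda>j. f (Y j)) \<longlonglongrightarrow> f y"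
        using f(1) that by (intro isCont_tendsto_compose[where g=f]) (auto simp: continuous_on_eq_continuous_at)
      moreover have "(\<lambda>j. Kt \<delta> (X j - Y j)) \<longlonglongrightarrow> Kt \<delta> (x - y)"
        using continuous_Kt[OF \<delta>] that X
        by (intro isCont_tendsto_compose[where g="Kt \<delta>"] tendsto_diff) (auto simp: continuous_on_eq_continuous_at)
      ultimately show ?thesis unfolding vector_scalar_mult_def by (intro tendsto_intros)
    qed
  qed (use f(3) in auto)
  then show ?thesis by (simp add: T[OF nice(1)] T[OF nv])
qed

text \<open>For f in C_c the functions T_\<delta> f converge continuously but do not have bounded
  support. A cutoff \<eta>_k makes the vague limit applicable, with a bound free of k, and Fatou
  then removes the cutoff.\<close>

lemma good_measure_vague_Cc:
  assumes v: "vague_conv N \<nu>" and good: "\<And>j. good_measure \<Omega> s (N j) \<Lambda>" and \<Lambda>: "\<Lambda> > 0" and \<delta>: "\<delta> > 0"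
    and f: "continuous_on UNIV f" "\<And>y. cmod (f y) \<le> B" "\<forall>y. y \<notin> ball 0 R \<longrightarrow> f y = 0"
  shows "(\<integral>\<^sup>+x. ennreal ((norm (T_trunc \<Omega> s \<nu> \<delta> f x))\<^sup>2) \<partial>\<nu>) \<le> ennreal (\<Lambda>\<^sup>2 * (\<integral>x. (cmod (f x))\<^sup>2 \<partial>\<nu>))"
proof -
  have nice: "nice_measure s (N j) \<Lambda>" for j using good by (simp add: good_measure_def)
  have nv: "nice_measure s \<nu> \<Lambda>" by (rule vague_conv_nice[OF v nice less_imp_le[OF \<Lambda>]])
  have \<Lambda>0: "\<Lambda> \<ge> 0" using \<Lambda> by simp
  have fm [measurable]: "f \<in> borel_measurable borel" by (rule borel_measurable_continuous_onI[OF f(1)])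
  have B: "B \<ge> 0" using f(2)[of 0] norm_ge_zero order_trans by blast
  note T = T_trunc_bounded_support[OF _ \<Lambda>0 \<delta> fm f(2,3)]
  note [measurable] = T(3)[OF nice] T(3)[OF nv]
  have sb: "(cmod (f x))\<^sup>2 \<le> B\<^sup>2" for x using f(2) by (intro power_mono) auto
  have fi: "integrable \<mu> (\<lambda>x. (cmod (f x))\<^sup>2)" if "nice_measure s \<mu> \<Lambda>" for \<mu>
    by (rule nice_measure_integrable_bounded_support[OF that, where B="B\<^sup>2" and c=0 and r=R]) (use sb f(3) in auto)
  have E: "(\<lambda>j. \<integral>x. (cmod (f x))\<^sup>2 \<partial>N j) \<longlonglongrightarrow> (\<integral>x. (cmod (f x))\<^sup>2 \<partial>\<nu>)"
  proof (rule vague_conv_integral(1)[OF v nice, where B="B\<^sup>2" and R=R])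
    show "X \<longlonglongrightarrow> x \<Longrightarrow> (\<lambda>j. (cmod (f (X j)))\<^sup>2) \<longlonglongrightarrow> (cmod (f x))\<^sup>2" for X x
      using f(1) by (intro tendsto_intros isCont_tendsto_compose[where g=f]) (auto simp: continuous_on_eq_continuous_at)
  qed (use sb f(3) in auto)
  define C where "C = B * \<delta> powr (- s) * (\<Lambda> * \<bar>R\<bar> powr s)"
  have C: "C \<ge> 0" using B \<Lambda> by (simp add: C_def)
  define \<eta> where "\<eta> k x = max 0 (min 1 (real k - norm x))" for k and x :: 'a
  have \<eta>: "0 \<le> \<eta> k x" "\<eta> k x \<le> 1" "x \<notin> ball 0 (real k) \<Longrightarrow> \<eta> k x = 0" for k x by (auto simp: \<eta>_def)
  have [measurable]: "\<eta> k \<in> borel_measurable borel" for k unfolding \<eta>_def[abs_def] by measurable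
  have cut: "(\<integral>\<^sup>+x. ennreal (\<eta> k x * (norm (T_trunc \<Omega> s \<nu> \<delta> f x))\<^sup>2) \<partial>\<nu>) \<le> ennreal (\<Lambda>\<^sup>2 * (\<integral>x. (cmod (f x))\<^sup>2 \<partial>\<nu>))" for k
  proof -
    have b: "\<bar>\<eta> k x * (norm (T_trunc \<Omega> s \<mu> \<delta> f x))\<^sup>2\<bar> \<le> C\<^sup>2" if "nice_measure s \<mu> \<Lambda>" for x \<mu>
    proof -
      have "(norm (T_trunc \<Omega> s \<mu> \<delta> f x))\<^sup>2 \<le> C\<^sup>2" unfolding C_def by (rule power_mono[OF T(4)[OF that]]) simp
      then have "\<eta> k x * (norm (T_trunc \<Omega> s \<mu> \<delta> f x))\<^sup>2 \<le> 1 * C\<^sup>2" using \<eta>[where x=x] by (intro mult_mono) auto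
      then show ?thesis using \<eta>(1)[where x=x] by (simp add: abs_mult)
    qed
    have z: "x \<notin> ball 0 (real k) \<Longrightarrow> \<eta> k x * (norm (T_trunc \<Omega> s \<mu> \<delta> f x))\<^sup>2 = 0" for x \<mu> using \<eta>(3)[of x k] by simp
    have L: "(\<lambda>j. \<integral>x. \<eta> k x * (norm (T_trunc \<Omega> s (N j) \<delta> f x))\<^sup>2 \<partial>N j) \<longlonglongrightarrow> (\<integral>x. \<eta> k x * (norm (T_trunc \<Omega> s \<nu> \<delta> f x))\<^sup>2 \<partial>\<nu>)"
      and I: "integrable \<nu> (\<lambda>x. \<eta> k x * (norm (T_trunc \<Omega> s \<nu> \<delta> f x))\<^sup>2)"
    proof -
      have conv: "(\<lambda>j. \<eta> k (X j) * (norm (T_trunc \<Omega> s (N j) \<delta> f (X j)))\<^sup>2) \<longlonglongrightarrow> \<eta> k x * (norm (T_trunc \<Omega> s \<nu> \<delta> f x))\<^sup>2"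
        if "X \<longlonglongrightarrow> x" for X x
        unfolding \<eta>_def by (intro tendsto_intros that T_trunc_vague[OF v nice \<Lambda>0 \<delta> f that])
      note V = vague_conv_integral[where B="C\<^sup>2" and R="real k"
          and f="\<lambda>j x. \<eta> k x * (norm (T_trunc \<Omega> s (N j) \<delta> f x))\<^sup>2" and g="\<lambda>x. \<eta> k x * (norm (T_trunc \<Omega> s \<nu> \<delta> f x))\<^sup>2", OF v nice]
      show "(\<lambda>j. \<integral>x. \<eta> k x * (norm (T_trunc \<Omega> s (N j) \<delta> f x))\<^sup>2 \<partial>N j) \<longlonglongrightarrow> (\<integral>x. \<eta> k x * (norm (T_trunc \<Omega> s \<nu> \<delta> f x))\<^sup>2 \<partial>\<nu>)"
        by (rule V(1); (measurable; fail | use b[OF nice] z conv in \<open>auto; fail\<close>))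
      show "integrable \<nu> (\<lambda>x. \<eta> k x * (norm (T_trunc \<Omega> s \<nu> \<delta> f x))\<^sup>2)"
        by (rule V(2); (measurable; fail | use b[OF nice] z conv in \<open>auto; fail\<close>))
    qed
    have "(\<integral>x. \<eta> k x * (norm (T_trunc \<Omega> s (N j) \<delta> f x))\<^sup>2 \<partial>N j) \<le> \<Lambda>\<^sup>2 * (\<integral>x. (cmod (f x))\<^sup>2 \<partial>N j)" for j
    proof -
      note [measurable_cong] = nice_measure_sets[OF nice[of j]]
      have "(\<integral>\<^sup>+x. ennreal (\<eta> k x * (norm (T_trunc \<Omega> s (N j) \<delta> f x))\<^sup>2) \<partial>N j) \<le> (\<integral>\<^sup>+x. ennreal ((norm (T_trunc \<Omega> s (N j) \<delta> f x))\<^sup>2) \<partial>N j)"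
        using \<eta> by (intro nn_integral_mono ennreal_leI mult_left_le_one_le) auto
      also have "\<dots> \<le> ennreal (\<Lambda>\<^sup>2) * (\<integral>\<^sup>+x. ennreal ((cmod (f x))\<^sup>2) \<partial>N j)"
        using good[of j] \<delta> unfolding good_measure_def by auto
      also have "\<dots> = ennreal (\<Lambda>\<^sup>2 * (\<integral>x. (cmod (f x))\<^sup>2 \<partial>N j))"
        by (subst nn_integral_eq_integral[OF fi[OF nice]]) (auto simp: ennreal_mult)
      finally have "(\<integral>\<^sup>+x. ennreal (\<eta> k x * (norm (T_trunc \<Omega> s (N j) \<delta> f x))\<^sup>2) \<partial>N j) \<le> ennreal (\<Lambda>\<^sup>2 * (\<integral>x. (cmod (f x))\<^sup>2 \<partial>N j))" .
      then show ?thesis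
        using \<eta> by (subst integral_eq_nn_integral) (auto intro!: enn2real_leI)
    qed
    then have "(\<integral>x. \<eta> k x * (norm (T_trunc \<Omega> s \<nu> \<delta> f x))\<^sup>2 \<partial>\<nu>) \<le> \<Lambda>\<^sup>2 * (\<integral>x. (cmod (f x))\<^sup>2 \<partial>\<nu>)"
      by (intro LIMSEQ_le[OF L tendsto_mult[OF tendsto_const E]]) auto
    then show ?thesis
      using \<eta> by (subst nn_integral_eq_integral[OF I]) (auto intro!: ennreal_leI)
  qed
  show ?thesis
  proof (rule nn_integral_limit_le[OF _ _ cut tendsto_const])
    note [measurable_cong] = nice_measure_sets[OF nv]
    show "(\<lambda>x. ennreal (\<eta> k x * (norm (T_trunc \<Omega> s \<nu> \<delta> f x))\<^sup>2)) \<in> borel_measurable \<nu>" for k by measurable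
    fix x :: 'a
    obtain n where n: "norm x + 1 \<le> real n" using real_arch_simple by blast
    have "\<eta> k x = 1" if "k \<ge> n" for k using n that by (simp add: \<eta>_def)
    then have "\<forall>\<^sub>F k in sequentially. ennreal (\<eta> k x * (norm (T_trunc \<Omega> s \<nu> \<delta> f x))\<^sup>2) = ennreal ((norm (T_trunc \<Omega> s \<nu> \<delta> f x))\<^sup>2)"
      unfolding eventually_sequentially by (intro exI[of _ n]) auto
    then show "(\<lambda>k. ennreal (\<eta> k x * (norm (T_trunc \<Omega> s \<nu> \<delta> f x))\<^sup>2)) \<longlonglongrightarrow> ennreal ((norm (T_trunc \<Omega> s \<nu> \<delta> f x))\<^sup>2)"
      by (rule tendsto_eventually)
  qed
qed

text \<open>Approximation in L^1 by continuous functions suffices: the truncated kernel is bounded,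
  so T_\<delta> h_n converges pointwise, and the common bound B turns L^1 closeness into convergence
  of the squared norms. Fatou does the rest.\<close>

lemma good_measure_vague_bounded:
  assumes v: "vague_conv N \<nu>" and good: "\<And>j. good_measure \<Omega> s (N j) \<Lambda>" and \<Lambda>: "\<Lambda> > 0" and \<delta>: "\<delta> > 0"
    and f: "f \<in> borel_measurable borel" "\<And>y. cmod (f y) \<le> B" "\<forall>y. y \<notin> ball 0 R \<longrightarrow> f y = 0"
  shows "(\<integral>\<^sup>+x. ennreal ((norm (T_trunc \<Omega> s \<nu> \<delta> f x))\<^sup>2) \<partial>\<nu>) \<le> ennreal (\<Lambda>\<^sup>2) * (\<integral>\<^sup>+x. ennreal ((cmod (f x))\<^sup>2) \<partial>\<nu>)"
proof -
  have nice: "nice_measure s (N j) \<Lambda>" for j using good by (simp add: good_measure_def)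
  have nv: "nice_measure s \<nu> \<Lambda>" by (rule vague_conv_nice[OF v nice less_imp_le[OF \<Lambda>]])
  note sv = nice_measure_sets[OF nv]
  note [measurable_cong] = sv
  note [measurable] = f(1)
  have \<Lambda>0: "\<Lambda> \<ge> 0" using \<Lambda> by simp
  have B: "B \<ge> 0" using f(2)[of 0] norm_ge_zero order_trans by blast
  \<comment> \<open>Restriction to a ball gives a finite measure, for which L^1 density is
    available; the extra 1 in the radius leaves room for the transition of the continuous cutoff
    \<eta>.\<close>
  define M where "M = density \<nu> (indicator (ball 0 (R + 1)))"
  have bs [measurable]: "ball 0 (R + 1) \<in> sets \<nu>" unfolding sv by simp
  have sM: "sets M = sets borel" by (simp add: M_def sv)
  have fM: "finite_measure M"
  proof
    have "emeasure M (space M) = emeasure \<nu> (ball 0 (R + 1))"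
      unfolding M_def by (subst emeasure_density) (auto simp: nice_measure_space[OF nv] nn_integral_cmult_indicator[symmetric] intro!: nn_integral_cong)
    then show "emeasure M (space M) \<noteq> \<infinity>" using nice_measure_ball_finite[OF nv, of 0 "R + 1"] by simp
  qed
  interpret M: finite_measure M by (rule fM)
  have fb: "f \<in> borel_measurable M" using f(1) sM by (simp cong: measurable_cong_sets)
  have fiM: "integrable M f" by (rule M.integrable_const_bound[where B=B]) (use f(2) fb in auto)
  have "\<forall>n::nat. \<exists>g. continuous_on UNIV g \<and> integrable M g \<and> (\<integral>x. norm (f x - g x) \<partial>M) < 1 / real (Suc n)"
    using continuous_dense_L1[OF sM fM fiM] by simp
  then obtain g where g: "\<And>n. continuous_on UNIV (g n)" "\<And>n. integrable M (g n)"
    "\<And>n. (\<integral>x. norm (f x - g n x) \<partial>M) < 1 / real (Suc n)" by metis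
  have gm [measurable]: "g n \<in> borel_measurable borel" for n by (rule borel_measurable_continuous_onI[OF g(1)])
  \<comment> \<open>Nearest-point projection onto the disc of radius B. It is 1-Lipschitz and fixes
    the values of f, so enforcing the bound on the approximants does not increase the L^1
    error.\<close>
  define cp where "cp z = closest_point (cball 0 B) z" for z :: complex
  have cp: "cmod (cp z) \<le> B" for z
    using closest_point_in_set[of "cball 0 B" z] B by (simp add: cp_def)
  have cpl: "dist (cp y) (cp z) \<le> dist y z" for y z
    unfolding cp_def by (rule closest_point_lipschitz) (use B in auto)
  have cpf: "cp z = z" if "cmod z \<le> B" for z
    using that unfolding cp_def by (intro closest_point_self) simp
  have cpc: "continuous_on UNIV cp"
    unfolding cp_def[abs_def] by (rule continuous_on_closest_point) (use B in auto)
  define \<eta> where "\<eta> x = max 0 (min 1 (R + 1 - norm x))" for x :: 'a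
  define h where "h n x = \<eta> x *\<^sub>R cp (g n x)" for n x
  have hc: "continuous_on UNIV (h n)" for n
    unfolding h_def \<eta>_def by (intro continuous_intros continuous_on_compose2[OF cpc g(1)]) auto
  have hm [measurable]: "h n \<in> borel_measurable borel" for n by (rule borel_measurable_continuous_onI[OF hc])
  have hb: "cmod (h n x) \<le> B" for n x
  proof -
    have "cmod (h n x) \<le> 1 * B" unfolding h_def norm_scaleR by (intro mult_mono cp) (auto simp: \<eta>_def)
    then show ?thesis by simp
  qed
  have h0: "\<forall>x. x \<notin> ball 0 (R + 1) \<longrightarrow> h n x = 0" for n by (simp add: h_def \<eta>_def)
  have hf: "cmod (h n x - f x) \<le> indicator (ball 0 (R + 1)) x * cmod (f x - g n x)" for n x
  proof (cases "x \<in> ball 0 (R + 1)")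
    case True
    have d: "cmod (cp (g n x) - f x) \<le> cmod (f x - g n x)"
      using cpl[of "g n x" "f x"] cpf[OF f(2)] by (simp add: dist_norm norm_minus_commute)
    show ?thesis
    proof (cases "x \<in> ball 0 R")
      case x: True
      then have "\<eta> x = 1" by (simp add: \<eta>_def)
      then show ?thesis using d True by (simp add: h_def)
    next
      case False
      have "\<bar>\<eta> x\<bar> * cmod (cp (g n x)) \<le> 1 * cmod (cp (g n x))"
        by (intro mult_right_mono) (auto simp: \<eta>_def)
      then show ?thesis using d f(3)[rule_format, OF False] True by (simp add: h_def)
    qed
  next
    case False
    then show ?thesis using h0[rule_format, OF False] f(3) by simp
  qed
  have hi: "integrable \<nu> (h n)" for n by (rule nice_measure_integrable_bounded_support[OF nv hm hb h0[rule_format]])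
  have fi: "integrable \<nu> f" by (rule nice_measure_integrable_bounded_support[OF nv f(1,2) f(3)[rule_format]])
  have di: "integrable \<nu> (\<lambda>x. cmod (h n x - f x))" for n using hi fi by auto
  have dist: "(\<integral>x. cmod (h n x - f x) \<partial>\<nu>) \<le> 1 / real (Suc n)" for n
  proof -
    have gfi: "integrable M (\<lambda>x. cmod (f x - g n x))" using fiM g(2) by auto
    have Md: "M = density \<nu> (\<lambda>x. ennreal (indicator (ball 0 (R + 1)) x))" by (simp add: M_def ennreal_indicator)
    have "integrable \<nu> (\<lambda>x. indicator (ball 0 (R + 1)) x *\<^sub>R cmod (f x - g n x))"
      using gfi unfolding Md by (subst (asm) integrable_density) auto
    then have "(\<integral>x. cmod (h n x - f x) \<partial>\<nu>) \<le> (\<integral>x. indicator (ball 0 (R + 1)) x *\<^sub>R cmod (f x - g n x) \<partial>\<nu>)"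
      by (intro integral_mono di) (use hf in auto)
    also have "\<dots> = (\<integral>x. cmod (f x - g n x) \<partial>M)"
      unfolding Md by (subst integral_density) auto
    also have "\<dots> \<le> 1 / real (Suc n)" using g(3)[of n] by simp
    finally show ?thesis .
  qed
  have lim0: "(\<lambda>n. c * (1 / real (Suc n))) \<longlonglongrightarrow> 0" for c :: real
    by (rule tendsto_mult_right_zero[OF LIMSEQ_Suc[OF lim_1_over_n]])
  have Tn: "(\<lambda>n. T_trunc \<Omega> s \<nu> \<delta> (h n) x) \<longlonglongrightarrow> T_trunc \<Omega> s \<nu> \<delta> f x" for x
  proof -
    note Th = T_trunc_bounded_support[OF nv \<Lambda>0 \<delta> hm hb h0] and Tf = T_trunc_bounded_support[OF nv \<Lambda>0 \<delta> f]
    have "norm (T_trunc \<Omega> s \<nu> \<delta> (h n) x - T_trunc \<Omega> s \<nu> \<delta> f x) \<le> \<delta> powr (- s) * (1 / real (Suc n))" for n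
    proof -
      have "T_trunc \<Omega> s \<nu> \<delta> (h n) x - T_trunc \<Omega> s \<nu> \<delta> f x = (\<integral>y. (h n y - f y) *s Kt \<delta> (x - y) \<partial>\<nu>)"
        unfolding Th(2) Tf(2) using Th(1)[of n x] Tf(1)[of x]
        by (simp add: vector_sub_rdistrib flip: Bochner_Integration.integral_diff)
      also have "norm \<dots> \<le> (\<integral>y. norm ((h n y - f y) *s Kt \<delta> (x - y)) \<partial>\<nu>)" by (rule integral_norm_bound)
      also have "\<dots> \<le> (\<integral>y. \<delta> powr (- s) * cmod (h n y - f y) \<partial>\<nu>)"
      proof (rule integral_mono)
        show "integrable \<nu> (\<lambda>y. norm ((h n y - f y) *s Kt \<delta> (x - y)))"
          using Bochner_Integration.integrable_diff[OF Th(1)[of n x] Tf(1)[of x]]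
          by (intro integrable_norm) (simp add: vector_sub_rdistrib)
        show "integrable \<nu> (\<lambda>y. \<delta> powr (- s) * cmod (h n y - f y))" by (intro integrable_mult_right di)
        fix y show "norm ((h n y - f y) *s Kt \<delta> (x - y)) \<le> \<delta> powr (- s) * cmod (h n y - f y)"
          unfolding norm_vector_scalar_mult mult.commute[of "\<delta> powr - s"]
          by (intro mult_left_mono norm_Kt_le'[OF \<delta>]) simp
      qed
      also have "\<dots> \<le> \<delta> powr (- s) * (1 / real (Suc n))"
        unfolding integral_mult_right_zero by (intro mult_left_mono dist) simp
      finally show ?thesis .
    qed
    then have "(\<lambda>n. T_trunc \<Omega> s \<nu> \<delta> (h n) x - T_trunc \<Omega> s \<nu> \<delta> f x) \<longlonglongrightarrow> 0"
      by (intro Lim_null_comparison[OF _ lim0[of "\<delta> powr - s"]]) auto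
    then show ?thesis by (rule LIM_zero_cancel)
  qed
  have sqi: "integrable \<nu> (\<lambda>x. (cmod (u x))\<^sup>2)" if [measurable]: "u \<in> borel_measurable borel" and u: "\<And>x. cmod (u x) \<le> B" "\<forall>x. x \<notin> ball 0 r \<longrightarrow> u x = 0" for u r
    by (rule nice_measure_integrable_bounded_support[OF nv, where B="B\<^sup>2" and c=0 and r=r]) (use u in \<open>auto intro!: power_mono\<close>)
  define E where "E = (\<integral>x. (cmod (f x))\<^sup>2 \<partial>\<nu>)"
  have sqf: "integrable \<nu> (\<lambda>x. (cmod (f x))\<^sup>2)" by (rule sqi[OF f])
  have hE: "(\<integral>x. (cmod (h n x))\<^sup>2 \<partial>\<nu>) \<le> E + 2 * B * (1 / real (Suc n))" for n
  proof -
    have "(\<integral>x. (cmod (h n x))\<^sup>2 \<partial>\<nu>) \<le> (\<integral>x. (cmod (f x))\<^sup>2 + 2 * B * cmod (h n x - f x) \<partial>\<nu>)"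
    proof (rule integral_mono)
      show "integrable \<nu> (\<lambda>x. (cmod (h n x))\<^sup>2)" by (rule sqi[OF hm hb h0])
      show "integrable \<nu> (\<lambda>x. (cmod (f x))\<^sup>2 + 2 * B * cmod (h n x - f x))" using sqf di by auto
      fix x
      have "(cmod (h n x))\<^sup>2 - (cmod (f x))\<^sup>2 = (cmod (h n x) + cmod (f x)) * (cmod (h n x) - cmod (f x))"
        by (simp add: power2_eq_square algebra_simps)
      also have "\<dots> \<le> (cmod (h n x) + cmod (f x)) * cmod (h n x - f x)"
        by (intro mult_left_mono norm_triangle_ineq2) auto
      also have "\<dots> \<le> (2 * B) * cmod (h n x - f x)"
        using hb[of n x] f(2)[of x] by (intro mult_right_mono) auto
      finally show "(cmod (h n x))\<^sup>2 \<le> (cmod (f x))\<^sup>2 + 2 * B * cmod (h n x - f x)" by simp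
    qed
    also have "\<dots> = E + 2 * B * (\<integral>x. cmod (h n x - f x) \<partial>\<nu>)" using sqf di by (simp add: E_def)
    also have "\<dots> \<le> E + 2 * B * (1 / real (Suc n))" using B by (intro add_left_mono mult_left_mono dist) auto
    finally show ?thesis .
  qed
  have "(\<integral>\<^sup>+x. ennreal ((norm (T_trunc \<Omega> s \<nu> \<delta> f x))\<^sup>2) \<partial>\<nu>) \<le> ennreal (\<Lambda>\<^sup>2 * E)"
  proof (rule nn_integral_limit_le)
    show "(\<lambda>x. ennreal ((norm (T_trunc \<Omega> s \<nu> \<delta> (h n) x))\<^sup>2)) \<in> borel_measurable \<nu>" for n
      using T_trunc_bounded_support(3)[OF nv \<Lambda>0 \<delta> hm hb h0, of n] by measurable
    show "(\<lambda>n. ennreal ((norm (T_trunc \<Omega> s \<nu> \<delta> (h n) x))\<^sup>2)) \<longlonglongrightarrow> ennreal ((norm (T_trunc \<Omega> s \<nu> \<delta> f x))\<^sup>2)" for x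
      by (intro tendsto_ennrealI tendsto_intros Tn)
    show "(\<integral>\<^sup>+x. ennreal ((norm (T_trunc \<Omega> s \<nu> \<delta> (h n) x))\<^sup>2) \<partial>\<nu>) \<le> ennreal (\<Lambda>\<^sup>2 * (E + 2 * B * (1 / real (Suc n))))" for n
      by (rule order_trans[OF good_measure_vague_Cc[OF v good \<Lambda> \<delta> hc hb h0] ennreal_leI[OF mult_left_mono[OF hE]]]) simp
    have "(\<lambda>n. \<Lambda>\<^sup>2 * (E + 2 * B * (1 / real (Suc n)))) \<longlonglongrightarrow> \<Lambda>\<^sup>2 * (E + 0)"
      by (intro tendsto_intros lim0)
    then show "(\<lambda>n. ennreal (\<Lambda>\<^sup>2 * (E + 2 * B * (1 / real (Suc n))))) \<longlonglongrightarrow> ennreal (\<Lambda>\<^sup>2 * E)"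
      by (intro tendsto_ennrealI) simp
  qed
  also have "\<dots> = ennreal (\<Lambda>\<^sup>2) * (\<integral>\<^sup>+x. ennreal ((cmod (f x))\<^sup>2) \<partial>\<nu>)"
    unfolding E_def by (subst nn_integral_eq_integral[OF sqf]) (auto simp: ennreal_mult)
  finally show ?thesis .
qed

text \<open>The final stage, from bounded f of bounded support to all of L^2: truncate f in size and
  space. Because f is dominated in L^2 and the kernel is square integrable, T_\<delta> of the
  truncations converges pointwise, and Fatou applies once more.\<close>

theorem good_measure_vague:
  assumes v: "vague_conv N \<nu>" and good: "\<And>j. good_measure \<Omega> s (N j) \<Lambda>" and \<Lambda>: "\<Lambda> > 0"
  shows "good_measure \<Omega> s \<nu> \<Lambda>"
  unfolding good_measure_def
proof (intro conjI allI impI)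
  have nice: "nice_measure s (N j) \<Lambda>" for j using good by (simp add: good_measure_def)
  show nv: "nice_measure s \<nu> \<Lambda>" by (rule vague_conv_nice[OF v nice less_imp_le[OF \<Lambda>]])
  note [measurable_cong] = nice_measure_sets[OF nv]
  have \<Lambda>0: "\<Lambda> \<ge> 0" using \<Lambda> by simp
  fix \<delta> :: real and f :: "'a \<Rightarrow> complex" assume \<delta>: "\<delta> > 0" and "f \<in> borel_measurable \<nu>"
  then have fm [measurable]: "f \<in> borel_measurable borel" by (simp add: measurable_cong_sets[OF nice_measure_sets[OF nv] refl])
  let ?F = "\<integral>\<^sup>+x. ennreal ((cmod (f x))\<^sup>2) \<partial>\<nu>"
  show "(\<integral>\<^sup>+x. ennreal ((norm (T_trunc \<Omega> s \<nu> \<delta> f x))\<^sup>2) \<partial>\<nu>) \<le> ennreal (\<Lambda>\<^sup>2) * ?F"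
  proof (cases "?F < \<infinity>")
    \<comment> \<open>An infinite right-hand side is trivial since \<Lambda> > 0; this leaves f in
      L^2, where \<open>T_trunc\<close> is an absolutely convergent integral.\<close>
    case False
    then have "?F = top" by (simp add: not_less top_unique)
    then have "ennreal (\<Lambda>\<^sup>2) * ?F = top" using \<Lambda> by (simp add: ennreal_mult_top)
    then show ?thesis by simp
  next
    case True
    define h where "h n x = (if cmod (f x) \<le> real n \<and> norm x < real n then f x else 0)" for n x
    have hm [measurable]: "h n \<in> borel_measurable borel" for n unfolding h_def[abs_def] by measurable
    have hb: "cmod (h n x) \<le> real n" for n x by (simp add: h_def)
    have h0: "\<forall>x. x \<notin> ball 0 (real n) \<longrightarrow> h n x = 0" for n by (simp add: h_def)
    have hle: "cmod (h n x) \<le> cmod (f x)" for n x by (simp add: h_def)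
    have hlim: "(\<lambda>n. h n x) \<longlonglongrightarrow> f x" for x
    proof -
      obtain m where m: "max (cmod (f x)) (norm x + 1) \<le> real m" using real_arch_simple by blast
      have "h n x = f x" if "n \<ge> m" for n using m that by (auto simp: h_def)
      then show ?thesis by (intro tendsto_eventually) (auto simp: eventually_sequentially)
    qed
    note Th = T_trunc_bounded_support[OF nv \<Lambda>0 \<delta> hm hb h0] and Tf = T_trunc_L2[OF nv \<Lambda>0 \<delta> fm True]
    show ?thesis
    proof (rule nn_integral_limit_le[OF _ _ _ tendsto_const])
      show "(\<lambda>x. ennreal ((norm (T_trunc \<Omega> s \<nu> \<delta> (h n) x))\<^sup>2)) \<in> borel_measurable \<nu>" for n
        using Th(3)[of n] by measurable
      have "(\<lambda>n. T_trunc \<Omega> s \<nu> \<delta> (h n) x) \<longlonglongrightarrow> T_trunc \<Omega> s \<nu> \<delta> f x" for x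
        unfolding Th(2) Tf(2)
      proof (rule integral_dominated_convergence[where w="\<lambda>y. norm (f y *s Kt \<delta> (x - y))"])
        show "integrable \<nu> (\<lambda>y. norm (f y *s Kt \<delta> (x - y)))" by (rule integrable_norm[OF Tf(1)])
        show "AE y in \<nu>. (\<lambda>n. h n y *s Kt \<delta> (x - y)) \<longlonglongrightarrow> f y *s Kt \<delta> (x - y)"
          unfolding vector_scalar_mult_def by (intro AE_I2 tendsto_intros hlim)
        show "AE y in \<nu>. norm (h n y *s Kt \<delta> (x - y)) \<le> norm (f y *s Kt \<delta> (x - y))" for n
          unfolding norm_vector_scalar_mult by (intro AE_I2 mult_right_mono hle) auto
      qed measurable
      then show "(\<lambda>n. ennreal ((norm (T_trunc \<Omega> s \<nu> \<delta> (h n) x))\<^sup>2)) \<longlonglongrightarrow> ennreal ((norm (T_trunc \<Omega> s \<nu> \<delta> f x))\<^sup>2)" for x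
        by (intro tendsto_ennrealI tendsto_intros)
      show "(\<integral>\<^sup>+x. ennreal ((norm (T_trunc \<Omega> s \<nu> \<delta> (h n) x))\<^sup>2) \<partial>\<nu>) \<le> ennreal (\<Lambda>\<^sup>2) * ?F" for n
        by (rule order_trans[OF good_measure_vague_bounded[OF v good \<Lambda> \<delta> hm hb h0]])
           (auto intro!: mult_left_mono nn_integral_mono ennreal_leI power_mono hle)
    qed
  qed
qed

end

section \<open>Upper density\<close>

lemma nice_measure_null_singleton:
  assumes nice: "nice_measure s \<mu> \<Lambda>" "0 \<le> \<Lambda>" and s: "s > 0"
  shows "emeasure \<mu> {x} = 0"
proof -
  have "emeasure \<mu> {x} \<le> ennreal (\<Lambda> * (1 / real (Suc n)) powr s)" for n
  proof -
    have "emeasure \<mu> {x} \<le> emeasure \<mu> (ball x (1 / real (Suc n)))"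
      by (intro emeasure_mono) (auto simp: nice_measure_sets[OF nice(1)])
    also have "\<dots> \<le> ennreal (\<Lambda> * (1 / real (Suc n)) powr s)"
      by (rule nice_measure_ball[OF nice(1)]) simp
    finally show ?thesis .
  qed
  moreover have "(\<lambda>n. ennreal (\<Lambda> * (1 / real (Suc n)) powr s)) \<longlonglongrightarrow> ennreal (\<Lambda> * 0 powr s)"
    using s by (intro tendsto_ennrealI tendsto_mult tendsto_const tendsto_powr'[OF LIMSEQ_Suc[OF lim_1_over_n]]) auto
  ultimately have "emeasure \<mu> {x} \<le> ennreal (\<Lambda> * 0 powr s)"
    by (intro LIMSEQ_le_const) auto
  then show ?thesis using s by simp
qed

text \<open>The complement is a union of null open balls; by Lindeloef countably many of them
  suffice.\<close>

lemma msupp_null_complement: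
  fixes \<mu> :: "'a::euclidean_space measure"
  assumes sb: "sets \<mu> = sets borel"
  shows "closed (msupp \<mu>)" "emeasure \<mu> (- msupp \<mu>) = 0"
proof -
  define F where "F = {ball x r | x r. r > 0 \<and> emeasure \<mu> (ball x r) = 0}"
  have eq: "- msupp \<mu> = \<Union> F"
  proof (intro equalityI subsetI)
    fix x assume "x \<in> - msupp \<mu>"
    then obtain r where "r > 0" "emeasure \<mu> (ball x r) = 0" by (auto simp: msupp_def)
    then show "x \<in> \<Union> F" unfolding F_def by (intro UnionI[of "ball x r"]) auto
  next
    fix y assume "y \<in> \<Union> F"
    then obtain x r where xr: "r > 0" "emeasure \<mu> (ball x r) = 0" "dist x y < r" by (auto simp: F_def)
    have "ball y (r - dist x y) \<subseteq> ball x r"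
    proof
      fix z assume "z \<in> ball y (r - dist x y)"
      then show "z \<in> ball x r" using dist_triangle[of x z y] by auto
    qed
    then have "emeasure \<mu> (ball y (r - dist x y)) \<le> emeasure \<mu> (ball x r)"
      by (intro emeasure_mono) (auto simp: sb)
    then show "y \<in> - msupp \<mu>" using xr by (auto simp: msupp_def intro!: exI[of _ "r - dist x y"])
  qed
  have op: "\<And>S. S \<in> F \<Longrightarrow> open S" by (auto simp: F_def)
  then have "open (\<Union> F)" by blast
  then show "closed (msupp \<mu>)" using eq by (simp add: closed_def)
  obtain F' where F': "F' \<subseteq> F" "countable F'" "\<Union> F' = \<Union> F"
    using Lindelof[of F] op by blast
  have "(\<Union>S\<in>F'. S) \<in> null_sets \<mu>"
    using F'(1) by (intro null_sets_UN' F'(2)) (auto simp: F_def null_sets_def sb)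
  then show "emeasure \<mu> (- msupp \<mu>) = 0" using eq F'(3) by (simp add: null_sets_def)
qed

text \<open>Cover the support by small sets; each one meeting E sits in a ball about a point of E of
  twice its diameter, where the density bound c applies. This gives the factor 2^s. The added 1
  leaves room to choose a cover close to the infimum.\<close>

lemma measure_le_hausdorff:
  fixes \<mu> :: "'a::euclidean_space measure"
  assumes nice: "nice_measure s \<mu> \<Lambda>" "0 \<le> \<Lambda>" and s: "s > 0" and \<delta>: "\<delta> > 0" and c: "c \<ge> 0"
    and fin: "hausdorff s (msupp \<mu>) < \<infinity>" and E: "E \<subseteq> msupp \<mu>"
    and le: "\<And>x r. x \<in> E \<Longrightarrow> 0 < r \<Longrightarrow> r \<le> 2 * \<delta> \<Longrightarrow> emeasure \<mu> (ball x r) \<le> ennreal (c * r powr s)"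
  shows "emeasure \<mu> E \<le> ennreal (c * 2 powr s) * (hausdorff s (msupp \<mu>) + 1)"
proof -
  note sb = nice_measure_sets[OF nice(1)]
  let ?H = "hausdorff s (msupp \<mu>)"
  have "hausdorff_pre s \<delta> (msupp \<mu>) \<le> ?H" unfolding hausdorff_def using \<delta> by (intro SUP_upper) auto
  also have "?H < ?H + 1" using fin by (cases ?H) (auto simp flip: ennreal_1 ennreal_plus simp: ennreal_less_iff)
  finally have "hausdorff_pre s \<delta> (msupp \<mu>) < ?H + 1" .
  then obtain U :: "nat \<Rightarrow> 'a set" where U: "msupp \<mu> \<subseteq> (\<Union>i. U i)" "\<And>i. bounded (U i)" "\<And>i. diameter (U i) \<le> \<delta>"
    and sum: "(\<Sum>i. ennreal (diameter (U i) powr s)) < ?H + 1"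
    unfolding hausdorff_pre_def INF_less_iff by auto
  define x where "x i = (SOME y. y \<in> U i \<inter> E)" for i
  have x: "x i \<in> U i \<inter> E" if "U i \<inter> E \<noteq> {}" for i
    unfolding x_def using that by (meson ex_in_conv someI_ex)
  \<comment> \<open>Doubling the radius lets an open ball contain all of \<open>U i\<close>.
    Diameter 0 is separated because a ball of radius 0 is empty; there the set is a single point,
    which is null.\<close>
  define V where "V i = (if U i \<inter> E = {} then {} else if diameter (U i) = 0 then {x i} else ball (x i) (2 * diameter (U i)))" for i
  have d0: "diameter (U i) \<ge> 0" for i by (rule diameter_ge_0[OF U(2)])
  have "E \<subseteq> (\<Union>i. V i)"
  proof
    fix y assume y: "y \<in> E"
    then obtain i where i: "y \<in> U i" using E U(1) by blast
    then have ne: "U i \<inter> E \<noteq> {}" using y by blast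
    have d: "dist (x i) y \<le> diameter (U i)" using diameter_bounded_bound[OF U(2)] x[OF ne] i by blast
    then have "y \<in> V i" using ne d0[of i] by (auto simp: V_def)
    then show "y \<in> (\<Union>i. V i)" by blast
  qed
  moreover have Vs: "V i \<in> sets \<mu>" for i by (auto simp: V_def sb)
  ultimately have "emeasure \<mu> E \<le> emeasure \<mu> (\<Union>i. V i)" by (intro emeasure_mono) auto
  also have "\<dots> \<le> (\<Sum>i. emeasure \<mu> (V i))"
    using Vs by (intro emeasure_subadditive_countably) auto
  also have "\<dots> \<le> (\<Sum>i. ennreal (c * 2 powr s) * ennreal (diameter (U i) powr s))"
  proof (intro suminf_le summableI)
    fix i
    show "emeasure \<mu> (V i) \<le> ennreal (c * 2 powr s) * ennreal (diameter (U i) powr s)"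
    proof (cases "U i \<inter> E = {} \<or> diameter (U i) = 0")
      case True
      then show ?thesis using nice_measure_null_singleton[OF nice s] by (auto simp: V_def)
    next
      case False
      then have "emeasure \<mu> (V i) \<le> ennreal (c * (2 * diameter (U i)) powr s)"
        using d0[of i] U(3)[of i] x[of i] by (auto simp: V_def intro!: le)
      also have "c * (2 * diameter (U i)) powr s = c * 2 powr s * diameter (U i) powr s"
        using d0 by (simp add: powr_mult)
      finally show ?thesis using c by (simp add: ennreal_mult)
    qed
  qed
  also have "\<dots> = ennreal (c * 2 powr s) * (\<Sum>i. ennreal (diameter (U i) powr s))"
    by (rule ennreal_suminf_cmult)
  also have "\<dots> \<le> ennreal (c * 2 powr s) * (?H + 1)"
    using sum by (intro mult_left_mono) auto
  finally show ?thesis .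
qed

text \<open>The covering bound with E the whole support and c = \<Lambda>: the growth condition
  itself serves as the density bound.\<close>

lemma finite_of_hausdorff:
  fixes \<mu> :: "'a::euclidean_space measure"
  assumes nice: "nice_measure s \<mu> \<Lambda>" "0 \<le> \<Lambda>" and s: "s > 0" and fin: "hausdorff s (msupp \<mu>) < \<infinity>"
  shows "emeasure \<mu> UNIV < \<infinity>"
proof -
  note sb = nice_measure_sets[OF nice(1)]
  note ms = msupp_null_complement[OF sb]
  have "emeasure \<mu> (msupp \<mu>) \<le> ennreal (\<Lambda> * 2 powr s) * (hausdorff s (msupp \<mu>) + 1)"
    by (rule measure_le_hausdorff[OF nice s zero_less_one nice(2) fin order_refl nice_measure_ball[OF nice(1)]])
  also have "\<dots> < \<infinity>" using fin by (simp add: ennreal_mult_less_top)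
  finally have "emeasure \<mu> (msupp \<mu>) < \<infinity>" .
  moreover have "emeasure \<mu> (msupp \<mu> \<union> - msupp \<mu>) \<le> emeasure \<mu> (msupp \<mu>) + emeasure \<mu> (- msupp \<mu>)"
    using ms(1) by (intro emeasure_subadditive) (auto simp: sb)
  ultimately show ?thesis using ms(2) by (simp add: le_less_trans)
qed

text \<open>Lower semicontinuity of the mass of a ball in its centre, by continuity from below: a
  slightly smaller ball already has mass above t and is contained in the balls about nearby centres.
  It yields measurability of sets defined by densities.\<close>

lemma open_emeasure_ball_greater:
  fixes \<mu> :: "'a::euclidean_space measure"
  assumes sb: "sets \<mu> = sets borel"
  shows "open {x. t < emeasure \<mu> (ball x r)}"
  unfolding open_contains_ball
proof
  fix x assume x: "x \<in> {x. t < emeasure \<mu> (ball x r)}"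
  define B where "B n = ball x (r - 1 / real (Suc n))" for n
  have "incseq B" unfolding B_def incseq_def by (auto simp: subset_ball frac_le intro: less_le_trans)
  moreover have "range B \<subseteq> sets \<mu>" by (auto simp: B_def sb)
  moreover have "(\<Union>n. B n) = ball x r"
  proof (intro equalityI subsetI)
    fix y assume "y \<in> ball x r"
    then have "0 < r - dist x y" by simp
    then obtain n where "1 / real (Suc n) < r - dist x y" using nat_approx_posE by blast
    then show "y \<in> (\<Union>n. B n)" by (auto simp: B_def intro!: exI[of _ n])
  next
    fix y assume "y \<in> (\<Union>n. B n)"
    then obtain n where "dist x y < r - 1 / real (Suc n)" by (auto simp: B_def)
    moreover have "1 / real (Suc n) > 0" by simp
    ultimately have "dist x y < r" by linarith
    then show "y \<in> ball x r" by simp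
  qed
  ultimately have "(SUP n. emeasure \<mu> (B n)) = emeasure \<mu> (ball x r)"
    using SUP_emeasure_incseq[of B \<mu>] by simp
  then have "t < (SUP n. emeasure \<mu> (B n))" using x by simp
  then obtain n where n: "t < emeasure \<mu> (B n)" unfolding less_SUP_iff by blast
  have "ball x (1 / real (Suc n)) \<subseteq> {x. t < emeasure \<mu> (ball x r)}"
  proof
    fix y assume y: "y \<in> ball x (1 / real (Suc n))"
    have "B n \<subseteq> ball y r"
    proof
      fix z assume "z \<in> B n"
      then show "z \<in> ball y r" using y dist_triangle[of y z x] by (auto simp: B_def dist_commute)
    qed
    then have "emeasure \<mu> (B n) \<le> emeasure \<mu> (ball y r)" by (intro emeasure_mono) (auto simp: sb)
    then show "y \<in> {x. t < emeasure \<mu> (ball x r)}" using n by simp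
  qed
  then show "\<exists>e>0. ball x e \<subseteq> {x. t < emeasure \<mu> (ball x r)}" by (intro exI[of _ "1 / real (Suc n)"]) auto
qed

text \<open>Points of the support with density at most \<epsilon> at all small scales form a set of
  measure at most \<epsilon> times a fixed finite constant, by the covering bound. Letting
  \<epsilon> tend to 0 leaves a null set.\<close>

lemma AE_positive_upper_density:
  fixes \<mu> :: "'a::euclidean_space measure"
  assumes nice: "nice_measure s \<mu> \<Lambda>" "0 \<le> \<Lambda>" and s: "s > 0" and fin: "hausdorff s (msupp \<mu>) < \<infinity>"
  shows "AE x in \<mu>. \<exists>\<epsilon>>0. \<forall>\<rho>>0. \<exists>r. 0 < r \<and> r < \<rho> \<and> ennreal (\<epsilon> * r powr s) < emeasure \<mu> (ball x r)"
proof -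
  note sb = nice_measure_sets[OF nice(1)]
  note ms = msupp_null_complement[OF sb]
  define \<epsilon> where "\<epsilon> n = 1 / real (Suc n)" for n
  have \<epsilon>: "\<epsilon> n > 0" for n by (simp add: \<epsilon>_def)
  \<comment> \<open>The sequence \<epsilon> serves two purposes: \<open>\<epsilon> n\<close> is the
    density threshold and \<open>2 * \<epsilon> k\<close> the scale below which it is respected. As
    an intersection with complements of open sets, \<open>E n k\<close> is closed.\<close>
  define E where "E n k = msupp \<mu> \<inter> (\<Inter>r\<in>{0<..2 * \<epsilon> k}. - {x. ennreal (\<epsilon> n * r powr s) < emeasure \<mu> (ball x r)})" for n k
  have "closed (E n k)" for n k
    unfolding E_def by (intro closed_Int ms closed_INT ballI closed_Compl open_emeasure_ball_greater[OF sb])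
  then have Es: "E n k \<in> sets \<mu>" for n k by (simp add: sb)
  let ?H = "hausdorff s (msupp \<mu>) + 1"
  have Eb: "emeasure \<mu> (E n k) \<le> ennreal (\<epsilon> n * 2 powr s) * ?H" for n k
    by (rule measure_le_hausdorff[OF nice s \<epsilon>[of k] less_imp_le[OF \<epsilon>] fin]) (auto simp: E_def not_less)
  have inc: "incseq (E n)" for n
  proof (rule incseq_SucI)
    fix k
    have "\<epsilon> (Suc k) \<le> \<epsilon> k" by (simp add: \<epsilon>_def frac_le)
    then show "E n k \<subseteq> E n (Suc k)" by (force simp: E_def)
  qed
  have Un: "emeasure \<mu> (\<Union>k. E n k) \<le> ennreal (\<epsilon> n * 2 powr s) * ?H" for n
    using SUP_emeasure_incseq[OF _ inc[of n], of \<mu>] Es Eb by (metis (no_types, lifting) SUP_least image_subsetI)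
  define Z where "Z = (\<Inter>n. \<Union>k. E n k)"
  have Zs: "Z \<in> sets \<mu>" unfolding Z_def using Es by auto
  have "emeasure \<mu> Z \<le> ennreal (\<epsilon> n * 2 powr s) * ?H" for n
    by (rule order_trans[OF emeasure_mono Un[of n]]) (use Es in \<open>auto simp: Z_def\<close>)
  moreover have "(\<lambda>n. ennreal (\<epsilon> n * 2 powr s) * ?H) \<longlonglongrightarrow> ennreal (0 * 2 powr s) * ?H"
    unfolding \<epsilon>_def using fin
    by (intro tendsto_mult_ennreal tendsto_ennrealI tendsto_mult tendsto_const LIMSEQ_Suc[OF lim_1_over_n]) (auto simp: less_top)
  ultimately have "emeasure \<mu> Z \<le> ennreal (0 * 2 powr s) * ?H" by (intro LIMSEQ_le_const) auto
  then have Z0: "emeasure \<mu> Z = 0" by simp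
  show ?thesis
  proof (rule AE_I)
    show "emeasure \<mu> (Z \<union> - msupp \<mu>) = 0"
      using Z0 ms Zs by (intro emeasure_Un_null_set[THEN trans]) (auto simp: null_sets_def sb)
    show "Z \<union> - msupp \<mu> \<in> sets \<mu>" using Zs ms by (auto simp: sb)
    show "{x \<in> space \<mu>. \<not> (\<exists>\<epsilon>>0. \<forall>\<rho>>0. \<exists>r. 0 < r \<and> r < \<rho> \<and> ennreal (\<epsilon> * r powr s) < emeasure \<mu> (ball x r))} \<subseteq> Z \<union> - msupp \<mu>"
    proof (rule subsetI, rule ccontr)
      fix x assume bad: "x \<in> {x \<in> space \<mu>. \<not> (\<exists>\<epsilon>>0. \<forall>\<rho>>0. \<exists>r. 0 < r \<and> r < \<rho> \<and> ennreal (\<epsilon> * r powr s) < emeasure \<mu> (ball x r))}"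
        and "x \<notin> Z \<union> - msupp \<mu>"
      then obtain n where n: "x \<in> msupp \<mu>" "\<And>k. x \<notin> E n k" by (auto simp: Z_def)
      have "\<exists>r. 0 < r \<and> r < \<rho> \<and> ennreal (\<epsilon> n * r powr s) < emeasure \<mu> (ball x r)" if "\<rho> > 0" for \<rho>
      proof -
        have "\<rho> / 2 > 0" using that by simp
        then obtain k where k: "1 / real (Suc k) < \<rho> / 2" by (rule nat_approx_posE)
        obtain r where "0 < r" "r \<le> 2 * \<epsilon> k" "ennreal (\<epsilon> n * r powr s) < emeasure \<mu> (ball x r)"
          using n(1) n(2)[of k] by (auto simp: E_def)
        then show ?thesis using k by (intro exI[of _ r]) (auto simp: \<epsilon>_def)
      qed
      then show False using bad \<epsilon>[of n] by blast
    qed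
  qed
qed

section \<open>Almost orthogonality of bumps at different scales\<close>

definition bump_function :: "('a::euclidean_space \<Rightarrow> real) \<Rightarrow> bool" where
  "bump_function \<psi> \<longleftrightarrow> (\<exists>L R. R > 0 \<and> lipschitz_bump L 0 R \<psi>)"

lemma lipschitz_bump_mono:
  assumes "lipschitz_bump L c r \<psi>" "ball c r \<subseteq> ball c' r'" "L \<le> L'"
  shows "lipschitz_bump L' c' r' \<psi>"
  using assms lipschitz_on_mono[of L UNIV \<psi> UNIV L'] unfolding lipschitz_bump_def by blast

lemma lipschitz_bump_bump_function:
  assumes "lipschitz_bump L c r \<psi>" "r > 0"
  shows "bump_function \<psi>"
proof -
  have "ball c r \<subseteq> ball 0 (norm c + r)"
  proof
    fix x assume "x \<in> ball c r"
    then show "x \<in> ball 0 (norm c + r)" using norm_triangle_ineq2[of x c] by (auto simp: dist_norm norm_minus_commute)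
  qed
  then show ?thesis unfolding bump_function_def
    using assms lipschitz_bump_mono[OF assms(1) _ order_refl] by (intro exI[of _ L] exI[of _ "norm c + r"]) (auto simp: add_nonneg_pos)
qed

lemma lipschitz_bump_add:
  assumes "lipschitz_bump L c r \<psi>" "lipschitz_bump L' c r \<phi>"
  shows "lipschitz_bump (L + L') c r (\<lambda>x. \<psi> x + \<phi> x)"
  using assms unfolding lipschitz_bump_def by (auto intro: lipschitz_on_add)

lemma lipschitz_bump_cmult:
  assumes "lipschitz_bump L c r \<psi>"
  shows "lipschitz_bump (\<bar>a\<bar> * L) c r (\<lambda>x. a * \<psi> x)"
  using assms unfolding lipschitz_bump_def by (auto intro: lipschitz_on_cmult_real)

lemma bump_function_add:
  assumes "bump_function \<psi>" "bump_function \<phi>"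
  shows "bump_function (\<lambda>x. \<psi> x + \<phi> x)"
proof -
  obtain L R L' R' where 1: "R > 0" "lipschitz_bump L 0 R \<psi>" "R' > 0" "lipschitz_bump L' 0 R' \<phi>"
    using assms by (auto simp: bump_function_def)
  have "lipschitz_bump L 0 (max R R') \<psi>" "lipschitz_bump L' 0 (max R R') \<phi>"
    by (rule lipschitz_bump_mono[OF 1(2)], auto intro: subset_ball,
        rule lipschitz_bump_mono[OF 1(4)], auto intro: subset_ball)
  from lipschitz_bump_add[OF this] show ?thesis using 1 unfolding bump_function_def by (meson less_max_iff_disj)
qed

lemma bump_function_0: "bump_function (\<lambda>_. 0)"
  unfolding bump_function_def lipschitz_bump_def by (intro exI[of _ 0] exI[of _ 1]) (auto intro: lipschitz_intros)

lemma bump_function_sum: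
  "finite D \<Longrightarrow> (\<And>i. i \<in> D \<Longrightarrow> bump_function (\<psi> i)) \<Longrightarrow> bump_function (\<lambda>x. \<Sum>i\<in>D. \<psi> i x)"
  by (induction D rule: finite_induct) (auto intro: bump_function_0 bump_function_add)

lemma bump_functionD:
  assumes "bump_function \<psi>"
  shows "\<psi> \<in> borel_measurable borel" "\<exists>B\<ge>0. \<forall>x. \<bar>\<psi> x\<bar> \<le> B" "\<exists>L\<ge>0. \<forall>x y. \<bar>\<psi> x - \<psi> y\<bar> \<le> L * dist x y"
proof -
  obtain L R where 1: "R > 0" "lipschitz_bump L 0 R \<psi>" using assms by (auto simp: bump_function_def)
  show "\<psi> \<in> borel_measurable borel" by (rule lipschitz_bump_measurable[OF 1(2)])
  show "\<exists>B\<ge>0. \<forall>x. \<bar>\<psi> x\<bar> \<le> B" using lipschitz_bump_bound[OF 1(2,1)] lipschitz_bumpD(3)[OF 1(2)] 1(1)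
    by (intro exI[of _ "2 * L * R"]) auto
  show "\<exists>L\<ge>0. \<forall>x y. \<bar>\<psi> x - \<psi> y\<bar> \<le> L * dist x y" using lipschitz_bumpD[OF 1(2)] by blast
qed

text \<open>Isolates what the orthogonality argument uses of T(1): additivity on bumps and an L^2
  bound. F is real-valued so that large values on many bumps add up without cancellation; it will be
  a component of T(1), with either sign.\<close>

locale bounded_bump_functional =
  fixes \<mu> :: "'a::euclidean_space measure" and F :: "('a \<Rightarrow> real) \<Rightarrow> real" and s \<Lambda> C :: real
  assumes nice: "nice_measure s \<mu> \<Lambda>" and \<Lambda>: "\<Lambda> \<ge> 0" and s_pos: "s > 0" and fin: "emeasure \<mu> UNIV < \<infinity>"
    and F_add: "\<And>\<psi> \<phi>. bump_function \<psi> \<Longrightarrow> bump_function \<phi> \<Longrightarrow> F (\<lambda>x. \<psi> x + \<phi> x) = F \<psi> + F \<phi>"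
    and F_bound: "\<And>\<psi>. bump_function \<psi> \<Longrightarrow> (F \<psi>)\<^sup>2 \<le> C * (\<integral>x. (\<psi> x)\<^sup>2 \<partial>\<mu>)" and C: "C \<ge> 0"
begin

lemma sets_\<mu>: "sets \<mu> = sets borel" by (rule nice_measure_sets[OF nice])

lemma space_\<mu>: "space \<mu> = UNIV" by (rule nice_measure_space[OF nice])

sublocale finite_measure \<mu>
  by (rule finite_measureI) (use fin in \<open>auto simp: space_\<mu>\<close>)

abbreviation mass where "mass \<equiv> measure \<mu> UNIV"

lemma integrable_bounded:
  assumes "g \<in> borel_measurable borel" "\<And>x. \<bar>g x :: real\<bar> \<le> B"
  shows "integrable \<mu> g"
  by (rule integrable_const_bound[where B=B]) (use assms in \<open>auto simp: measurable_cong_sets[OF sets_\<mu> refl]\<close>)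

lemma F_0: "F (\<lambda>_. 0) = 0"
  using F_add[OF bump_function_0 bump_function_0] by simp

lemma F_sum:
  "finite D \<Longrightarrow> (\<And>i. i \<in> D \<Longrightarrow> bump_function (\<psi> i)) \<Longrightarrow> F (\<lambda>x. \<Sum>i\<in>D. \<psi> i x) = (\<Sum>i\<in>D. F (\<psi> i))"
  by (induction D rule: finite_induct) (auto simp: F_0 F_add bump_function_sum)

text \<open>Oscillation at scale \<rho> is encoded by its effect, a small pairing with slowly
  varying functions, rather than by a geometric description. Sums of disjoint mean-zero bumps of
  radius at most \<rho> have this property.\<close>

definition fine_bump :: "real \<Rightarrow> ('a \<Rightarrow> real) \<Rightarrow> bool" where
  "fine_bump \<rho> \<Psi> \<longleftrightarrow> bump_function \<Psi> \<and> (\<forall>x. \<bar>\<Psi> x\<bar> \<le> 1) \<and>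
     (\<forall>L g. L \<ge> 0 \<and> bump_function g \<and> (\<forall>x y. \<bar>g x - g y\<bar> \<le> L * dist x y) \<longrightarrow> (\<integral>x. \<Psi> x * g x \<partial>\<mu>) \<le> L * \<rho> * mass)"

text \<open>Functions oscillating at very different scales are almost orthogonal, so a functional that is
  bounded in \<open>L\<^sup>2\<close> cannot be large at infinitely many scales.\<close>

lemma F_small_at_fine_scale:
  assumes \<kappa>: "\<kappa> > 0"
  shows "\<exists>\<rho>>0. \<forall>\<Psi>. fine_bump \<rho> \<Psi> \<longrightarrow> F \<Psi> < \<kappa>"
proof (rule ccontr)
  assume "\<not> ?thesis"
  then have bad: "\<And>\<rho>. \<rho> > 0 \<Longrightarrow> \<exists>\<Psi>. fine_bump \<rho> \<Psi> \<and> F \<Psi> \<ge> \<kappa>" by (meson not_le)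
  \<comment> \<open>G is a sum of n bumps, each at a scale chosen after its predecessors. F grows
    like n \<kappa> while the squared norm grows only like n: \<open>mass\<close> for each new bump
    and 2 for twice a cross term of at most 1. For large n this contradicts the L^2 bound.\<close>
  have "\<exists>G. bump_function G \<and> F G \<ge> real n * \<kappa> \<and> (\<integral>x. (G x)\<^sup>2 \<partial>\<mu>) \<le> real n * (mass + 2)" for n
  proof (induction n)
    case 0
    show ?case by (intro exI[of _ "\<lambda>_. 0"]) (simp add: bump_function_0 F_0)
  next
    case (Suc n)
    then obtain G where G: "bump_function G" "F G \<ge> real n * \<kappa>" "(\<integral>x. (G x)\<^sup>2 \<partial>\<mu>) \<le> real n * (mass + 2)" by blast
    obtain L B where L: "L \<ge> 0" "\<And>x y. \<bar>G x - G y\<bar> \<le> L * dist x y" and B: "B \<ge> 0" "\<And>x. \<bar>G x\<bar> \<le> B"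
      using bump_functionD(2,3)[OF G(1)] by blast
    \<comment> \<open>The new scale is fine compared with the Lipschitz constant of the sum built so
      far, which makes the cross term at most 1.\<close>
    define \<rho> where "\<rho> = 1 / (L * mass + 1)"
    have p: "L * mass + 1 > 0" using L by (simp add: add_nonneg_pos)
    then have "\<rho> > 0" by (simp add: \<rho>_def)
    then obtain \<Psi> where \<Psi>: "fine_bump \<rho> \<Psi>" "F \<Psi> \<ge> \<kappa>" using bad by blast
    have b\<Psi>: "bump_function \<Psi>" and \<Psi>1: "\<And>x. \<bar>\<Psi> x\<bar> \<le> 1" using \<Psi> by (auto simp: fine_bump_def)
    have "(\<integral>x. \<Psi> x * G x \<partial>\<mu>) \<le> L * \<rho> * mass" using \<Psi>(1) G(1) L unfolding fine_bump_def by blast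
    also have "\<dots> = L * mass / (L * mass + 1)" by (simp add: \<rho>_def)
    also have "\<dots> \<le> 1" using p by (simp add: divide_le_eq)
    finally have cross: "(\<integral>x. \<Psi> x * G x \<partial>\<mu>) \<le> 1" .
    note [measurable] = bump_functionD(1)[OF G(1)] bump_functionD(1)[OF b\<Psi>]
    have G2: "(G x)\<^sup>2 \<le> B\<^sup>2" for x using B(2)[of x] by (metis abs_ge_zero power2_abs power_mono)
    have \<Psi>2: "(\<Psi> x)\<^sup>2 \<le> 1" for x using \<Psi>1[of x] by (simp add: abs_square_le_1)
    have "\<bar>\<Psi> x * G x\<bar> \<le> 1 * B" for x unfolding abs_mult using \<Psi>1 B by (intro mult_mono) auto
    then have i3: "integrable \<mu> (\<lambda>x. \<Psi> x * G x)" by (intro integrable_bounded[where B=B]) auto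
    have i1: "integrable \<mu> (\<lambda>x. (G x)\<^sup>2)" by (rule integrable_bounded[where B="B\<^sup>2"]) (use G2 in auto)
    have i2: "integrable \<mu> (\<lambda>x. (\<Psi> x)\<^sup>2)" by (rule integrable_bounded[where B=1]) (use \<Psi>2 in auto)
    note ints = i1 i2 i3
    have "(\<integral>x. (\<Psi> x)\<^sup>2 \<partial>\<mu>) \<le> (\<integral>x. 1 \<partial>\<mu>)" using ints(2) \<Psi>2 by (intro integral_mono) auto
    then have \<Psi>m: "(\<integral>x. (\<Psi> x)\<^sup>2 \<partial>\<mu>) \<le> mass" by (simp add: space_\<mu>)
    have "(\<integral>x. (G x + \<Psi> x)\<^sup>2 \<partial>\<mu>) = (\<integral>x. (G x)\<^sup>2 + 2 * (\<Psi> x * G x) + (\<Psi> x)\<^sup>2 \<partial>\<mu>)"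
      by (intro Bochner_Integration.integral_cong) (auto simp: power2_sum)
    also have "\<dots> = (\<integral>x. (G x)\<^sup>2 \<partial>\<mu>) + 2 * (\<integral>x. \<Psi> x * G x \<partial>\<mu>) + (\<integral>x. (\<Psi> x)\<^sup>2 \<partial>\<mu>)"
      using ints by simp
    also have "\<dots> \<le> real (Suc n) * (mass + 2)" using G(3) cross \<Psi>m by (simp add: algebra_simps)
    finally show ?case using F_add[OF G(1) b\<Psi>] G(2) \<Psi>(2) bump_function_add[OF G(1) b\<Psi>]
      by (intro exI[of _ "\<lambda>x. G x + \<Psi> x"]) (auto simp: algebra_simps)
  qed
  note G = this
  obtain n where n: "C * (mass + 2) / \<kappa>\<^sup>2 < real n" using reals_Archimedean2 by blast
  obtain g where g: "bump_function g" "F g \<ge> real n * \<kappa>" "(\<integral>x. (g x)\<^sup>2 \<partial>\<mu>) \<le> real n * (mass + 2)" using G by blast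
  have n0: "real n > 0" using n C by (smt (verit, best) divide_nonneg_nonneg measure_nonneg mult_nonneg_nonneg zero_le_power2)
  have "(real n * \<kappa>)\<^sup>2 \<le> (F g)\<^sup>2" using g(2) \<kappa> by (intro power_mono) auto
  also have "\<dots> \<le> C * (real n * (mass + 2))"
    using F_bound[OF g(1)] mult_left_mono[OF g(3) C] by linarith
  finally have "real n * (real n * \<kappa>\<^sup>2) \<le> real n * (C * (mass + 2))" by (simp add: power2_eq_square algebra_simps)
  then have "real n * \<kappa>\<^sup>2 \<le> C * (mass + 2)" using n0 by simp
  then show False using n \<kappa> by (simp add: divide_less_eq)
qed

text \<open>Mean zero lets g be replaced on each ball by its deviation from the value at the centre,
  at most l \<rho>. Disjointness keeps the sum bounded by 1 and lets the masses of the balls add up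
  to at most the total mass.\<close>

lemma fine_bump_sum:
  assumes \<rho>: "\<rho> \<ge> 0" and D: "finite D" and \<psi>: "\<And>x. x \<in> D \<Longrightarrow> lipschitz_bump (L x) x (r x) (\<psi> x)"
    "\<And>x y. x \<in> D \<Longrightarrow> \<bar>\<psi> x y\<bar> \<le> 1" "\<And>x. x \<in> D \<Longrightarrow> (\<integral>y. \<psi> x y \<partial>\<mu>) = 0"
    and r: "\<And>x. x \<in> D \<Longrightarrow> 0 < r x \<and> r x \<le> \<rho>"
    and dj: "pairwise (\<lambda>x y. disjnt (ball x (r x)) (ball y (r y))) D"
  shows "fine_bump \<rho> (\<lambda>y. \<Sum>x\<in>D. \<psi> x y)"
  unfolding fine_bump_def
proof (intro conjI allI impI)
  have bf: "bump_function (\<psi> x)" if "x \<in> D" for x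
    using lipschitz_bump_bump_function[OF \<psi>(1)[OF that]] r[OF that] by blast
  then show "bump_function (\<lambda>y. \<Sum>x\<in>D. \<psi> x y)" by (intro bump_function_sum D)
  show "\<bar>\<Sum>x\<in>D. \<psi> x y\<bar> \<le> 1" for y
  proof (cases "\<exists>x\<in>D. y \<in> ball x (r x)")
    case True
    then obtain x where x: "x \<in> D" "y \<in> ball x (r x)" by blast
    have "\<psi> z y = 0" if "z \<in> D - {x}" for z
    proof -
      have "disjnt (ball z (r z)) (ball x (r x))" using that x dj by (auto simp: pairwise_def)
      then have "y \<notin> ball z (r z)" using x by (auto simp: disjnt_def)
      then show ?thesis using lipschitz_bumpD(2)[OF \<psi>(1)] that by auto
    qed
    then have "(\<Sum>x\<in>D. \<psi> x y) = \<psi> x y" using x(1) D by (simp add: sum.remove)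
    then show ?thesis using \<psi>(2)[OF x(1)] by simp
  next
    case False
    then have "(\<Sum>x\<in>D. \<psi> x y) = 0" using lipschitz_bumpD(2)[OF \<psi>(1)] by (intro sum.neutral) blast
    then show ?thesis by simp
  qed
  fix l and g :: "'a \<Rightarrow> real" assume lg: "l \<ge> 0 \<and> bump_function g \<and> (\<forall>x y. \<bar>g x - g y\<bar> \<le> l * dist x y)"
  have gm [measurable]: "g \<in> borel_measurable borel" using lg bump_functionD(1) by blast
  obtain B where B: "B \<ge> 0" "\<And>x. \<bar>g x\<bar> \<le> B" using bump_functionD(2)[of g] lg by blast
  have pm [measurable]: "\<psi> x \<in> borel_measurable borel" if "x \<in> D" for x using bump_functionD(1)[OF bf[OF that]] .
  have ig: "integrable \<mu> (\<lambda>y. \<psi> x y * g y)" if "x \<in> D" for x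
  proof (rule integrable_bounded[where B="1 * B"])
    show "\<bar>\<psi> x y * g y\<bar> \<le> 1 * B" for y unfolding abs_mult using \<psi>(2)[OF that] B by (intro mult_mono) auto
  qed (use pm[OF that] in measurable)
  have i\<psi>: "integrable \<mu> (\<psi> x)" if "x \<in> D" for x
    by (rule integrable_bounded[OF pm[OF that] \<psi>(2)[OF that]])
  have one: "(\<integral>y. \<psi> x y * g y \<partial>\<mu>) \<le> l * \<rho> * measure \<mu> (ball x (r x))" if x: "x \<in> D" for x
  proof -
    have "(\<integral>y. \<psi> x y * g y \<partial>\<mu>) = (\<integral>y. \<psi> x y * g y - \<psi> x y * g x \<partial>\<mu>)"
      using ig[OF x] i\<psi>[OF x] \<psi>(3)[OF x] by simp
    also have "\<dots> \<le> (\<integral>y. l * \<rho> * indicator (ball x (r x)) y \<partial>\<mu>)"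
    proof (rule integral_mono)
      show "integrable \<mu> (\<lambda>y. \<psi> x y * g y - \<psi> x y * g x)" using ig[OF x] i\<psi>[OF x] by simp
      show "integrable \<mu> (\<lambda>y. l * \<rho> * indicator (ball x (r x)) y)"
        by (intro integrable_mult_right integrable_real_indicator) (auto simp: sets_\<mu> less_top[symmetric])
      fix y
      show "\<psi> x y * g y - \<psi> x y * g x \<le> l * \<rho> * indicator (ball x (r x)) y"
      proof (cases "y \<in> ball x (r x)")
        case True
        have "\<psi> x y * g y - \<psi> x y * g x \<le> \<bar>\<psi> x y\<bar> * \<bar>g y - g x\<bar>"
          by (metis abs_ge_self abs_mult right_diff_distrib)
        also have "\<dots> \<le> 1 * (l * dist y x)" using \<psi>(2)[OF x] lg by (intro mult_mono) auto
        also have "\<dots> \<le> l * \<rho>" using True r[OF x] lg by (auto simp: dist_commute intro!: mult_left_mono)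
        finally show ?thesis using True by simp
      qed (use lipschitz_bumpD(2)[OF \<psi>(1)[OF x]] in auto)
    qed
    also have "\<dots> = l * \<rho> * measure \<mu> (ball x (r x))" by (simp add: space_\<mu>)
    finally show ?thesis .
  qed
  have "(\<integral>y. (\<Sum>x\<in>D. \<psi> x y) * g y \<partial>\<mu>) = (\<Sum>x\<in>D. \<integral>y. \<psi> x y * g y \<partial>\<mu>)"
    unfolding sum_distrib_right by (rule Bochner_Integration.integral_sum[OF ig])
  also have "\<dots> \<le> (\<Sum>x\<in>D. l * \<rho> * measure \<mu> (ball x (r x)))" by (rule sum_mono[OF one])
  also have "\<dots> = l * \<rho> * (\<Sum>x\<in>D. measure \<mu> (ball x (r x)))" by (simp add: sum_distrib_left)
  also have "(\<Sum>x\<in>D. measure \<mu> (ball x (r x))) = measure \<mu> (\<Union>x\<in>D. ball x (r x))"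
    using dj by (intro finite_measure_finite_Union[symmetric] D)
       (auto simp: sets_\<mu> disjoint_family_on_def pairwise_def disjnt_def)
  also have "l * \<rho> * measure \<mu> (\<Union>x\<in>D. ball x (r x)) \<le> l * \<rho> * mass"
    using lg \<rho> finite_measure_mono[of "\<Union>x\<in>D. ball x (r x)" UNIV] by (intro mult_left_mono) (auto simp: sets_\<mu>)
  finally show "(\<integral>y. (\<Sum>x\<in>D. \<psi> x y) * g y \<partial>\<mu>) \<le> l * \<rho> * mass" .
qed

text \<open>From balls carrying a bump with F > t r^s, Vitali selects disjoint ones whose fivefold
  dilates cover the bad set. The bumps on finitely many of them add up to a fine bump, so t times
  the sum of r^s is at most \<kappa>, and niceness bounds the measure of the dilates by \<Lambda>
  5^s \<kappa>/t. Finally \<kappa> tends to 0.\<close>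

lemma AE_F_small_on_balls:
  assumes t: "t > 0"
  shows "AE x in \<mu>. \<exists>\<rho>>0. \<forall>r L \<psi>. 0 < r \<and> r < \<rho> \<and> lipschitz_bump L x r \<psi> \<and> (\<forall>y. \<bar>\<psi> y\<bar> \<le> 1) \<and> (\<integral>y. \<psi> y \<partial>\<mu>) = 0
           \<longrightarrow> F \<psi> \<le> t * r powr s"
proof -
  define P where "P x r L \<psi> \<longleftrightarrow> 0 < r \<and> lipschitz_bump L x r \<psi> \<and> (\<forall>y. \<bar>\<psi> y\<bar> \<le> 1) \<and> (\<integral>y. \<psi> y \<partial>\<mu>) = 0 \<and> t * r powr s < F \<psi>" for x r L \<psi>
  define Bad where "Bad = {x. \<forall>\<rho>>0. \<exists>r L \<psi>. r < \<rho> \<and> P x r L \<psi>}"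
  have cover: "\<exists>O'. O' \<in> sets \<mu> \<and> Bad \<subseteq> O' \<and> emeasure \<mu> O' \<le> ennreal (\<Lambda> * 5 powr s * (\<kappa> / t))" if \<kappa>: "\<kappa> > 0" for \<kappa>
  proof -
    obtain \<rho> where \<rho>: "\<rho> > 0" "\<And>\<Psi>. fine_bump \<rho> \<Psi> \<Longrightarrow> F \<Psi> < \<kappa>" using F_small_at_fine_scale[OF \<kappa>] by blast
    have "\<forall>x\<in>Bad. \<exists>r L \<psi>. r < \<rho> \<and> P x r L \<psi>" using \<rho>(1) by (auto simp: Bad_def)
    then obtain r L \<psi> where rP: "\<And>x. x \<in> Bad \<Longrightarrow> r x < \<rho> \<and> P x (r x) (L x) (\<psi> x)" by metis
    have rpos: "0 < r x \<and> r x \<le> \<rho>" if "x \<in> Bad" for x using rP[OF that] by (auto simp: P_def)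
    have cov: "Bad \<subseteq> (\<Union>x\<in>Bad. ball x (r x))" using rpos by force
    obtain C' where C': "countable C'" "C' \<subseteq> Bad"
      "pairwise (\<lambda>i j. disjnt (ball i (r i)) (ball j (r j))) C'" "Bad \<subseteq> (\<Union>i\<in>C'. ball i (5 * r i))"
      by (rule Vitali_covering_lemma_balls[where S=Bad and K=Bad and a="\<lambda>x. x" and r=r and B=\<rho>, OF cov rpos]) (assumption, rule that)
    have fin_sum: "(\<Sum>x\<in>D. r x powr s) \<le> \<kappa> / t" if D: "finite D" "D \<subseteq> C'" for D
    proof -
      have DB: "x \<in> Bad" if "x \<in> D" for x using that D C' by blast
      have "fine_bump \<rho> (\<lambda>y. \<Sum>x\<in>D. \<psi> x y)"
        by (rule fine_bump_sum[OF less_imp_le[OF \<rho>(1)] D(1), of L r])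
           (use rP[OF DB] rpos[OF DB] pairwise_subset[OF C'(3) D(2)] in \<open>auto simp: P_def\<close>)
      then have "F (\<lambda>y. \<Sum>x\<in>D. \<psi> x y) < \<kappa>" by (rule \<rho>(2))
      moreover have "F (\<lambda>y. \<Sum>x\<in>D. \<psi> x y) = (\<Sum>x\<in>D. F (\<psi> x))"
      proof (rule F_sum[OF D(1)])
        fix x assume "x \<in> D"
        then show "bump_function (\<psi> x)" using rP[OF DB] lipschitz_bump_bump_function unfolding P_def by blast
      qed
      moreover have "(\<Sum>x\<in>D. t * r x powr s) \<le> (\<Sum>x\<in>D. F (\<psi> x))"
      proof (rule sum_mono)
        fix x assume "x \<in> D"
        then show "t * r x powr s \<le> F (\<psi> x)" using rP[OF DB] unfolding P_def by (blast intro: less_imp_le)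
      qed
      ultimately have "t * (\<Sum>x\<in>D. r x powr s) \<le> \<kappa>" by (simp add: sum_distrib_left)
      then show ?thesis using t by (simp add: field_simps)
    qed
    have fin_em: "emeasure \<mu> (\<Union>x\<in>D. ball x (5 * r x)) \<le> ennreal (\<Lambda> * 5 powr s * (\<kappa> / t))" if D: "finite D" "D \<subseteq> C'" for D
    proof -
      have "emeasure \<mu> (\<Union>x\<in>D. ball x (5 * r x)) \<le> (\<Sum>x\<in>D. emeasure \<mu> (ball x (5 * r x)))"
        using D by (intro emeasure_subadditive_finite) (auto simp: sets_\<mu>)
      also have "\<dots> \<le> (\<Sum>x\<in>D. ennreal (\<Lambda> * (5 * r x) powr s))"
        using D C' rpos by (intro sum_mono nice_measure_ball[OF nice]) auto
      also have "\<dots> = (\<Sum>x\<in>D. ennreal (\<Lambda> * 5 powr s * r x powr s))"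
        using D C' rpos by (intro sum.cong) (auto simp: powr_mult subset_iff less_imp_le mult.assoc)
      also have "\<dots> = ennreal (\<Lambda> * 5 powr s * (\<Sum>x\<in>D. r x powr s))"
        unfolding sum_distrib_left using \<Lambda> by (intro sum_ennreal) auto
      also have "\<dots> \<le> ennreal (\<Lambda> * 5 powr s * (\<kappa> / t))"
        using fin_sum[OF D] \<Lambda> by (intro ennreal_leI mult_left_mono) auto
      finally show ?thesis .
    qed
    show ?thesis
    proof (cases "C' = {}")
      case True
      then show ?thesis using C'(4) by (intro exI[of _ "{}"]) auto
    next
      case False
      \<comment> \<open>F is only finitely additive, so the bound is available for finite
        subfamilies; continuity from below carries it over to the countable union.\<close>
      define U where "U n = (\<Union>x\<in>from_nat_into C' ` {..<n}. ball x (5 * r x))" for n :: nat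
      have sub: "from_nat_into C' ` {..<n} \<subseteq> C'" for n using from_nat_into[OF False] by auto
      have Us: "range U \<subseteq> sets \<mu>" by (auto simp: U_def sets_\<mu>)
      have "incseq U" unfolding U_def incseq_def by (intro allI impI UN_mono image_mono) auto
      then have "emeasure \<mu> (\<Union>n. U n) = (SUP n. emeasure \<mu> (U n))" using SUP_emeasure_incseq[OF Us] by simp
      also have "\<dots> \<le> ennreal (\<Lambda> * 5 powr s * (\<kappa> / t))"
        by (rule SUP_least) (unfold U_def, rule fin_em[OF _ sub], simp)
      finally have e: "emeasure \<mu> (\<Union>n. U n) \<le> ennreal (\<Lambda> * 5 powr s * (\<kappa> / t))" .
      have "Bad \<subseteq> (\<Union>n. U n)"
      proof
        fix y assume "y \<in> Bad"
        then obtain x where x: "x \<in> C'" "y \<in> ball x (5 * r x)" using C'(4) by blast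
        then obtain k where "from_nat_into C' k = x" using from_nat_into_surj[OF C'(1)] by metis
        then have "y \<in> U (Suc k)" using x by (auto simp: U_def)
        then show "y \<in> (\<Union>n. U n)" by blast
      qed
      moreover have "(\<Union>n. U n) \<in> sets \<mu>" using Us by auto
      ultimately show ?thesis using e by blast
    qed
  qed
  \<comment> \<open>\<open>Bad\<close> is defined by quantifying over functions and its
    measurability is not at hand; it is therefore enclosed in measurable sets of measure tending to
    0.\<close>
  have "\<forall>n::nat. \<exists>O'. O' \<in> sets \<mu> \<and> Bad \<subseteq> O' \<and> emeasure \<mu> O' \<le> ennreal (\<Lambda> * 5 powr s * ((1 / real (Suc n)) / t))"
    by (intro allI cover) simp
  then obtain O' where O': "\<And>n. O' n \<in> sets \<mu>" "\<And>n. Bad \<subseteq> O' n" "\<And>n. emeasure \<mu> (O' n) \<le> ennreal (\<Lambda> * 5 powr s * ((1 / real (Suc n)) / t))"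
    by metis
  define Z where "Z = (\<Inter>n. O' n)"
  have Zs: "Z \<in> sets \<mu>" unfolding Z_def using O'(1) by auto
  have "emeasure \<mu> Z \<le> ennreal (\<Lambda> * 5 powr s * ((1 / real (Suc n)) / t))" for n
    by (rule order_trans[OF emeasure_mono O'(3)[of n]]) (use O'(1) in \<open>auto simp: Z_def\<close>)
  moreover have "(\<lambda>n. ennreal (\<Lambda> * 5 powr s * ((1 / real (Suc n)) / t))) \<longlonglongrightarrow> ennreal (\<Lambda> * 5 powr s * (0 / t))"
    using t by (intro tendsto_ennrealI tendsto_mult tendsto_const tendsto_divide LIMSEQ_Suc[OF lim_1_over_n]) auto
  ultimately have "emeasure \<mu> Z \<le> ennreal (\<Lambda> * 5 powr s * (0 / t))" by (intro LIMSEQ_le_const) auto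
  then have Z0: "emeasure \<mu> Z = 0" by simp
  show ?thesis
  proof (rule AE_I[OF _ Z0 Zs], rule subsetI, rule ccontr)
    fix x assume b: "x \<in> {x \<in> space \<mu>. \<not> (\<exists>\<rho>>0. \<forall>r L \<psi>. 0 < r \<and> r < \<rho> \<and> lipschitz_bump L x r \<psi> \<and> (\<forall>y. \<bar>\<psi> y\<bar> \<le> 1) \<and> (\<integral>y. \<psi> y \<partial>\<mu>) = 0
           \<longrightarrow> F \<psi> \<le> t * r powr s)}" and nZ: "x \<notin> Z"
    have "x \<in> Bad" using b unfolding Bad_def P_def by (simp add: not_le) blast
    then show False using nZ O'(2) by (auto simp: Z_def)
  qed
qed

end

section \<open>Blow-ups\<close>

text \<open>The factor \<open>r powr (- s)\<close> keeps the growth constant unchanged and, since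
  the kernel is homogeneous of degree -s, the operator norm as well. All blow-ups thus share the
  \<Lambda> of the original measure.\<close>

definition blowup :: "real \<Rightarrow> 'a::euclidean_space measure \<Rightarrow> 'a \<Rightarrow> real \<Rightarrow> 'a measure" where
  "blowup s \<mu> x\<^sub>0 r = distr (density \<mu> (\<lambda>_. ennreal (r powr (- s)))) borel (\<lambda>y. (1 / r) *\<^sub>R (y - x\<^sub>0))"

lemma blowup_sets: "sets (blowup s \<mu> x\<^sub>0 r) = sets borel"
  by (simp add: blowup_def)

lemma nn_integral_blowup:
  fixes \<mu> :: "'a::euclidean_space measure"
  assumes sb: "sets \<mu> = sets borel" and u [measurable]: "u \<in> borel_measurable borel"
  shows "(\<integral>\<^sup>+x. u x \<partial>blowup s \<mu> x\<^sub>0 r) = ennreal (r powr (- s)) * (\<integral>\<^sup>+y. u ((1 / r) *\<^sub>R (y - x\<^sub>0)) \<partial>\<mu>)"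
proof -
  note [measurable_cong] = sb
  show ?thesis unfolding blowup_def
    by (subst nn_integral_distr, measurable, subst nn_integral_density) (auto intro!: nn_integral_cmult)
qed

lemma integral_blowup:
  fixes \<mu> :: "'a::euclidean_space measure" and u :: "'a \<Rightarrow> 'b::euclidean_space"
  assumes sb: "sets \<mu> = sets borel" and u [measurable]: "u \<in> borel_measurable borel"
  shows "(\<integral>x. u x \<partial>blowup s \<mu> x\<^sub>0 r) = r powr (- s) *\<^sub>R (\<integral>y. u ((1 / r) *\<^sub>R (y - x\<^sub>0)) \<partial>\<mu>)"
proof -
  note [measurable_cong] = sb
  show ?thesis unfolding blowup_def
    by (subst integral_distr, measurable, subst integral_density) auto
qed

lemma emeasure_blowup_ball:
  fixes \<mu> :: "'a::euclidean_space measure"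
  assumes sb: "sets \<mu> = sets borel" and r: "r > 0"
  shows "emeasure (blowup s \<mu> x\<^sub>0 r) (ball x \<rho>) = ennreal (r powr (- s)) * emeasure \<mu> (ball (x\<^sub>0 + r *\<^sub>R x) (r * \<rho>))"
proof -
  have "dist x ((1 / r) *\<^sub>R (y - x\<^sub>0)) = dist (x\<^sub>0 + r *\<^sub>R x) y / r" for y
  proof -
    have "x - (1 / r) *\<^sub>R (y - x\<^sub>0) = (1 / r) *\<^sub>R (x\<^sub>0 + r *\<^sub>R x - y)" using r by (simp add: algebra_simps)
    then show ?thesis using r by (simp add: dist_norm)
  qed
  then have "dist x ((1 / r) *\<^sub>R (y - x\<^sub>0)) < \<rho> \<longleftrightarrow> dist (x\<^sub>0 + r *\<^sub>R x) y < r * \<rho>" for y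
    using r by (simp only: divide_less_eq mult.commute if_True)
  then have ind: "indicator (ball x \<rho>) ((1 / r) *\<^sub>R (y - x\<^sub>0)) = (indicator (ball (x\<^sub>0 + r *\<^sub>R x) (r * \<rho>)) y :: ennreal)" for y
    by (simp only: indicator_def mem_ball)
  have "emeasure (blowup s \<mu> x\<^sub>0 r) (ball x \<rho>) = (\<integral>\<^sup>+y. indicator (ball x \<rho>) y \<partial>blowup s \<mu> x\<^sub>0 r)"
    by (simp add: blowup_sets)
  also have "\<dots> = ennreal (r powr (- s)) * (\<integral>\<^sup>+y. indicator (ball (x\<^sub>0 + r *\<^sub>R x) (r * \<rho>)) y \<partial>\<mu>)"
  proof -
    have "(indicator (ball x \<rho>) :: 'a \<Rightarrow> ennreal) \<in> borel_measurable borel"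
      by (intro borel_measurable_indicator) simp
    from nn_integral_blowup[OF sb this] show ?thesis by (simp only: ind)
  qed
  also have "\<dots> = ennreal (r powr (- s)) * emeasure \<mu> (ball (x\<^sub>0 + r *\<^sub>R x) (r * \<rho>))"
    by (simp add: sb)
  finally show ?thesis .
qed

lemma nice_measure_blowup:
  fixes \<mu> :: "'a::euclidean_space measure"
  assumes nice: "nice_measure s \<mu> \<Lambda>" and \<Lambda>: "\<Lambda> \<ge> 0" and r: "r > 0"
  shows "nice_measure s (blowup s \<mu> x\<^sub>0 r) \<Lambda>"
  unfolding nice_measure_def
proof (intro conjI allI impI blowup_sets)
  fix x :: 'a and \<rho> :: real assume \<rho>: "\<rho> > 0"
  have "emeasure (blowup s \<mu> x\<^sub>0 r) (ball x \<rho>) \<le> ennreal (r powr (- s)) * ennreal (\<Lambda> * (r * \<rho>) powr s)"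
    unfolding emeasure_blowup_ball[OF nice_measure_sets[OF nice] r]
    using r \<rho> by (intro mult_left_mono nice_measure_ball[OF nice]) auto
  also have "\<dots> = ennreal (r powr (- s) * (\<Lambda> * (r * \<rho>) powr s))"
    using \<Lambda> by (simp add: ennreal_mult)
  also have "r powr (- s) * (\<Lambda> * (r * \<rho>) powr s) = \<Lambda> * \<rho> powr s"
    using r \<rho> by (simp add: powr_mult powr_minus field_simps)
  finally show "emeasure (blowup s \<mu> x\<^sub>0 r) (ball x \<rho>) \<le> ennreal (\<Lambda> * \<rho> powr s)" .
qed

context CZ_kernel
begin

text \<open>The density factor r^(-s) is absorbed by the kernel, whose truncation level \<delta>
  becomes r \<delta> in the original coordinates. This is why goodness is demanded for every
  truncation level.\<close>

lemma T_trunc_blowup: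
  assumes sb: "sets \<mu> = sets borel" and r: "r > 0" and \<delta>: "\<delta> > 0" and f [measurable]: "f \<in> borel_measurable borel"
  shows "T_trunc \<Omega> s (blowup s \<mu> x\<^sub>0 r) \<delta> f x = T_trunc \<Omega> s \<mu> (r * \<delta>) (\<lambda>y. f ((1 / r) *\<^sub>R (y - x\<^sub>0))) (x\<^sub>0 + r *\<^sub>R x)"
  unfolding T_trunc_def vec_eq_iff
proof
  fix i
  have [measurable]: "(\<lambda>y. Kt \<delta> y $ i) \<in> borel_measurable borel"
    by (rule borel_measurable_continuous_onI, intro continuous_intros continuous_Kt[OF \<delta>])
  have K: "r powr (- s) *\<^sub>R Kt \<delta> (x - (1 / r) *\<^sub>R (y - x\<^sub>0)) = Kt (r * \<delta>) (x\<^sub>0 + r *\<^sub>R x - y)" for y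
  proof -
    have "r *\<^sub>R (x - (1 / r) *\<^sub>R (y - x\<^sub>0)) = x\<^sub>0 + r *\<^sub>R x - y" using r by (simp add: algebra_simps)
    then show ?thesis using Kt_scale[OF r \<delta>, of "x - (1 / r) *\<^sub>R (y - x\<^sub>0)"] by simp
  qed
  have "(\<integral>y. Kt \<delta> (x - y) $ i * f y \<partial>blowup s \<mu> x\<^sub>0 r)
      = r powr (- s) *\<^sub>R (\<integral>y. Kt \<delta> (x - (1 / r) *\<^sub>R (y - x\<^sub>0)) $ i * f ((1 / r) *\<^sub>R (y - x\<^sub>0)) \<partial>\<mu>)"
    by (subst integral_blowup[OF sb]) auto
  also have "\<dots> = (\<integral>y. r powr (- s) *\<^sub>R (Kt \<delta> (x - (1 / r) *\<^sub>R (y - x\<^sub>0)) $ i * f ((1 / r) *\<^sub>R (y - x\<^sub>0))) \<partial>\<mu>)"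
    by (rule integral_scaleR_right[symmetric])
  also have "\<dots> = (\<integral>y. Kt (r * \<delta>) (x\<^sub>0 + r *\<^sub>R x - y) $ i * f ((1 / r) *\<^sub>R (y - x\<^sub>0)) \<partial>\<mu>)"
    unfolding K[symmetric] by simp
  finally show "(\<chi> i. \<integral>y. Kt \<delta> (x - y) $ i * f y \<partial>blowup s \<mu> x\<^sub>0 r) $ i =
     (\<chi> i. \<integral>y. Kt (r * \<delta>) (x\<^sub>0 + r *\<^sub>R x - y) $ i * f ((1 / r) *\<^sub>R (y - x\<^sub>0)) \<partial>\<mu>) $ i" by simp
qed

lemma good_measure_blowup:
  assumes good: "good_measure \<Omega> s \<mu> \<Lambda>" and \<Lambda>: "\<Lambda> > 0" and r: "r > 0"
  shows "good_measure \<Omega> s (blowup s \<mu> x\<^sub>0 r) \<Lambda>"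
  unfolding good_measure_def
proof (intro conjI allI impI)
  have nice: "nice_measure s \<mu> \<Lambda>" using good by (simp add: good_measure_def)
  have \<Lambda>0: "\<Lambda> \<ge> 0" using \<Lambda> by simp
  note sb = nice_measure_sets[OF nice]
  let ?\<beta> = "blowup s \<mu> x\<^sub>0 r"
  show nb: "nice_measure s ?\<beta> \<Lambda>" by (rule nice_measure_blowup[OF nice \<Lambda>0 r])
  fix \<delta> :: real and f :: "'a \<Rightarrow> complex" assume \<delta>: "\<delta> > 0" and "f \<in> borel_measurable ?\<beta>"
  then have fm [measurable]: "f \<in> borel_measurable borel" by (simp add: measurable_cong_sets[OF blowup_sets refl])
  define f' where "f' y = f ((1 / r) *\<^sub>R (y - x\<^sub>0))" for y
  have f'm: "f' \<in> borel_measurable \<mu>" unfolding f'_def[abs_def] by (simp add: measurable_cong_sets[OF sb refl])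
  have sq: "(\<integral>\<^sup>+x. ennreal ((cmod (f x))\<^sup>2) \<partial>?\<beta>) = ennreal (r powr (- s)) * (\<integral>\<^sup>+x. ennreal ((cmod (f' x))\<^sup>2) \<partial>\<mu>)"
    unfolding f'_def by (rule nn_integral_blowup[OF sb]) measurable
  show "(\<integral>\<^sup>+x. ennreal ((norm (T_trunc \<Omega> s ?\<beta> \<delta> f x))\<^sup>2) \<partial>?\<beta>) \<le> ennreal (\<Lambda>\<^sup>2) * (\<integral>\<^sup>+x. ennreal ((cmod (f x))\<^sup>2) \<partial>?\<beta>)"
  proof (cases "(\<integral>\<^sup>+x. ennreal ((cmod (f x))\<^sup>2) \<partial>?\<beta>) < \<infinity>")
    \<comment> \<open>The infinite case is trivial; in the other one, f in L^2 supplies the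
      measurability of T f required for the change of variables.\<close>
    case False
    then have "(\<integral>\<^sup>+x. ennreal ((cmod (f x))\<^sup>2) \<partial>?\<beta>) = top" by (simp add: not_less top_unique)
    then have "ennreal (\<Lambda>\<^sup>2) * (\<integral>\<^sup>+x. ennreal ((cmod (f x))\<^sup>2) \<partial>?\<beta>) = top" using \<Lambda> by (simp add: ennreal_mult_top)
    then show ?thesis by simp
  next
    case True
    have Tm: "T_trunc \<Omega> s ?\<beta> \<delta> f \<in> borel_measurable borel" by (rule T_trunc_L2(3)[OF nb \<Lambda>0 \<delta> fm True])
    then have m: "(\<lambda>x. ennreal ((norm (T_trunc \<Omega> s ?\<beta> \<delta> f x))\<^sup>2)) \<in> borel_measurable borel" by measurable
    have "x\<^sub>0 + r *\<^sub>R ((1 / r) *\<^sub>R (y - x\<^sub>0)) = y" for y using r by simp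
    then have "(\<integral>\<^sup>+x. ennreal ((norm (T_trunc \<Omega> s ?\<beta> \<delta> f x))\<^sup>2) \<partial>?\<beta>)
        = ennreal (r powr (- s)) * (\<integral>\<^sup>+y. ennreal ((norm (T_trunc \<Omega> s \<mu> (r * \<delta>) f' y))\<^sup>2) \<partial>\<mu>)"
      unfolding nn_integral_blowup[OF sb m] by (simp only: T_trunc_blowup[OF sb r \<delta> fm] f'_def[abs_def])
    also have "\<dots> \<le> ennreal (r powr (- s)) * (ennreal (\<Lambda>\<^sup>2) * (\<integral>\<^sup>+x. ennreal ((cmod (f' x))\<^sup>2) \<partial>\<mu>))"
      using good r \<delta> f'm unfolding good_measure_def by (intro mult_left_mono) auto
    also have "\<dots> = ennreal (\<Lambda>\<^sup>2) * (\<integral>\<^sup>+x. ennreal ((cmod (f x))\<^sup>2) \<partial>?\<beta>)"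
      unfolding sq by (rule mult.left_commute)
    finally show ?thesis .
  qed
qed

lemma A_blowup:
  assumes nice: "nice_measure s \<mu> \<Lambda>" and \<Lambda>: "\<Lambda> \<ge> 0" and r: "r > 0" and \<delta>: "\<delta> > 0"
    and \<phi>: "square_integrable (blowup s \<mu> x\<^sub>0 r) \<phi>" and \<psi> [measurable]: "\<psi> \<in> borel_measurable borel"
  shows "A (blowup s \<mu> x\<^sub>0 r) \<delta> \<phi> \<psi> = r powr (- s) *\<^sub>R A \<mu> (r * \<delta>) (\<lambda>y. \<phi> ((1 / r) *\<^sub>R (y - x\<^sub>0))) (\<lambda>y. \<psi> ((1 / r) *\<^sub>R (y - x\<^sub>0)))"
proof -
  note sb = nice_measure_sets[OF nice]
  have [measurable]: "\<phi> \<in> borel_measurable borel" using \<phi> by (simp add: square_integrable_def)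
  have fm: "(\<lambda>y. complex_of_real (\<phi> y)) \<in> borel_measurable borel" by measurable
  have m: "(\<lambda>x. \<psi> x *\<^sub>R T_trunc \<Omega> s (blowup s \<mu> x\<^sub>0 r) \<delta> (\<lambda>y. complex_of_real (\<phi> y)) x) \<in> borel_measurable borel"
    by (intro borel_measurable_scaleR \<psi> T_trunc_real(3)[OF nice_measure_blowup[OF nice \<Lambda> r] \<Lambda> \<delta> \<phi>])
  have "x\<^sub>0 + r *\<^sub>R ((1 / r) *\<^sub>R (y - x\<^sub>0)) = y" for y using r by simp
  then show ?thesis unfolding A_def
    unfolding integral_blowup[OF sb m] by (simp only: T_trunc_blowup[OF sb r \<delta> fm])
qed

lemma TT_blowup_one:
  assumes nice: "nice_measure s \<mu> \<Lambda>" and \<Lambda>: "\<Lambda> \<ge> 0" and fin: "emeasure \<mu> UNIV < \<infinity>" and r: "r > 0"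
    and \<psi>: "lipschitz_bump L c \<rho> \<psi>" "\<rho> > 0"
    and \<psi>': "bump_function (\<lambda>y. \<psi> ((1 / r) *\<^sub>R (y - x\<^sub>0)))"
  shows "TT (blowup s \<mu> x\<^sub>0 r) (\<lambda>_. 1) \<psi> = r powr (- s) *\<^sub>R TT \<mu> (\<lambda>_. 1) (\<lambda>y. \<psi> ((1 / r) *\<^sub>R (y - x\<^sub>0)))"
proof -
  note sb = nice_measure_sets[OF nice]
  let ?\<beta> = "blowup s \<mu> x\<^sub>0 r"
  have nb: "nice_measure s ?\<beta> \<Lambda>" by (rule nice_measure_blowup[OF nice \<Lambda> r])
  have q\<mu>: "square_integrable \<mu> (\<lambda>_. 1)" using fin by (simp add: square_integrable_def nice_measure_space[OF nice])
  have q: "square_integrable ?\<beta> (\<lambda>_. 1)"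
  proof -
    have "(\<integral>\<^sup>+x. ennreal ((1::real)\<^sup>2) \<partial>?\<beta>) = ennreal (r powr (- s)) * (\<integral>\<^sup>+y. ennreal ((1::real)\<^sup>2) \<partial>\<mu>)"
      by (rule nn_integral_blowup[OF sb]) measurable
    also have "\<dots> < \<infinity>" using fin by (simp add: nice_measure_space[OF nice] ennreal_mult_less_top)
    finally show ?thesis by (simp add: square_integrable_def)
  qed
  obtain L' R' where \<psi>'': "R' > 0" "lipschitz_bump L' 0 R' (\<lambda>y. \<psi> ((1 / r) *\<^sub>R (y - x\<^sub>0)))"
    using \<psi>' by (auto simp: bump_function_def)
  have 1: "((\<lambda>\<delta>. A ?\<beta> \<delta> (\<lambda>_. 1) \<psi>) \<longlongrightarrow> TT ?\<beta> (\<lambda>_. 1) \<psi>) (at_right 0)"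
    by (rule A_tendsto(1)[OF nb \<Lambda> q _ \<psi>]) simp
  have "((\<lambda>\<delta>. A \<mu> \<delta> (\<lambda>_. 1) (\<lambda>y. \<psi> ((1 / r) *\<^sub>R (y - x\<^sub>0)))) \<longlongrightarrow> TT \<mu> (\<lambda>_. 1) (\<lambda>y. \<psi> ((1 / r) *\<^sub>R (y - x\<^sub>0)))) (at_right 0)"
    by (rule A_tendsto(1)[OF nice \<Lambda> q\<mu> _ \<psi>''(2,1)]) simp
  \<comment> \<open>Scaling the truncation level by a fixed r > 0 does not affect the limit from the
    right at 0.\<close>
  moreover have "filterlim (\<lambda>\<delta>. r * \<delta>) (at_right 0) (at_right 0)"
  proof -
    have "((\<lambda>\<delta>. r * \<delta>) \<longlongrightarrow> r * 0) (at_right 0)" by (intro tendsto_intros)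
    moreover have "\<forall>\<^sub>F \<delta> in at_right 0. r * \<delta> \<in> {0<..} \<and> r * \<delta> \<noteq> 0"
      using eventually_at_right_less[of "0::real"] by eventually_elim (use r in simp)
    ultimately show ?thesis by (simp add: filterlim_at)
  qed
  ultimately have "((\<lambda>\<delta>. A \<mu> (r * \<delta>) (\<lambda>_. 1) (\<lambda>y. \<psi> ((1 / r) *\<^sub>R (y - x\<^sub>0)))) \<longlongrightarrow> TT \<mu> (\<lambda>_. 1) (\<lambda>y. \<psi> ((1 / r) *\<^sub>R (y - x\<^sub>0)))) (at_right 0)"
    by (rule filterlim_compose)
  then have "((\<lambda>\<delta>. r powr (- s) *\<^sub>R A \<mu> (r * \<delta>) (\<lambda>_. 1) (\<lambda>y. \<psi> ((1 / r) *\<^sub>R (y - x\<^sub>0)))) \<longlongrightarrow>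
      r powr (- s) *\<^sub>R TT \<mu> (\<lambda>_. 1) (\<lambda>y. \<psi> ((1 / r) *\<^sub>R (y - x\<^sub>0)))) (at_right 0)"
    by (intro tendsto_intros)
  moreover have "\<forall>\<^sub>F \<delta> in at_right 0. r powr (- s) *\<^sub>R A \<mu> (r * \<delta>) (\<lambda>_. 1) (\<lambda>y. \<psi> ((1 / r) *\<^sub>R (y - x\<^sub>0))) = A ?\<beta> \<delta> (\<lambda>_. 1) \<psi>"
    using eventually_at_right_less[of "0::real"]
    by eventually_elim (rule A_blowup[OF nice \<Lambda> r _ q lipschitz_bump_measurable[OF \<psi>(1)], symmetric])
  ultimately have "((\<lambda>\<delta>. A ?\<beta> \<delta> (\<lambda>_. 1) \<psi>) \<longlongrightarrow> r powr (- s) *\<^sub>R TT \<mu> (\<lambda>_. 1) (\<lambda>y. \<psi> ((1 / r) *\<^sub>R (y - x\<^sub>0)))) (at_right 0)"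
    by (rule Lim_transform_eventually)
  with 1 show ?thesis by (rule tendsto_unique[rotated]) simp
qed

end

section \<open>T(1) for a finite good measure\<close>

locale finite_good_measure = CZ_kernel +
  fixes \<mu> :: "'a measure" and \<Lambda> :: real
  assumes good: "good_measure \<Omega> s \<mu> \<Lambda>" and \<Lambda>_pos: "\<Lambda> > 0" and finite_mass: "emeasure \<mu> UNIV < \<infinity>"
begin

lemma nice: "nice_measure s \<mu> \<Lambda>" using good by (simp add: good_measure_def)

lemma \<Lambda>_nonneg: "\<Lambda> \<ge> 0" using \<Lambda>_pos by simp

lemma square_integrable_1: "square_integrable \<mu> (\<lambda>_. 1)"
  using finite_mass by (simp add: square_integrable_def nice_measure_space[OF nice])

text \<open>For finite mass the constant 1 is a cutoff on every ball at once. The far-field term of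
  T(1) then disappears, and the pairing makes sense for all bumps, of mean zero or not, which makes
  it an additive functional.\<close>

definition T1 :: "('a \<Rightarrow> real) \<Rightarrow> complex ^ 'b" where
  "T1 \<psi> = TT \<mu> (\<lambda>_. 1) \<psi>"

lemma A_tendsto_T1:
  assumes "bump_function \<psi>"
  shows "((\<lambda>\<delta>. A \<mu> \<delta> (\<lambda>_. 1) \<psi>) \<longlongrightarrow> T1 \<psi>) (at_right 0)"
proof -
  obtain L R where "R > 0" "lipschitz_bump L 0 R \<psi>" using assms by (auto simp: bump_function_def)
  then show ?thesis unfolding T1_def by (intro A_tendsto(1)[OF nice \<Lambda>_nonneg square_integrable_1]) auto
qed

lemma A_one_integrable:
  assumes "bump_function \<psi>" "\<delta> > 0"
  shows "integrable \<mu> (\<lambda>x. \<psi> x *\<^sub>R T_trunc \<Omega> s \<mu> \<delta> (\<lambda>y. complex_of_real 1) x)"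
proof -
  obtain L R where "R > 0" "lipschitz_bump L 0 R \<psi>" using assms by (auto simp: bump_function_def)
  then show ?thesis by (intro bump_T_trunc_integrable[OF nice \<Lambda>_nonneg assms(2) square_integrable_1]) auto
qed

lemma T1_add:
  assumes "bump_function \<psi>" "bump_function \<phi>"
  shows "T1 (\<lambda>x. \<psi> x + \<phi> x) = T1 \<psi> + T1 \<phi>"
proof -
  have "((\<lambda>\<delta>. A \<mu> \<delta> (\<lambda>_. 1) \<psi> + A \<mu> \<delta> (\<lambda>_. 1) \<phi>) \<longlongrightarrow> T1 \<psi> + T1 \<phi>) (at_right 0)"
    by (intro tendsto_add A_tendsto_T1 assms)
  moreover have "\<forall>\<^sub>F \<delta> in at_right 0. A \<mu> \<delta> (\<lambda>_. 1) \<psi> + A \<mu> \<delta> (\<lambda>_. 1) \<phi> = A \<mu> \<delta> (\<lambda>_. 1) (\<lambda>x. \<psi> x + \<phi> x)"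
    using eventually_at_right_less[of "0::real"]
  proof eventually_elim
    case (elim \<delta>)
    show ?case unfolding A_def scaleR_add_left
      by (rule Bochner_Integration.integral_add[OF A_one_integrable[OF assms(1) elim] A_one_integrable[OF assms(2) elim], symmetric])
  qed
  ultimately have "((\<lambda>\<delta>. A \<mu> \<delta> (\<lambda>_. 1) (\<lambda>x. \<psi> x + \<phi> x)) \<longlongrightarrow> T1 \<psi> + T1 \<phi>) (at_right 0)"
    by (rule Lim_transform_eventually)
  then show ?thesis using A_tendsto_T1[OF bump_function_add[OF assms]] by (intro tendsto_unique[of "at_right 0"]) auto
qed

lemma bump_function_cmult: "bump_function \<psi> \<Longrightarrow> bump_function (\<lambda>x. a * \<psi> x)"
  unfolding bump_function_def using lipschitz_bump_cmult by blast

lemma T1_cmult: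
  assumes "bump_function \<psi>"
  shows "T1 (\<lambda>x. a * \<psi> x) = a *\<^sub>R T1 \<psi>"
proof -
  have "A \<mu> \<delta> (\<lambda>_. 1) (\<lambda>x. a * \<psi> x) = a *\<^sub>R A \<mu> \<delta> (\<lambda>_. 1) \<psi>" for \<delta>
    unfolding A_def by (simp flip: scaleR_scaleR)
  then have "((\<lambda>\<delta>. A \<mu> \<delta> (\<lambda>_. 1) (\<lambda>x. a * \<psi> x)) \<longlongrightarrow> a *\<^sub>R T1 \<psi>) (at_right 0)"
    using A_tendsto_T1[OF assms] by (simp add: tendsto_scaleR)
  then show ?thesis using A_tendsto_T1[OF bump_function_cmult[OF assms]] by (intro tendsto_unique[of "at_right 0"]) auto
qed

text \<open>Cauchy-Schwarz, with the L^2 norm of T_\<delta> 1 bounded through goodness by \<Lambda>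
  times the root of the total mass; the bound is uniform in \<delta> and survives the limit.\<close>

lemma T1_bound:
  assumes \<psi>: "bump_function \<psi>"
  shows "(norm (T1 \<psi>))\<^sup>2 \<le> (\<Lambda>\<^sup>2 * measure \<mu> UNIV) * (\<integral>x. (\<psi> x)\<^sup>2 \<partial>\<mu>)"
proof -
  note [measurable_cong] = nice_measure_sets[OF nice]
  note [measurable] = bump_functionD(1)[OF \<psi>]
  obtain L R where LR: "R > 0" "lipschitz_bump L 0 R \<psi>" using \<psi> by (auto simp: bump_function_def)
  have sqi: "integrable \<mu> (\<lambda>x. (\<psi> x)\<^sup>2)"
  proof (rule nice_measure_integrable_bounded_support[OF nice, where B="(2 * L * R)\<^sup>2" and c=0 and r=R])
    show "norm ((\<psi> x)\<^sup>2) \<le> (2 * L * R)\<^sup>2" for x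
      using power_mono[OF lipschitz_bump_bound[OF LR(2,1)], of x 2] by simp
  qed (use lipschitz_bumpD(2)[OF LR(2)] in auto)
  have "(norm (A \<mu> \<delta> (\<lambda>_. 1) \<psi>))\<^sup>2 \<le> (\<Lambda>\<^sup>2 * measure \<mu> UNIV) * (\<integral>x. (\<psi> x)\<^sup>2 \<partial>\<mu>)" if \<delta>: "\<delta> > 0" for \<delta>
  proof -
    let ?T = "T_trunc \<Omega> s \<mu> \<delta> (\<lambda>y. complex_of_real 1)"
    have [measurable]: "?T \<in> borel_measurable borel" by (rule T_trunc_real(3)[OF nice \<Lambda>_nonneg \<delta> square_integrable_1])
    have "ennreal (norm (A \<mu> \<delta> (\<lambda>_. 1) \<psi>)) \<le> (\<integral>\<^sup>+x. ennreal (norm (\<psi> x *\<^sub>R ?T x)) \<partial>\<mu>)"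
      unfolding A_def by (rule integral_norm_bound_ennreal[OF A_one_integrable[OF \<psi> \<delta>]])
    also have "\<dots> = (\<integral>\<^sup>+x. ennreal \<bar>\<psi> x\<bar> * ennreal (norm (?T x)) \<partial>\<mu>)" by (simp add: ennreal_mult)
    finally have "(ennreal (norm (A \<mu> \<delta> (\<lambda>_. 1) \<psi>)))\<^sup>2 \<le> (\<integral>\<^sup>+x. ennreal \<bar>\<psi> x\<bar> * ennreal (norm (?T x)) \<partial>\<mu>)\<^sup>2"
      by (rule power_mono) simp
    also have "\<dots> \<le> (\<integral>\<^sup>+x. (ennreal \<bar>\<psi> x\<bar>)\<^sup>2 \<partial>\<mu>) * (\<integral>\<^sup>+x. (ennreal (norm (?T x)))\<^sup>2 \<partial>\<mu>)"
      by (rule Cauchy_Schwarz_nn_integral) measurable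
    also have "\<dots> = ennreal (\<integral>x. (\<psi> x)\<^sup>2 \<partial>\<mu>) * (\<integral>\<^sup>+x. ennreal ((norm (?T x))\<^sup>2) \<partial>\<mu>)"
      by (simp add: ennreal_power nn_integral_eq_integral[OF sqi])
    also have "\<dots> \<le> ennreal (\<integral>x. (\<psi> x)\<^sup>2 \<partial>\<mu>) * (ennreal (\<Lambda>\<^sup>2) * (\<integral>\<^sup>+x. ennreal ((cmod (complex_of_real 1))\<^sup>2) \<partial>\<mu>))"
    proof (rule mult_left_mono)
      have "(\<lambda>y. complex_of_real 1) \<in> borel_measurable \<mu>" by simp
      then show "(\<integral>\<^sup>+x. ennreal ((norm (?T x))\<^sup>2) \<partial>\<mu>) \<le> ennreal (\<Lambda>\<^sup>2) * (\<integral>\<^sup>+x. ennreal ((cmod (complex_of_real 1))\<^sup>2) \<partial>\<mu>)"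
        using good \<delta> unfolding good_measure_def by blast
    qed simp
    also have "(\<integral>\<^sup>+x. ennreal ((cmod (complex_of_real 1))\<^sup>2) \<partial>\<mu>) = ennreal (measure \<mu> UNIV)"
      using finite_mass by (simp add: nice_measure_space[OF nice] emeasure_eq_ennreal_measure less_top[symmetric])
    also have "ennreal (\<integral>x. (\<psi> x)\<^sup>2 \<partial>\<mu>) * (ennreal (\<Lambda>\<^sup>2) * ennreal (measure \<mu> UNIV)) = ennreal ((\<Lambda>\<^sup>2 * measure \<mu> UNIV) * (\<integral>x. (\<psi> x)\<^sup>2 \<partial>\<mu>))"
      by (simp add: ennreal_mult[symmetric] mult_ac)
    finally show ?thesis by (simp add: ennreal_power)
  qed
  then have "\<forall>\<^sub>F \<delta> in at_right 0. (norm (A \<mu> \<delta> (\<lambda>_. 1) \<psi>))\<^sup>2 \<le> (\<Lambda>\<^sup>2 * measure \<mu> UNIV) * (\<integral>x. (\<psi> x)\<^sup>2 \<partial>\<mu>)"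
    using eventually_at_right_less[of "0::real"] by (auto elim: eventually_mono)
  then show ?thesis
    by (intro tendsto_upperbound[OF tendsto_power[OF tendsto_norm[OF A_tendsto_T1[OF \<psi>]]]]) auto
qed

text \<open>The scalar result is applied to each real component. The threshold is divided by the
  real dimension of the target, so that the l^1 norm of the components recovers 1/(n+1).\<close>

lemma AE_T1_small:
  "AE x in \<mu>. \<forall>n::nat. \<exists>\<rho>>0. \<forall>r L \<psi>. 0 < r \<and> r < \<rho> \<and> lipschitz_bump L x r \<psi> \<and> (\<forall>y. \<bar>\<psi> y\<bar> \<le> 1) \<and> (\<integral>y. \<psi> y \<partial>\<mu>) = 0
     \<longrightarrow> norm (T1 \<psi>) \<le> (1 / real (Suc n)) * r powr s"
proof -
  let ?D = "real DIM(complex ^ 'b)"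
  have D: "?D > 0" by simp
  have small: "AE x in \<mu>. \<exists>\<rho>>0. \<forall>r L \<psi>. 0 < r \<and> r < \<rho> \<and> lipschitz_bump L x r \<psi> \<and> (\<forall>y. \<bar>\<psi> y\<bar> \<le> 1) \<and> (\<integral>y. \<psi> y \<partial>\<mu>) = 0
     \<longrightarrow> T1 \<psi> \<bullet> b \<le> (1 / real (Suc n) / ?D) * r powr s" if b: "norm b = 1" for b n
  proof -
    interpret bounded_bump_functional \<mu> "\<lambda>\<psi>. T1 \<psi> \<bullet> b" s \<Lambda> "\<Lambda>\<^sup>2 * measure \<mu> UNIV"
    proof unfold_locales
      fix \<psi> :: "'a \<Rightarrow> real" assume \<psi>: "bump_function \<psi>"
      have "(T1 \<psi> \<bullet> b)\<^sup>2 \<le> (norm (T1 \<psi>))\<^sup>2" using Cauchy_Schwarz_ineq2[of "T1 \<psi>" b] b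
        by (metis abs_ge_zero mult.right_neutral power2_abs power_mono)
      then show "(T1 \<psi> \<bullet> b)\<^sup>2 \<le> \<Lambda>\<^sup>2 * measure \<mu> UNIV * (\<integral>x. (\<psi> x)\<^sup>2 \<partial>\<mu>)" using T1_bound[OF \<psi>] by linarith
    qed (use nice \<Lambda>_nonneg s_pos finite_mass in \<open>auto simp: T1_add inner_add_left\<close>)
    show ?thesis by (rule AE_F_small_on_balls) (use D in simp)
  qed
  have "AE x in \<mu>. \<forall>b\<in>Basis. \<exists>\<rho>>0. \<forall>r L \<psi>. 0 < r \<and> r < \<rho> \<and> lipschitz_bump L x r \<psi> \<and> (\<forall>y. \<bar>\<psi> y\<bar> \<le> 1) \<and> (\<integral>y. \<psi> y \<partial>\<mu>) = 0
     \<longrightarrow> \<bar>T1 \<psi> \<bullet> b\<bar> \<le> (1 / real (Suc n) / ?D) * r powr s" for n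
  proof (intro AE_finite_allI finite_Basis)
    fix b :: "complex ^ 'b" assume b: "b \<in> Basis"
    \<comment> \<open>The scalar result bounds a component from above only; using both b and -b
      controls its absolute value.\<close>
    have nb: "norm b = 1" "norm (- b) = 1" using b by auto
    show "AE x in \<mu>. \<exists>\<rho>>0. \<forall>r L \<psi>. 0 < r \<and> r < \<rho> \<and> lipschitz_bump L x r \<psi> \<and> (\<forall>y. \<bar>\<psi> y\<bar> \<le> 1) \<and> (\<integral>y. \<psi> y \<partial>\<mu>) = 0
     \<longrightarrow> \<bar>T1 \<psi> \<bullet> b\<bar> \<le> (1 / real (Suc n) / ?D) * r powr s"
      using small[OF nb(1), of n] small[OF nb(2), of n]
    proof eventually_elim
      case (elim x)
      then obtain \<rho>1 \<rho>2 where \<rho>: "\<rho>1 > 0" "\<rho>2 > 0"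
        "\<And>r L \<psi>. 0 < r \<and> r < \<rho>1 \<and> lipschitz_bump L x r \<psi> \<and> (\<forall>y. \<bar>\<psi> y\<bar> \<le> 1) \<and> (\<integral>y. \<psi> y \<partial>\<mu>) = 0
          \<Longrightarrow> T1 \<psi> \<bullet> b \<le> (1 / real (Suc n) / ?D) * r powr s"
        "\<And>r L \<psi>. 0 < r \<and> r < \<rho>2 \<and> lipschitz_bump L x r \<psi> \<and> (\<forall>y. \<bar>\<psi> y\<bar> \<le> 1) \<and> (\<integral>y. \<psi> y \<partial>\<mu>) = 0
          \<Longrightarrow> T1 \<psi> \<bullet> (- b) \<le> (1 / real (Suc n) / ?D) * r powr s" by blast
      show ?case
      proof (intro exI[of _ "min \<rho>1 \<rho>2"] conjI allI impI)
        fix r L \<psi> assume h: "0 < r \<and> r < min \<rho>1 \<rho>2 \<and> lipschitz_bump L x r \<psi> \<and> (\<forall>y. \<bar>\<psi> y\<bar> \<le> 1) \<and> (\<integral>y. \<psi> y \<partial>\<mu>) = 0"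
        have "T1 \<psi> \<bullet> b \<le> (1 / real (Suc n) / ?D) * r powr s"
          by (rule \<rho>(3)[of r L]) (use h in simp)
        moreover have "T1 \<psi> \<bullet> (- b) \<le> (1 / real (Suc n) / ?D) * r powr s"
          by (rule \<rho>(4)[of r L]) (use h in simp)
        ultimately show "\<bar>T1 \<psi> \<bullet> b\<bar> \<le> (1 / real (Suc n) / ?D) * r powr s" unfolding inner_minus_right by linarith
      qed (use \<rho> in auto)
    qed
  qed
  then have "AE x in \<mu>. \<forall>n. \<forall>b\<in>Basis. \<exists>\<rho>>0. \<forall>r L \<psi>. 0 < r \<and> r < \<rho> \<and> lipschitz_bump L x r \<psi> \<and> (\<forall>y. \<bar>\<psi> y\<bar> \<le> 1) \<and> (\<integral>y. \<psi> y \<partial>\<mu>) = 0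
     \<longrightarrow> \<bar>T1 \<psi> \<bullet> b\<bar> \<le> (1 / real (Suc n) / ?D) * r powr s"
    unfolding AE_all_countable by blast
  then show ?thesis
  proof eventually_elim
    case (elim x)
    show ?case
    proof
      fix n
      obtain \<rho> where \<rho>: "\<And>b. b \<in> Basis \<Longrightarrow> \<rho> b > 0 \<and> (\<forall>r L \<psi>. 0 < r \<and> r < \<rho> b \<and> lipschitz_bump L x r \<psi> \<and> (\<forall>y. \<bar>\<psi> y\<bar> \<le> 1) \<and> (\<integral>y. \<psi> y \<partial>\<mu>) = 0
     \<longrightarrow> \<bar>T1 \<psi> \<bullet> b\<bar> \<le> (1 / real (Suc n) / ?D) * r powr s)" using elim by metis
      define \<rho>0 where "\<rho>0 = Min (\<rho> ` Basis)"
      have \<rho>0: "\<rho>0 > 0" "\<And>b. b \<in> Basis \<Longrightarrow> \<rho>0 \<le> \<rho> b" using \<rho> by (auto simp: \<rho>0_def)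
      show "\<exists>\<rho>>0. \<forall>r L \<psi>. 0 < r \<and> r < \<rho> \<and> lipschitz_bump L x r \<psi> \<and> (\<forall>y. \<bar>\<psi> y\<bar> \<le> 1) \<and> (\<integral>y. \<psi> y \<partial>\<mu>) = 0
        \<longrightarrow> norm (T1 \<psi>) \<le> (1 / real (Suc n)) * r powr s"
      proof (intro exI[of _ \<rho>0] conjI allI impI \<rho>0(1))
        fix r L \<psi> assume h: "0 < r \<and> r < \<rho>0 \<and> lipschitz_bump L x r \<psi> \<and> (\<forall>y. \<bar>\<psi> y\<bar> \<le> 1) \<and> (\<integral>y. \<psi> y \<partial>\<mu>) = 0"
        have "norm (T1 \<psi>) \<le> (\<Sum>b\<in>Basis. \<bar>T1 \<psi> \<bullet> b\<bar>)" by (rule norm_le_l1)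
        also have "\<dots> \<le> (\<Sum>b\<in>(Basis :: (complex ^ 'b) set). (1 / real (Suc n) / ?D) * r powr s)"
        proof (rule sum_mono)
          fix b :: "complex ^ 'b" assume b: "b \<in> Basis"
          have "r < \<rho> b" using h \<rho>0(2)[OF b] by linarith
          then show "\<bar>T1 \<psi> \<bullet> b\<bar> \<le> (1 / real (Suc n) / ?D) * r powr s" using \<rho>[OF b] h by blast
        qed
        also have "\<dots> = (1 / real (Suc n)) * r powr s" using D by simp
        finally show "norm (T1 \<psi>) \<le> (1 / real (Suc n)) * r powr s" .
      qed
    qed
  qed
qed

end

text \<open>The radius r(|c| + \<rho>) makes the ball centred at the blow-up point itself, wherever
  the bump sits in blown-up coordinates, because the smallness of T(1) is known only for balls with
  that centre.\<close>

lemma lipschitz_bump_rescale: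
  assumes \<psi>: "lipschitz_bump L c \<rho> \<psi>" and r: "r > 0"
  shows "lipschitz_bump (L / r) x\<^sub>0 (r * (norm c + \<rho>)) (\<lambda>y. \<psi> ((1 / r) *\<^sub>R (y - x\<^sub>0)))"
  unfolding lipschitz_bump_def
proof (intro conjI allI impI)
  show "(L / r)-lipschitz_on UNIV (\<lambda>y. \<psi> ((1 / r) *\<^sub>R (y - x\<^sub>0)))"
  proof (rule lipschitz_onI)
    fix y z
    have "dist ((1 / r) *\<^sub>R (y - x\<^sub>0)) ((1 / r) *\<^sub>R (z - x\<^sub>0)) = dist y z / r"
      using r by (simp add: dist_norm flip: scaleR_diff_right)
    then show "dist (\<psi> ((1 / r) *\<^sub>R (y - x\<^sub>0))) (\<psi> ((1 / r) *\<^sub>R (z - x\<^sub>0))) \<le> L / r * dist y z"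
      using lipschitz_bumpD(1)[OF \<psi>, of "(1 / r) *\<^sub>R (y - x\<^sub>0)" "(1 / r) *\<^sub>R (z - x\<^sub>0)"]
      by (simp add: dist_real_def)
  qed (use lipschitz_bumpD(3)[OF \<psi>] r in auto)
  fix y assume "y \<notin> ball x\<^sub>0 (r * (norm c + \<rho>))"
  then have "norm c + \<rho> \<le> norm (y - x\<^sub>0) / r" using r by (simp add: dist_norm norm_minus_commute field_simps)
  also have "\<dots> = norm ((1 / r) *\<^sub>R (y - x\<^sub>0))" unfolding norm_scaleR using r by simp
  finally have "\<rho> \<le> norm ((1 / r) *\<^sub>R (y - x\<^sub>0)) - norm c" by simp
  also have "\<dots> \<le> dist c ((1 / r) *\<^sub>R (y - x\<^sub>0))"
    using norm_triangle_ineq2[of "(1 / r) *\<^sub>R (y - x\<^sub>0)" c] by (simp only: dist_norm norm_minus_commute[of c])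
  finally show "\<psi> ((1 / r) *\<^sub>R (y - x\<^sub>0)) = 0" by (intro lipschitz_bumpD(2)[OF \<psi>]) (simp only: mem_ball not_less)
qed

section \<open>Limits of blow-ups are reflectionless\<close>

context finite_good_measure
begin

definition T1_small_at :: "'a \<Rightarrow> bool" where
  "T1_small_at x \<longleftrightarrow> (\<forall>n::nat. \<exists>\<rho>>0. \<forall>r L \<psi>. 0 < r \<and> r < \<rho> \<and> lipschitz_bump L x r \<psi> \<and> (\<forall>y. \<bar>\<psi> y\<bar> \<le> 1) \<and> (\<integral>y. \<psi> y \<partial>\<mu>) = 0
     \<longrightarrow> norm (T1 \<psi>) \<le> (1 / real (Suc n)) * r powr s)"

text \<open>The factor r^(-s) from the blow-up cancels the r^s in the smallness of T(1), leaving a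
  fixed multiple of 1/(n+1). The threshold R is uniform over all bumps with constants L, c and
  \<rho>, since the bumps it is applied to vary with the blow-up.\<close>

lemma TT_blowup_small:
  assumes x0: "T1_small_at x\<^sub>0" and \<rho>: "\<rho> > 0" and L: "L \<ge> 0" and e: "e > 0"
  shows "\<exists>R>0. \<forall>r \<psi>. 0 < r \<and> r < R \<and> lipschitz_bump L c \<rho> \<psi> \<and> (\<integral>x. \<psi> x \<partial>blowup s \<mu> x\<^sub>0 r) = 0
     \<longrightarrow> norm (TT (blowup s \<mu> x\<^sub>0 r) (\<lambda>_. 1) \<psi>) \<le> e"
proof -
  define \<rho>' where "\<rho>' = norm c + \<rho>"
  have \<rho>': "\<rho>' > 0" using \<rho> by (simp add: \<rho>'_def add_nonneg_pos)
  define B where "B = 2 * L * \<rho> + 1"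
  have B: "B > 0" using L \<rho> by (simp add: B_def add_nonneg_pos)
  \<comment> \<open>B bounds the rescaled bump, so dividing by B normalises it to size 1; n is then
    large enough to absorb B and the enlarged radius \<rho>'.\<close>
  obtain n where n: "B * \<rho>' powr s / e < real n" using reals_Archimedean2 by blast
  then have "B * \<rho>' powr s < real (Suc n) * e" using e by (simp add: divide_less_eq algebra_simps)
  then have ne: "B * \<rho>' powr s / real (Suc n) \<le> e" by (simp add: divide_le_eq mult.commute del: of_nat_Suc)
  obtain \<rho>n where \<rho>n: "\<rho>n > 0" "\<And>r L \<psi>. 0 < r \<Longrightarrow> r < \<rho>n \<Longrightarrow> lipschitz_bump L x\<^sub>0 r \<psi> \<Longrightarrow> (\<forall>y. \<bar>\<psi> y\<bar> \<le> 1) \<Longrightarrow> (\<integral>y. \<psi> y \<partial>\<mu>) = 0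
     \<Longrightarrow> norm (T1 \<psi>) \<le> (1 / real (Suc n)) * r powr s"
    using x0 unfolding T1_small_at_def by meson
  have "norm (TT (blowup s \<mu> x\<^sub>0 r) (\<lambda>_. 1) \<psi>) \<le> e"
    if r: "0 < r" "r < \<rho>n / \<rho>'" and \<psi>: "lipschitz_bump L c \<rho> \<psi>" and mz: "(\<integral>x. \<psi> x \<partial>blowup s \<mu> x\<^sub>0 r) = 0" for r \<psi>
  proof -
    define \<psi>' where "\<psi>' y = \<psi> ((1 / r) *\<^sub>R (y - x\<^sub>0))" for y
    have b': "lipschitz_bump (L / r) x\<^sub>0 (r * \<rho>') \<psi>'"
      unfolding \<psi>'_def[abs_def] \<rho>'_def by (rule lipschitz_bump_rescale[OF \<psi> r(1)])
    have rp: "r * \<rho>' > 0" "r * \<rho>' < \<rho>n" using r \<rho>' by (auto simp: field_simps)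
    have bf: "bump_function \<psi>'" by (rule lipschitz_bump_bump_function[OF b' rp(1)])
    have "(\<integral>x. \<psi> x \<partial>blowup s \<mu> x\<^sub>0 r) = r powr (- s) *\<^sub>R (\<integral>y. \<psi>' y \<partial>\<mu>)"
      unfolding \<psi>'_def by (rule integral_blowup[OF nice_measure_sets[OF nice] lipschitz_bump_measurable[OF \<psi>]])
    then have mz': "(\<integral>y. (1 / B) * \<psi>' y \<partial>\<mu>) = 0" using mz r by simp
    have "\<bar>\<psi>' y\<bar> \<le> B" for y using lipschitz_bump_bound[OF \<psi> \<rho>, of "(1 / r) *\<^sub>R (y - x\<^sub>0)"] unfolding \<psi>'_def B_def by linarith
    then have le1: "\<forall>y. \<bar>(1 / B) * \<psi>' y\<bar> \<le> 1" using B by (simp add: abs_mult divide_le_eq)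
    have "norm (T1 (\<lambda>y. (1 / B) * \<psi>' y)) \<le> (1 / real (Suc n)) * (r * \<rho>') powr s"
      by (rule \<rho>n(2)[OF rp lipschitz_bump_cmult[OF b'] le1 mz'])
    then have t: "norm (T1 \<psi>') \<le> B * ((1 / real (Suc n)) * (r * \<rho>') powr s)"
      unfolding T1_cmult[OF bf] using B by (simp add: field_simps)
    have "norm (TT (blowup s \<mu> x\<^sub>0 r) (\<lambda>_. 1) \<psi>) = r powr (- s) * norm (T1 \<psi>')"
      using TT_blowup_one[OF nice \<Lambda>_nonneg finite_mass r(1) \<psi> \<rho> bf[unfolded \<psi>'_def[abs_def]]]
      by (simp add: T1_def \<psi>'_def[abs_def])
    also have "\<dots> \<le> r powr (- s) * (B * ((1 / real (Suc n)) * (r * \<rho>') powr s))"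
      by (intro mult_left_mono t) simp
    also have "\<dots> = B * \<rho>' powr s / real (Suc n)"
      using r \<rho>' by (simp add: powr_mult powr_minus field_simps del: of_nat_Suc)
    finally show ?thesis using ne by linarith
  qed
  then show ?thesis using \<rho>n(1) \<rho>' by (intro exI[of _ "\<rho>n / \<rho>'"]) auto
qed

text \<open>The pairing for \<nu> is compared with a truncated pairing having a compactly supported
  cutoff, this with the same quantity for a blow-up by vague convergence, and that in turn with T(1)
  of the blow-up, which is small. The cutoff and truncation errors do not depend on the blow-up, so
  they may be sent to 0 last.\<close>

lemma blowup_limit_reflectionless:
  assumes x0: "T1_small_at x\<^sub>0" and r0: "\<And>k. r k > 0" and rlim: "r \<longlonglongrightarrow> 0"
    and v: "vague_conv (\<lambda>k. blowup s \<mu> x\<^sub>0 (r k)) \<nu>"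
  shows "reflectionless \<Omega> s \<nu>"
proof -
  define N where "N k = blowup s \<mu> x\<^sub>0 (r k)" for k
  have vN: "vague_conv N \<nu>" using v by (simp add: N_def[abs_def])
  have goodN: "good_measure \<Omega> s (N k) \<Lambda>" for k
    unfolding N_def by (rule good_measure_blowup[OF good \<Lambda>_pos r0])
  have niceN: "nice_measure s (N k) \<Lambda>" for k using goodN by (simp add: good_measure_def)
  have goodv: "good_measure \<Omega> s \<nu> \<Lambda>" by (rule good_measure_vague[OF vN goodN \<Lambda>_pos])
  then have nv: "nice_measure s \<nu> \<Lambda>" by (simp add: good_measure_def)
  have cut1: "cutoff (N k) c t (\<lambda>_. 1)" for k c t
  proof -
    have "(\<integral>\<^sup>+x. ennreal ((1::real)\<^sup>2) \<partial>N k) = ennreal (r k powr (- s)) * (\<integral>\<^sup>+y. ennreal ((1::real)\<^sup>2) \<partial>\<mu>)"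
      unfolding N_def by (rule nn_integral_blowup[OF nice_measure_sets[OF nice]]) measurable
    also have "\<dots> < \<infinity>" using finite_mass by (simp add: nice_measure_space[OF nice] ennreal_mult_less_top)
    finally show ?thesis by (simp add: cutoff_def square_integrable_def)
  qed
  have main: "T1_pair \<Omega> s \<nu> z \<phi> \<psi> = 0"
    if L: "L-lipschitz_on UNIV \<psi>" and R: "R > 0" and sup: "closure {x. \<psi> x \<noteq> 0} \<subseteq> ball c R"
      and mz: "(\<integral>x. \<psi> x \<partial>\<nu>) = 0" and z: "z \<in> ball c R" and \<phi>: "cutoff \<nu> c (2 * R) \<phi>"
    for \<psi> c R z \<phi> L
  proof -
    have "\<psi> x = 0" if "x \<notin> ball c R" for x using that sup closure_subset[of "{x. \<psi> x \<noteq> 0}"] by blast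
    then have \<psi>: "lipschitz_bump L c R \<psi>" using L by (simp add: lipschitz_bump_def)
    note L0 = lipschitz_bumpD(3)[OF \<psi>]
    \<comment> \<open>A bump that is positive on the whole ball; multiples of it restore mean zero
      for the blow-ups without enlarging the support.\<close>
    define \<theta> where "\<theta> x = max 0 (R - dist c x)" for x
    have \<theta>: "lipschitz_bump 1 c R \<theta>"
      unfolding lipschitz_bump_def
    proof (intro conjI lipschitz_onI allI impI)
      show "dist (\<theta> x) (\<theta> y) \<le> 1 * dist x y" for x y
        using dist_triangle[of c x y] dist_triangle[of c y x] by (auto simp: \<theta>_def dist_real_def dist_commute max_def abs_if)
    qed (auto simp: \<theta>_def)
    have \<theta>pos: "\<theta> x \<ge> 0" "x \<in> ball c R \<Longrightarrow> \<theta> x > 0" for x by (auto simp: \<theta>_def)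
    have \<theta>i: "integrable \<nu> \<theta>" by (rule lipschitz_bump_integrable[OF nv \<theta> R])
    show ?thesis
    proof (cases "(\<integral>x. \<theta> x \<partial>\<nu>) = 0")
      \<comment> \<open>Then \<nu> has no mass on the ball, so that no correction by \<theta> is
        possible, but every integral against \<psi> vanishes.\<close>
      case True
      then have "AE x in \<nu>. \<theta> x = 0" using \<theta>i \<theta>pos by (subst (asm) integral_nonneg_eq_0_iff_AE) auto
      then have "AE x in \<nu>. \<psi> x = 0"
      proof eventually_elim
        case (elim x)
        then show ?case using \<theta>pos(2)[of x] lipschitz_bumpD(2)[OF \<psi>, of x] by force
      qed
      then have z0: "(\<integral>x. \<psi> x *\<^sub>R (u x :: complex ^ 'b) \<partial>\<nu>) = 0" for u
        by (intro integral_eq_zero_AE) (auto elim!: eventually_mono)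
      then show ?thesis
        unfolding T1_pair_def T_pair_eq_Lim A_def by (simp add: tendsto_Lim)
    next
      case False
      define mv where "mv = (\<integral>x. \<theta> x \<partial>\<nu>)"
      have mv: "mv > 0" using False \<theta>pos by (simp add: mv_def less_le integral_nonneg)
      define B0 where "B0 = norm c + R"
      have sub: "x \<notin> ball 0 B0 \<Longrightarrow> x \<notin> ball c R" for x
        using norm_triangle_ineq2[of x c] by (auto simp: B0_def dist_norm norm_minus_commute)
      have lipconv: "(\<lambda>k. g (X k)) \<longlonglongrightarrow> g x" if "lipschitz_bump L' c R g" "X \<longlonglongrightarrow> x" for X x g L'
      proof -
        have "continuous_on UNIV g" using that(1) unfolding lipschitz_bump_def by (blast intro: lipschitz_on_continuous_on)
        then show ?thesis using that(2) by (intro isCont_tendsto_compose[where g=g]) (auto simp: continuous_on_eq_continuous_at)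
      qed
      have conv: "(\<lambda>k. \<integral>x. g x \<partial>N k) \<longlonglongrightarrow> (\<integral>x. g x \<partial>\<nu>)" if g: "lipschitz_bump L' c R g" for g L'
      proof (rule vague_conv_integral(1)[OF vN niceN, where B="2 * L' * R" and R=B0])
        show "norm (g x) \<le> 2 * L' * R" for x using lipschitz_bump_bound[OF g R] by simp
        show "x \<notin> ball 0 B0 \<Longrightarrow> g x = 0" for x using lipschitz_bumpD(2)[OF g] sub by blast
      qed (use lipschitz_bump_measurable[OF g] lipconv[OF g] in auto)
      define m where "m k = (\<integral>x. \<theta> x \<partial>N k)" for k
      have mlim: "m \<longlonglongrightarrow> mv" using conv[OF \<theta>] by (simp add: m_def[abs_def] mv_def)
      define c0 where "c0 k = (\<integral>x. \<psi> x \<partial>N k) / m k" for k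
      have "c0 \<longlonglongrightarrow> 0 / mv"
        unfolding c0_def using conv[OF \<psi>] mz by (intro tendsto_divide mlim) (use mv in auto)
      then have c0: "c0 \<longlonglongrightarrow> 0" by simp
      \<comment> \<open>Capping the coefficient gives the Lipschitz constant L + 1 for every k;
        since \<open>c0\<close> tends to 0, the cap is eventually inactive and the mean is then
        exactly 0.\<close>
      define ck where "ck k = (if \<bar>c0 k\<bar> \<le> 1 then c0 k else 0)" for k
      have ck1: "\<bar>ck k\<bar> \<le> 1" for k by (simp add: ck_def)
      have ck: "ck \<longlonglongrightarrow> 0"
        by (rule Lim_null_comparison[OF _ tendsto_rabs_zero[OF c0]]) (auto simp: ck_def)
      define \<psi>k where "\<psi>k k x = \<psi> x + (- ck k) * \<theta> x" for k x
      have \<psi>k: "lipschitz_bump (L + 1) c R (\<psi>k k)" for k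
      proof -
        have "lipschitz_bump (L + \<bar>- ck k\<bar> * 1) c R (\<lambda>x. \<psi> x + (- ck k) * \<theta> x)"
          by (rule lipschitz_bump_add[OF \<psi> lipschitz_bump_cmult[OF \<theta>]])
        then show ?thesis unfolding \<psi>k_def[abs_def] by (rule lipschitz_bump_mono) (use ck1[of k] in auto)
      qed
      have mzk: "\<forall>\<^sub>F k in sequentially. (\<integral>x. \<psi>k k x \<partial>N k) = 0"
        using order_tendstoD(1)[OF mlim mv] order_tendstoD(2)[OF tendsto_rabs_zero[OF c0] zero_less_one]
      proof eventually_elim
        case (elim k)
        have "(\<integral>x. \<psi>k k x \<partial>N k) = (\<integral>x. \<psi> x \<partial>N k) - c0 k * m k"
          using elim lipschitz_bump_integrable[OF niceN \<psi> R, of k] lipschitz_bump_integrable[OF niceN \<theta> R, of k]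
          unfolding \<psi>k_def m_def by (simp add: ck_def)
        also have "\<dots> = 0" using elim by (simp add: c0_def)
        finally show ?case .
      qed
      obtain C1 where C1: "C1 \<ge> 0" and T1p: "\<And>\<mu> c \<rho> z \<phi> \<kappa> \<psi> L. nice_measure s \<mu> \<Lambda> \<Longrightarrow> 2 * R \<le> \<rho> \<Longrightarrow> cutoff \<mu> c (2 * R) \<phi> \<Longrightarrow> cutoff \<mu> c \<rho> \<kappa> \<Longrightarrow>
        lipschitz_bump L c R \<psi> \<Longrightarrow> (\<integral>x. \<psi> x \<partial>\<mu>) = 0 \<Longrightarrow> z \<in> ball c R \<Longrightarrow>
        norm (T1_pair \<Omega> s \<mu> z \<phi> \<psi> - TT \<mu> \<kappa> \<psi>) \<le> C1 * L * \<rho> powr (- \<alpha>)"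
        using T1_pair_cutoff[OF R \<Lambda>_nonneg] by blast
      define C2 where "C2 = 2 * ((L + 1) * 2 powr s * \<Lambda> * (\<Lambda> * (2 * R) powr s))"
      have C2: "C2 \<ge> 0" using L0 \<Lambda>_nonneg by (simp add: C2_def)
      have bound: "norm (T1_pair \<Omega> s \<nu> z \<phi> \<psi>) \<le> 2 * (C1 * (L + 1) * \<rho> powr (- \<alpha>) + C2 * \<delta>)"
        if \<rho>: "2 * R \<le> \<rho>" and \<delta>: "0 < \<delta>" "\<delta> \<le> R" for \<rho> \<delta>
      proof -
        \<comment> \<open>Unlike the constant 1, \<kappa> is continuous with bounded support, so the
          pairing with this cutoff is accessible to vague convergence; it is an admissible cutoff
          for \<nu> and all blow-ups alike.\<close>
        define \<kappa> where "\<kappa> y = max 0 (min 1 (\<rho> + 1 - dist c y))" for y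
        have \<kappa>01: "0 \<le> \<kappa> y" "\<kappa> y \<le> 1" "y \<in> ball c \<rho> \<Longrightarrow> \<kappa> y = 1" "y \<notin> ball c (\<rho> + 1) \<Longrightarrow> \<kappa> y = 0" for y
          by (auto simp: \<kappa>_def)
        have \<kappa>c: "continuous_on UNIV \<kappa>" unfolding \<kappa>_def[abs_def] by (intro continuous_intros)
        have \<kappa>m [measurable]: "\<kappa> \<in> borel_measurable borel" by (rule borel_measurable_continuous_onI[OF \<kappa>c])
        have cut\<kappa>: "cutoff \<mu>' c \<rho> \<kappa>" if n: "nice_measure s \<mu>' \<Lambda>" for \<mu>'
        proof -
          have "integrable \<mu>' (\<lambda>x. (\<kappa> x)\<^sup>2)"
            by (rule nice_measure_integrable_bounded_support[OF n, where B=1 and c=c and r="\<rho> + 1"])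
               (use \<kappa>01 in \<open>auto simp: abs_square_le_1 abs_le_iff intro: order_trans[OF _ \<kappa>01(1)]\<close>)
          then have "(\<integral>\<^sup>+x. ennreal ((\<kappa> x)\<^sup>2) \<partial>\<mu>') < \<infinity>" by (subst nn_integral_eq_integral) auto
          then show ?thesis using \<kappa>01 by (auto simp: cutoff_def square_integrable_def)
        qed
        have \<kappa>2: "\<kappa> x = 1" if "x \<in> ball c (2 * R)" for x using that \<rho> by (intro \<kappa>01(3)) auto
        have sq: "square_integrable \<mu>' \<kappa>" if "nice_measure s \<mu>' \<Lambda>" for \<mu>' using cut\<kappa>[OF that] by (simp add: cutoff_def)
        have i: "norm (T1_pair \<Omega> s \<nu> z \<phi> \<psi> - TT \<nu> \<kappa> \<psi>) \<le> C1 * (L + 1) * \<rho> powr (- \<alpha>)"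
          by (rule T1p[OF nv \<rho> \<phi> cut\<kappa>[OF nv] _ mz z]) (rule lipschitz_bump_mono[OF \<psi>], auto)
        have ii: "norm (A \<nu> \<delta> \<kappa> \<psi> - TT \<nu> \<kappa> \<psi>) \<le> C2 * \<delta>"
          unfolding C2_def by (rule A_tendsto(2)[OF nv \<Lambda>_nonneg sq[OF nv] \<kappa>2 _ R \<delta>]) (auto intro: lipschitz_bump_mono[OF \<psi>])
        define B1 where "B1 = norm c + (\<rho> + 1)"
        have \<kappa>0: "\<forall>y. y \<notin> ball 0 B1 \<longrightarrow> complex_of_real (\<kappa> y) = 0"
        proof (intro allI impI)
          fix y :: 'a assume "y \<notin> ball 0 B1"
          then have "y \<notin> ball c (\<rho> + 1)" using norm_triangle_ineq2[of y c] by (auto simp: B1_def dist_norm norm_minus_commute)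
          then show "complex_of_real (\<kappa> y) = 0" using \<kappa>01(4) by simp
        qed
        have \<kappa>b: "cmod (complex_of_real (\<kappa> y)) \<le> 1" for y using \<kappa>01[of y] by simp
        have cc: "continuous_on UNIV (\<lambda>y. complex_of_real (\<kappa> y))" by (intro continuous_intros \<kappa>c)
        have cm: "(\<lambda>y. complex_of_real (\<kappa> y)) \<in> borel_measurable borel" by measurable
        note Tb = T_trunc_bounded_support[OF _ \<Lambda>_nonneg \<delta>(1) cm \<kappa>b \<kappa>0]
        define B2 where "B2 = 1 * \<delta> powr (- s) * (\<Lambda> * \<bar>B1\<bar> powr s)"
        have iii: "(\<lambda>k. A (N k) \<delta> \<kappa> (\<psi>k k)) \<longlonglongrightarrow> A \<nu> \<delta> \<kappa> \<psi>"
          unfolding A_def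
        proof (rule vague_conv_integral(1)[OF vN niceN, where B="2 * (L + 1) * R * B2" and R=B0])
          show "(\<lambda>x. \<psi>k k x *\<^sub>R T_trunc \<Omega> s (N k) \<delta> (\<lambda>y. complex_of_real (\<kappa> y)) x) \<in> borel_measurable borel" for k
            by (intro borel_measurable_scaleR lipschitz_bump_measurable[OF \<psi>k] Tb(3)[OF niceN])
          show "(\<lambda>x. \<psi> x *\<^sub>R T_trunc \<Omega> s \<nu> \<delta> (\<lambda>y. complex_of_real (\<kappa> y)) x) \<in> borel_measurable borel"
            by (intro borel_measurable_scaleR lipschitz_bump_measurable[OF \<psi>] Tb(3)[OF nv])
          show "norm (\<psi>k k x *\<^sub>R T_trunc \<Omega> s (N k) \<delta> (\<lambda>y. complex_of_real (\<kappa> y)) x) \<le> 2 * (L + 1) * R * B2" for k x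
            unfolding norm_scaleR B2_def using L0 R
            by (intro mult_mono Tb(4)[OF niceN] lipschitz_bump_bound[OF \<psi>k R]) auto
          show "x \<notin> ball 0 B0 \<Longrightarrow> \<psi>k k x *\<^sub>R T_trunc \<Omega> s (N k) \<delta> (\<lambda>y. complex_of_real (\<kappa> y)) x = 0" for k x
            using lipschitz_bumpD(2)[OF \<psi>k sub] by simp
          fix X and x :: 'a assume X: "X \<longlonglongrightarrow> x"
          have "(\<lambda>k. \<psi>k k (X k)) \<longlonglongrightarrow> \<psi> x + (- 0) * \<theta> x"
            unfolding \<psi>k_def by (intro tendsto_intros lipconv[OF \<psi> X] lipconv[OF \<theta> X] ck)
          then show "(\<lambda>k. \<psi>k k (X k) *\<^sub>R T_trunc \<Omega> s (N k) \<delta> (\<lambda>y. complex_of_real (\<kappa> y)) (X k))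
              \<longlonglongrightarrow> \<psi> x *\<^sub>R T_trunc \<Omega> s \<nu> \<delta> (\<lambda>y. complex_of_real (\<kappa> y)) x"
            by (intro tendsto_scaleR T_trunc_vague[OF vN niceN \<Lambda>_nonneg \<delta>(1) cc \<kappa>b \<kappa>0 X]) simp
        qed
        have "norm (A \<nu> \<delta> \<kappa> \<psi>) \<le> C1 * (L + 1) * \<rho> powr (- \<alpha>) + C2 * \<delta> + e" if e: "e > 0" for e
        proof -
          have L1: "L + 1 \<ge> 0" using L0 by simp
          obtain R' where R': "R' > 0" "\<And>t \<psi>. 0 < t \<Longrightarrow> t < R' \<Longrightarrow> lipschitz_bump (L + 1) c R \<psi> \<Longrightarrow> (\<integral>x. \<psi> x \<partial>blowup s \<mu> x\<^sub>0 t) = 0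
            \<Longrightarrow> norm (TT (blowup s \<mu> x\<^sub>0 t) (\<lambda>_. 1) \<psi>) \<le> e"
            using TT_blowup_small[OF x0 R L1 e, of c] by blast
          have "\<forall>\<^sub>F k in sequentially. norm (A (N k) \<delta> \<kappa> (\<psi>k k)) \<le> C1 * (L + 1) * \<rho> powr (- \<alpha>) + C2 * \<delta> + e"
            using mzk order_tendstoD(2)[OF rlim R'(1)]
          proof eventually_elim
            case (elim k)
            have "norm (TT (N k) (\<lambda>_. 1) (\<psi>k k)) \<le> e"
              using R'(2)[OF r0[of k] elim(2) \<psi>k] elim(1) by (simp add: N_def)
            \<comment> \<open>With cutoff 1 the far-field integral carries the weight 0.\<close>
            moreover have "T1_pair \<Omega> s (N k) z (\<lambda>_. 1) (\<psi>k k) = TT (N k) (\<lambda>_. 1) (\<psi>k k)"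
              by (simp add: T1_pair_def)
            moreover have "norm (T1_pair \<Omega> s (N k) z (\<lambda>_. 1) (\<psi>k k) - TT (N k) \<kappa> (\<psi>k k)) \<le> C1 * (L + 1) * \<rho> powr (- \<alpha>)"
              by (rule T1p[OF niceN \<rho> cut1 cut\<kappa>[OF niceN] \<psi>k elim(1) z])
            moreover have "norm (A (N k) \<delta> \<kappa> (\<psi>k k) - TT (N k) \<kappa> (\<psi>k k)) \<le> C2 * \<delta>"
              unfolding C2_def by (rule A_tendsto(2)[OF niceN \<Lambda>_nonneg sq[OF niceN] \<kappa>2 \<psi>k R \<delta>])
            moreover have "norm a \<le> norm (a - b) + norm (d - b) + norm d" for a b d :: "complex ^ 'b"
              using norm_triangle_ineq2[of a b] norm_triangle_ineq2[of b d] by (simp add: norm_minus_commute)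
            ultimately show ?case by (smt (verit))
          qed
          then show ?thesis by (rule tendsto_upperbound[OF tendsto_norm[OF iii]]) simp
        qed
        then have iv: "norm (A \<nu> \<delta> \<kappa> \<psi>) \<le> C1 * (L + 1) * \<rho> powr (- \<alpha>) + C2 * \<delta>"
          by (rule field_le_epsilon)
        have "norm a \<le> norm (a - b) + norm (d - b) + norm d" for a b d :: "complex ^ 'b"
          using norm_triangle_ineq2[of a b] norm_triangle_ineq2[of b d] by (simp add: norm_minus_commute)
        \<comment> \<open>Both errors occur twice, once for \<nu> and once for the blow-ups in
          \<open>iv\<close>, hence the factor 2 in \<open>bound\<close>.\<close>
        from order_trans[OF this[of "T1_pair \<Omega> s \<nu> z \<phi> \<psi>" "TT \<nu> \<kappa> \<psi>" "A \<nu> \<delta> \<kappa> \<psi>"] add_mono[OF add_mono[OF i ii] iv]]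
        show ?thesis by (simp only: mult_2)
      qed
      \<comment> \<open>The cutoff radius 2R + n and the truncation level R/(n+1) are admissible for
        every n, and both errors tend to 0.\<close>
      have l1: "(\<lambda>n. (2 * R + real n) powr (- \<alpha>)) \<longlonglongrightarrow> 0"
        using \<alpha>_pos by (intro tendsto_neg_powr filterlim_tendsto_add_at_top[OF tendsto_const filterlim_real_sequentially]) auto
      have l2: "(\<lambda>n. R * (1 / real (Suc n))) \<longlonglongrightarrow> 0"
        by (rule tendsto_mult_right_zero[OF LIMSEQ_Suc[OF lim_1_over_n]])
      have "(\<lambda>n. 2 * (C1 * (L + 1) * (2 * R + real n) powr (- \<alpha>) + C2 * (R * (1 / real (Suc n))))) \<longlonglongrightarrow> 2 * (C1 * (L + 1) * 0 + C2 * 0)"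
        by (intro tendsto_intros l1 l2)
      moreover have "norm (T1_pair \<Omega> s \<nu> z \<phi> \<psi>) \<le> 2 * (C1 * (L + 1) * (2 * R + real n) powr (- \<alpha>) + C2 * (R * (1 / real (Suc n))))" for n
        using R by (intro bound) (auto simp: divide_le_eq)
      ultimately have "norm (T1_pair \<Omega> s \<nu> z \<phi> \<psi>) \<le> 2 * (C1 * (L + 1) * 0 + C2 * 0)"
        by (intro LIMSEQ_le_const) auto
      then show ?thesis by simp
    qed
  qed
  show ?thesis
    unfolding reflectionless_def
  proof (intro conjI allI impI)
    show "\<exists>\<Lambda>>0. good_measure \<Omega> s \<nu> \<Lambda>" using goodv \<Lambda>_pos by blast
    fix \<psi> :: "'a \<Rightarrow> real" and c R z \<phi>
    assume h: "(\<exists>L. lipschitz_on L UNIV \<psi>) \<and> R > 0 \<and> closure {x. \<psi> x \<noteq> 0} \<subseteq> ball c R \<and>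
        (\<integral> x. \<psi> x \<partial>\<nu>) = 0 \<and> z \<in> ball c R \<and>
        \<phi> \<in> borel_measurable \<nu> \<and> (\<integral>\<^sup>+ x. ennreal ((\<phi> x)\<^sup>2) \<partial>\<nu>) < \<infinity> \<and>
        (\<forall>x. 0 \<le> \<phi> x \<and> \<phi> x \<le> 1) \<and> (\<forall>x \<in> ball c (2 * R). \<phi> x = 1)"
    then obtain L where L: "L-lipschitz_on UNIV \<psi>" by blast
    have "\<phi> \<in> borel_measurable borel" using h by (simp add: measurable_cong_sets[OF nice_measure_sets[OF nv] refl])
    then have "cutoff \<nu> c (2 * R) \<phi>" using h by (simp add: cutoff_def square_integrable_def)
    then show "T1_pair \<Omega> s \<nu> z \<phi> \<psi> = 0" using h by (intro main[OF L]) auto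
  qed
qed

end

section \<open>Contradiction at a point of positive upper density\<close>

theorem theorem1p1:
  fixes \<Omega> :: "'a::euclidean_space \<Rightarrow> complex ^ 'n"
    and s \<alpha> \<Lambda> :: real and \<mu> :: "'a measure"
  assumes "DIM('a) \<ge> 2"
    and "0 < s" and "s < real DIM('a)"
    and "0 < \<alpha>" and "\<alpha> \<le> 1"
    and "CZ_angular \<alpha> \<Omega>"
    and only_zero: "\<forall>\<nu> :: 'a measure. sets \<nu> = sets borel \<longrightarrow> reflectionless \<Omega> s \<nu>
                      \<longrightarrow> \<nu> = null_measure borel"
    and "\<Lambda> > 0" and "nice_measure s \<mu> \<Lambda>"
    and "hausdorff s (msupp \<mu>) < \<infinity>"
    and "\<exists>\<Lambda>' > 0. good_measure \<Omega> s \<mu> \<Lambda>'"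
  shows "\<mu> = null_measure borel"
proof (rule ccontr)
  assume ne: "\<mu> \<noteq> null_measure borel"
  obtain \<Lambda>' where \<Lambda>': "\<Lambda>' > 0" "good_measure \<Omega> s \<mu> \<Lambda>'" using assms by blast
  have nice: "nice_measure s \<mu> \<Lambda>'" using \<Lambda>' by (simp add: good_measure_def)
  note sb = nice_measure_sets[OF nice]
  have \<Lambda>0: "0 \<le> \<Lambda>'" using \<Lambda>' by simp
  interpret finite_good_measure \<Omega> s \<alpha> \<mu> \<Lambda>'
  proof (intro finite_good_measure.intro CZ_kernel.intro finite_good_measure_axioms.intro)
    show "0 < s" "0 < \<alpha>" "\<alpha> \<le> 1" "CZ_angular \<alpha> \<Omega>" by (fact assms)+
    show "good_measure \<Omega> s \<mu> \<Lambda>'" "\<Lambda>' > 0" by (fact \<Lambda>')+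
    show "emeasure \<mu> UNIV < \<infinity>" by (rule finite_of_hausdorff[OF nice \<Lambda>0 assms(2,10)])
  qed
  have "emeasure \<mu> UNIV \<noteq> 0"
  proof
    assume 0: "emeasure \<mu> UNIV = 0"
    have e: "emeasure \<mu> X = emeasure (null_measure borel) X" if "X \<in> sets \<mu>" for X
      using emeasure_mono[of X UNIV \<mu>] 0 by (simp add: sb)
    have "\<mu> = null_measure borel" by (rule measure_eqI[OF _ e]) (simp_all only: sb sets_null_measure)
    with ne show False by blast
  qed
  then have nt: "\<not> (AE x in \<mu>. False)"
    unfolding eventually_False ae_filter_eq_bot_iff nice_measure_space[OF nice] .
  have AE: "AE x in \<mu>. T1_small_at x \<and> (\<exists>\<epsilon>>0. \<forall>\<rho>>0. \<exists>r. 0 < r \<and> r < \<rho> \<and> ennreal (\<epsilon> * r powr s) < emeasure \<mu> (ball x r))"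
    using AE_T1_small AE_positive_upper_density[OF nice \<Lambda>0 assms(2,10)] unfolding T1_small_at_def by eventually_elim blast
  have "\<exists>x. T1_small_at x \<and> (\<exists>\<epsilon>>0. \<forall>\<rho>>0. \<exists>r. 0 < r \<and> r < \<rho> \<and> ennreal (\<epsilon> * r powr s) < emeasure \<mu> (ball x r))"
  proof (rule ccontr)
    assume "\<not> ?thesis"
    then have "AE x in \<mu>. False" using AE by (elim eventually_mono) blast
    with nt show False by blast
  qed
  then obtain x\<^sub>0 \<epsilon> where x0: "T1_small_at x\<^sub>0" and \<epsilon>: "\<epsilon> > 0"
    and dens: "\<And>\<rho>. \<rho> > 0 \<Longrightarrow> \<exists>r. 0 < r \<and> r < \<rho> \<and> ennreal (\<epsilon> * r powr s) < emeasure \<mu> (ball x\<^sub>0 r)"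
    by blast
  have "\<forall>k::nat. \<exists>r. 0 < r \<and> r < 1 / real (Suc k) \<and> ennreal (\<epsilon> * r powr s) < emeasure \<mu> (ball x\<^sub>0 r)"
    by (intro allI dens) simp
  then obtain r where r: "\<And>k. 0 < r k" "\<And>k. r k < 1 / real (Suc k)" "\<And>k. ennreal (\<epsilon> * r k powr s) < emeasure \<mu> (ball x\<^sub>0 (r k))"
    by metis
  define N where "N k = blowup s \<mu> x\<^sub>0 (r k)" for k
  have niceN: "nice_measure s (N k) \<Lambda>'" for k unfolding N_def by (rule nice_measure_blowup[OF nice \<Lambda>0 r(1)])
  \<comment> \<open>The radii were chosen by the density lower bound, and blowing up normalises it
    to mass at least \<epsilon> in the unit ball.\<close>
  have Nb: "ennreal \<epsilon> \<le> emeasure (N k) (ball 0 1)" for k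
  proof -
    have "ennreal \<epsilon> = ennreal (r k powr (- s)) * ennreal (\<epsilon> * r k powr s)"
      using r(1)[of k] \<epsilon> by (simp add: ennreal_mult[symmetric] powr_minus)
    also have "\<dots> \<le> ennreal (r k powr (- s)) * emeasure \<mu> (ball x\<^sub>0 (r k))"
      using r(3)[of k] by (intro mult_left_mono) auto
    also have "\<dots> = emeasure (N k) (ball 0 1)" unfolding N_def emeasure_blowup_ball[OF sb r(1)] by simp
    finally show ?thesis .
  qed
  have "emeasure (N k) UNIV \<noteq> 0" for k
  proof -
    have "ennreal \<epsilon> \<le> emeasure (N k) UNIV"
      by (rule order_trans[OF Nb emeasure_mono]) (auto simp: nice_measure_sets[OF niceN])
    then show ?thesis using \<epsilon> by auto
  qed
  then obtain \<sigma> \<nu> where \<sigma>: "strict_mono \<sigma>" and v: "vague_conv (\<lambda>j. N (\<sigma> j)) \<nu>"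
    using vague_compactness[where N=N, OF niceN \<Lambda>0 assms(2)] by blast
  have rlim: "r \<longlonglongrightarrow> 0"
    by (rule tendsto_sandwich[OF _ _ tendsto_const LIMSEQ_Suc[OF lim_1_over_n]]) (use r(1,2) in \<open>auto intro!: always_eventually simp: less_imp_le\<close>)
  have "(\<lambda>j. r (\<sigma> j)) \<longlonglongrightarrow> 0" using LIMSEQ_subseq_LIMSEQ[OF rlim \<sigma>] by (simp add: comp_def)
  then have "reflectionless \<Omega> s \<nu>"
    using blowup_limit_reflectionless[OF x0, of "\<lambda>j. r (\<sigma> j)" \<nu>] r(1) v by (simp add: N_def)
  moreover have "sets \<nu> = sets borel" using v by (simp add: vague_conv_def)
  ultimately have \<nu>0: "\<nu> = null_measure borel" using only_zero by blast
  \<comment> \<open>A continuous function above the indicator of the unit ball: its integrals stay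
    at least \<epsilon> along the blow-ups, and so does the integral in the limit, which therefore
    cannot be the zero measure.\<close>
  define f where "f x = max 0 (min 1 (2 - norm x))" for x :: 'a
  have f01: "0 \<le> f x" "f x \<le> 1" "x \<in> ball 0 1 \<Longrightarrow> f x = 1" "x \<notin> ball 0 2 \<Longrightarrow> f x = 0" for x by (auto simp: f_def)
  have fc: "continuous_on UNIV f" unfolding f_def[abs_def] by (intro continuous_intros)
  have fm: "f \<in> borel_measurable borel" by (rule borel_measurable_continuous_onI[OF fc])
  have fb: "norm (f x) \<le> 1" for x using f01[of x] by simp
  have "(\<lambda>j. \<integral>x. f x \<partial>N (\<sigma> j)) \<longlonglongrightarrow> (\<integral>x. f x \<partial>\<nu>)"
  proof (rule vague_conv_integral(1)[OF v niceN fm fm fb f01(4)])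
    show "X \<longlonglongrightarrow> x \<Longrightarrow> (\<lambda>j. f (X j)) \<longlonglongrightarrow> f x" for X x
      using fc by (intro isCont_tendsto_compose[where g=f]) (auto simp: continuous_on_eq_continuous_at)
  qed
  moreover have "\<epsilon> \<le> (\<integral>x. f x \<partial>N k)" for k
  proof -
    have fi: "integrable (N k) f" by (rule nice_measure_integrable_bounded_support[OF niceN fm fb f01(4)])
    have "ennreal \<epsilon> \<le> (\<integral>\<^sup>+x. indicator (ball 0 1) x \<partial>N k)"
      using Nb[of k] by (simp add: nice_measure_sets[OF niceN])
    also have "\<dots> \<le> (\<integral>\<^sup>+x. ennreal (f x) \<partial>N k)"
      using f01(3) by (intro nn_integral_mono) (auto simp: indicator_def)
    also have "\<dots> = ennreal (\<integral>x. f x \<partial>N k)" by (rule nn_integral_eq_integral[OF fi]) (rule AE_I2, rule f01(1))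
    finally have "ennreal \<epsilon> \<le> ennreal (\<integral>x. f x \<partial>N k)" .
    moreover have "0 \<le> (\<integral>x. f x \<partial>N k)" by (rule Bochner_Integration.integral_nonneg) (rule f01(1))
    ultimately show ?thesis by (simp only: ennreal_le_iff)
  qed
  ultimately have "\<epsilon> \<le> (\<integral>x. f x \<partial>\<nu>)" by (intro LIMSEQ_le_const) auto
  then show False using \<epsilon> \<nu>0 by simp
qed

end
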